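(* Suppose that conditions (A1), (A2), (A3) of the context hold. Then, on $\mathbb R^{\tilde E}$ equipped with the product topology, $$\sqrt{M}\,\bigl(\hat{\bm P}(M)-\bm P\bigr)\ \xrightarrow[M\to\infty]{\ \mathrm d\ }\ \mathcal N(\bm 0,V^{\bm P})$$ (convergence in distribution) under $\mathbb P_{i_0}$ for every initial value $i_0\in E$, where the asymptotic variance matrix $V^{\bm P}=(V^{\bm P}_{ee'})_{e,e'\in\tilde E}$ is given by $$V^{\bm P}=\sum_{\tilde e\in\tilde E}\bar q_{\tilde e}\,\bigl(\bm\psi*\bm\delta^{\tilde e}*\bm\psi*\mathcal S\bm q+\bm\psi*\mathcal S\bm\delta^{\tilde e}\bigr)^{\otimes2}-\sum_{\tilde i\in E}\mu_{\tilde i\tilde i}\,\bigl(\bm\psi*\bm q^{\tilde i}*\bm\psi*\mathcal S\bm q+\bm\psi*\mathcal S\bm q^{\tilde i}\bigr)^{\otimes2}.$$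
   Context: $E$ is a finite (nonempty) set, $\mathbb N=\{0,1,2,\dots\}$, $\tilde E:=E\times E\times\mathbb N$. Let $\bm q=(q_{ij}(k))_{(i,j,k)\in\tilde E}$ be nonnegative numbers with $q_{ij}(0)=0$ for all $i,j\in E$ and $\sum_{j\in E}\sum_{k\in\mathbb N}q_{ij}(k)=1$ for all $i\in E$. Markov renewal chain: for each $i_0\in E$, under the probability $\mathbb P_{i_0}$ (expectation $\mathbb E_{i_0}$), $(J_n,S_n)_{n\ge0}$ is an $E\times\mathbb N$-valued process with $J_0=i_0$, $S_0=X_0=0$, $X_n:=S_n-S_{n-1}$ for $n\ge1$, such that $(J_n,X_n)_{n\ge 0}$ is a Markov chain with $\mathbb P_{i_0}(J_{n+1}=j,\,X_{n+1}=k\mid J_n=i,\,X_n)=q_{ij}(k)$. Let $\tau_j=\inf\{n\ge1:J_n=j\}$. Conditions: (A1) the embedded Markov chain $J$ is irreducible: $\mathbb P_i(\tau_j<\infty)>0$ for all $i,j\in E$. (A2) aperiodicity: for all $i\in E$, the greatest common divisor of $\{k\in\mathbb N:\mathbb P_i(S_{\tau_i}=k)>0\}$ is one. (A3) positive recurrence: $\mu_{ii}:=\mathbb E_i S_{\tau_i}<\infty$ for all $i\in E$. Estimator of $\bm q$: for $M\in\mathbb N$, $N(M):=\max\{n\in\mathbb N:S_n\le M\}$, $N_i(M):=\sum_{n=1}^{N(M)}1_{\{J_{n-1}=i\}}$, and $\hat{\bm q}(M)=(\hat q_{ij}(k,M))_{(i,j,k)\in\tilde E}$ with $\hat q_{ij}(k,M):=\frac1{N_i(M)}\sum_{n=1}^{N(M)}1_{\{J_{n-1}=i,\,J_n=j,\,X_n=k\}}$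 (interpreted as $0$ when $N_i(M)=0$). Matrix convolution: for matrix sequences $\bm A=(A_{ij}(k))_{(i,j,k)\in\tilde E}$, $\bm B=(B_{ij}(k))_{(i,j,k)\in\tilde E}$, $(\bm A*\bm B)_{ij}(k):=\sum_{l=0}^k\sum_{u\in E}A_{iu}(l)B_{uj}(k-l)$. $\bm{\delta I}$ is the identity for $*$ (identity matrix at $k=0$, zero matrix for $k\ge1$). $\bm A^{(0)}=\bm{\delta I}$, $\bm A^{(n)}=\bm A*\bm A^{(n-1)}$ for $n\ge 1$. When $\bm A^{(n)}(k)=\bm0$ for all $n>k$ (true if $\bm A(0)=\bm0$), $(\bm{\delta I}-\bm A)^{(-1)}:=\sum_{n\ge0}\bm A^{(n)}$. Set $\bm\psi:=(\bm{\delta I}-\bm q)^{(-1)}$ and $\hat{\bm\psi}(M):=(\bm{\delta I}-\hat{\bm q}(M))^{(-1)}$. Operator $\mathcal S$: for a (possibly random) matrix sequence $\bm A$ such that $\lim_{K\to\infty}\sum_{j\in E}\sum_{k\le K}A_{ij}(k)$ exists in $L^2$ for all $i\in E$, $(\mathcal S\bm A)_{ij}(k):=1_{\{i=j\}}\lim_{K\to\infty}\sum_{j'\in E}\sum_{k<k'\le K}A_{ij'}(k')$ in $L^2$. Semi-Markov chain: $Z_k:=J_{N(k)}$ for $k\in\mathbb N$. Its distribution matrix sequence is $\bm P=(P_{ij}(k))_{(i,j,k)\in\tilde E}$, $P_{ij}(k):=\mathbb P_i(Z_k=j)$ (one has $\bm P=\bm\psi*\mathcal S\bm q$), and its estimator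 is $\hat{\bm P}(M):=\hat{\bm\psi}(M)*\mathcal S\hat{\bm q}(M)$. Further notation: $\bar q_{(i,j,k)}:=\mu_{ii}q_{ij}(k)$; $\bm q^{\tilde i}$ is the matrix sequence $q^{\tilde i}_{ij}(k)=1_{\{i=\tilde i\}}q_{ij}(k)$; $\bm\delta^{\tilde e}$ is the matrix sequence with $\delta^{\tilde e}_e=1_{\{e=\tilde e\}}$, $e\in\tilde E$; for matrix sequences, $\bm A\otimes\bm B:=(A_eB_{e'})_{e,e'\in\tilde E}$ and $\bm A^{\otimes2}:=\bm A\otimes\bm A$. For a nonnegative definite matrix $V=(V_{ee'})_{e,e'\in\tilde E}$, $\mathcal N(\bm0,V)$ is the law on $\mathbb R^{\tilde E}$ of a centered Gaussian system $(Y_e)_{e\in\tilde E}$ with $\mathbb E\,Y_eY_{e'}=V_{ee'}$. *)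

theory Defs
  imports "HOL-Probability.Probability"
begin

section \<open>Matrix sequences and convolution\<close>

text \<open>
  The finite nonempty state space is the type \<open>'e :: finite\<close>. A matrix sequence is a real function
  on \<open>'e \<times> 'e \<times> nat\<close>; the type of these functions carries the product topology.
\<close>

type_synonym 'e mseq = "'e \<times> 'e \<times> nat \<Rightarrow> real"

definition mconv :: "'e::finite mseq \<Rightarrow> 'e mseq \<Rightarrow> 'e mseq"  (infixl \<open>\<circledast>\<close> 70)
  where "A \<circledast> B = (\<lambda>(i, j, k). \<Sum>l\<le>k. \<Sum>u\<in>UNIV. A (i, u, l) * B (u, j, k - l))"

definition mconv_id :: "'e::finite mseq"
  where "mconv_id = (\<lambda>(i, j, k). if i = j \<and> k = 0 then 1 else 0)"

primrec mconv_power :: "'e::finite mseq \<Rightarrow> nat \<Rightarrow> 'e mseq"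
  where
    "mconv_power A 0 = mconv_id"
  | "mconv_power A (Suc n) = A \<circledast> mconv_power A n"

text \<open>
  The inverse of \<open>mconv_id - A\<close>. If \<open>A\<close> vanishes at lag \<open>0\<close>, then every entry of the series below
  is a finite sum.
\<close>

definition mconv_inv :: "'e::finite mseq \<Rightarrow> 'e mseq"
  where "mconv_inv A = (\<lambda>e. \<Sum>n. mconv_power A n e)"

definition mplus :: "'e mseq \<Rightarrow> 'e mseq \<Rightarrow> 'e mseq"  (infixl \<open>\<oplus>\<^sub>m\<close> 65)
  where "A \<oplus>\<^sub>m B = (\<lambda>e. A e + B e)"

definition mtensor :: "'e mseq \<Rightarrow> 'e mseq \<Rightarrow> ('e \<times> 'e \<times> nat) \<times> ('e \<times> 'e \<times> nat) \<Rightarrow> real"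
  where "mtensor A B = (\<lambda>(e, e'). A e * B e')"

definition unit_mseq :: "'e \<times> 'e \<times> nat \<Rightarrow> 'e mseq"
  where "unit_mseq e' = (\<lambda>e. if e = e' then 1 else 0)"

definition restrict_row :: "'e mseq \<Rightarrow> 'e \<Rightarrow> 'e mseq"
  where "restrict_row q i' = (\<lambda>(i, j, k). if i = i' then q (i, j, k) else 0)"


section \<open>The survival operator\<close>

definition tail_partial_sum :: "'e::finite mseq \<Rightarrow> 'e \<Rightarrow> nat \<Rightarrow> nat \<Rightarrow> real"
  where "tail_partial_sum A i k K = (\<Sum>j\<in>UNIV. \<Sum>k'\<in>{k<..K}. A (i, j, k'))"

text \<open>For a deterministic matrix sequence the \<open>L\<^sup>2\<close> limit is the limit of real numbers.\<close>

definition survival :: "'e::finite mseq \<Rightarrow> 'e mseq"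
  where "survival A = (\<lambda>(i, j, k). if i = j then lim (tail_partial_sum A i k) else 0)"

definition L2_tendsto :: "'w measure \<Rightarrow> (nat \<Rightarrow> 'w \<Rightarrow> real) \<Rightarrow> ('w \<Rightarrow> real) \<Rightarrow> bool"
  where "L2_tendsto M X Y \<longleftrightarrow>
    (\<forall>n. X n \<in> borel_measurable M \<and> integrable M (\<lambda>\<omega>. (X n \<omega>)\<^sup>2)) \<and>
    Y \<in> borel_measurable M \<and> integrable M (\<lambda>\<omega>. (Y \<omega>)\<^sup>2) \<and>
    (\<lambda>n. \<integral>\<omega>. (X n \<omega> - Y \<omega>)\<^sup>2 \<partial>M) \<longlonglongrightarrow> 0"

text \<open>
  An \<open>L\<^sup>2\<close> limit is determined only up to null sets; \<open>L2_lim\<close> selects an arbitrary version.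
\<close>

definition L2_lim :: "'w measure \<Rightarrow> (nat \<Rightarrow> 'w \<Rightarrow> real) \<Rightarrow> 'w \<Rightarrow> real"
  where "L2_lim M X = (SOME Y. L2_tendsto M X Y)"

definition random_survival :: "'w measure \<Rightarrow> ('w \<Rightarrow> 'e::finite mseq) \<Rightarrow> 'w \<Rightarrow> 'e mseq"
  where "random_survival M A = (\<lambda>\<omega> (i, j, k).
    if i = j then L2_lim M (\<lambda>K \<omega>'. tail_partial_sum (A \<omega>') i k K) \<omega> else 0)"


section \<open>Markov renewal chains\<close>

definition semi_markov_kernel :: "'e::finite mseq \<Rightarrow> bool"
  where "semi_markov_kernel q \<longleftrightarrow>
    (\<forall>e. 0 \<le> q e) \<and> (\<forall>i j. q (i, j, 0) = 0) \<and>
    (\<forall>i. (\<lambda>k. \<Sum>j\<in>UNIV. q (i, j, k)) sums 1)"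

text \<open>
  The increments \<open>X\<close>. The value at \<open>n = 0\<close> is \<open>0\<close>. For \<open>n \<ge> 1\<close> the subtraction is truncated, but
  under the Markov property below with \<open>q (i, j, 0) = 0\<close> the truncated difference is almost surely
  positive, hence almost surely the genuine one.
\<close>

definition sojourn :: "(nat \<Rightarrow> 'w \<Rightarrow> nat) \<Rightarrow> nat \<Rightarrow> 'w \<Rightarrow> nat"
  where "sojourn S n \<omega> = S n \<omega> - S (n - 1) \<omega>"

text \<open>
  The Markov property is conditioned on the full history of \<open>(J, X)\<close> up to time \<open>n\<close>.
  \<open>Pr i\<close> is the probability under which the chain starts at \<open>i\<close>.
\<close>

definition markov_renewal_chain ::
  "'e::finite mseq \<Rightarrow> ('e \<Rightarrow> 'w measure) \<Rightarrow> (nat \<Rightarrow> 'w \<Rightarrow> 'e) \<Rightarrow> (nat \<Rightarrow> 'w \<Rightarrow> nat) \<Rightarrow> bool"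
  where "markov_renewal_chain q Pr J S \<longleftrightarrow>
    semi_markov_kernel q \<and>
    (\<forall>i\<^sub>0. prob_space (Pr i\<^sub>0) \<and>
      (\<forall>n. J n \<in> measurable (Pr i\<^sub>0) (count_space UNIV)) \<and>
      (\<forall>n. S n \<in> measurable (Pr i\<^sub>0) (count_space UNIV)) \<and>
      (AE \<omega> in Pr i\<^sub>0. J 0 \<omega> = i\<^sub>0 \<and> S 0 \<omega> = 0) \<and>
      (\<forall>n js xs j k.
        measure (Pr i\<^sub>0) {\<omega> \<in> space (Pr i\<^sub>0). \<forall>m\<le>n. J m \<omega> = js m \<and> sojourn S m \<omega> = xs m} > 0 \<longrightarrow>
        cond_prob (Pr i\<^sub>0)
          (\<lambda>\<omega>. J (Suc n) \<omega> = j \<and> sojourn S (Suc n) \<omega> = k)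
          (\<lambda>\<omega>. \<forall>m\<le>n. J m \<omega> = js m \<and> sojourn S m \<omega> = xs m)
        = q (js n, j, k)))"

definition hit_time :: "(nat \<Rightarrow> 'w \<Rightarrow> 'e) \<Rightarrow> 'e \<Rightarrow> 'w \<Rightarrow> enat"
  where "hit_time J j \<omega> = Inf {enat n | n. 1 \<le> n \<and> J n \<omega> = j}"

definition S_at_hit :: "(nat \<Rightarrow> 'w \<Rightarrow> 'e) \<Rightarrow> (nat \<Rightarrow> 'w \<Rightarrow> nat) \<Rightarrow> 'e \<Rightarrow> 'w \<Rightarrow> enat"
  where "S_at_hit J S j \<omega> = (case hit_time J j \<omega> of enat n \<Rightarrow> enat (S n \<omega>) | \<infinity> \<Rightarrow> \<infinity>)"

definition chain_irreducible :: "('e \<Rightarrow> 'w measure) \<Rightarrow> (nat \<Rightarrow> 'w \<Rightarrow> 'e) \<Rightarrow> bool"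
  where "chain_irreducible Pr J \<longleftrightarrow>
    (\<forall>i j. measure (Pr i) {\<omega> \<in> space (Pr i). hit_time J j \<omega> < \<infinity>} > 0)"

definition chain_aperiodic ::
  "('e \<Rightarrow> 'w measure) \<Rightarrow> (nat \<Rightarrow> 'w \<Rightarrow> 'e) \<Rightarrow> (nat \<Rightarrow> 'w \<Rightarrow> nat) \<Rightarrow> bool"
  where "chain_aperiodic Pr J S \<longleftrightarrow>
    (\<forall>i. Gcd {k :: nat. measure (Pr i) {\<omega> \<in> space (Pr i). S_at_hit J S i \<omega> = enat k} > 0} = 1)"

definition mean_recurrence ::
  "('e \<Rightarrow> 'w measure) \<Rightarrow> (nat \<Rightarrow> 'w \<Rightarrow> 'e) \<Rightarrow> (nat \<Rightarrow> 'w \<Rightarrow> nat) \<Rightarrow> 'e \<Rightarrow> ennreal"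
  where "mean_recurrence Pr J S i = (\<integral>\<^sup>+\<omega>. ennreal_of_enat (S_at_hit J S i \<omega>) \<partial>Pr i)"

definition chain_positive_recurrent ::
  "('e \<Rightarrow> 'w measure) \<Rightarrow> (nat \<Rightarrow> 'w \<Rightarrow> 'e) \<Rightarrow> (nat \<Rightarrow> 'w \<Rightarrow> nat) \<Rightarrow> bool"
  where "chain_positive_recurrent Pr J S \<longleftrightarrow> (\<forall>i. mean_recurrence Pr J S i < \<infinity>)"


section \<open>Counting processes, estimators and the semi-Markov chain\<close>

text \<open>
  The set below is almost surely finite and nonempty, because \<open>S\<close> starts at \<open>0\<close> and is almost
  surely strictly increasing.
\<close>

definition renewal_count :: "(nat \<Rightarrow> 'w \<Rightarrow> nat) \<Rightarrow> nat \<Rightarrow> 'w \<Rightarrow> nat"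
  where "renewal_count S m \<omega> = Max {n. S n \<omega> \<le> m}"

definition visit_count ::
  "(nat \<Rightarrow> 'w \<Rightarrow> 'e) \<Rightarrow> (nat \<Rightarrow> 'w \<Rightarrow> nat) \<Rightarrow> 'e \<Rightarrow> nat \<Rightarrow> 'w \<Rightarrow> real"
  where "visit_count J S i m \<omega> =
    (\<Sum>n = 1..renewal_count S m \<omega>. if J (n - 1) \<omega> = i then 1 else 0)"

text \<open>Division by zero yields \<open>0\<close>, which is the convention for states not yet visited.\<close>

definition q_hat ::
  "(nat \<Rightarrow> 'w \<Rightarrow> 'e) \<Rightarrow> (nat \<Rightarrow> 'w \<Rightarrow> nat) \<Rightarrow> nat \<Rightarrow> 'w \<Rightarrow> 'e mseq"
  where "q_hat J S m \<omega> = (\<lambda>(i, j, k). 1 / visit_count J S i m \<omega> *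
    (\<Sum>n = 1..renewal_count S m \<omega>.
      if J (n - 1) \<omega> = i \<and> J n \<omega> = j \<and> sojourn S n \<omega> = k then 1 else 0))"

definition semi_markov_chain ::
  "(nat \<Rightarrow> 'w \<Rightarrow> 'e) \<Rightarrow> (nat \<Rightarrow> 'w \<Rightarrow> nat) \<Rightarrow> nat \<Rightarrow> 'w \<Rightarrow> 'e"
  where "semi_markov_chain J S k \<omega> = J (renewal_count S k \<omega>) \<omega>"

definition P_mseq ::
  "('e \<Rightarrow> 'w measure) \<Rightarrow> (nat \<Rightarrow> 'w \<Rightarrow> 'e) \<Rightarrow> (nat \<Rightarrow> 'w \<Rightarrow> nat) \<Rightarrow> 'e mseq"
  where "P_mseq Pr J S = (\<lambda>(i, j, k).
    measure (Pr i) {\<omega> \<in> space (Pr i). semi_markov_chain J S k \<omega> = j})"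

text \<open>The estimator depends on the measure \<open>M\<close> only through the version of the \<open>L\<^sup>2\<close> limit.\<close>

definition P_hat ::
  "'w measure \<Rightarrow> (nat \<Rightarrow> 'w \<Rightarrow> 'e::finite) \<Rightarrow> (nat \<Rightarrow> 'w \<Rightarrow> nat) \<Rightarrow> nat \<Rightarrow> 'w \<Rightarrow> 'e mseq"
  where "P_hat M J S m \<omega> =
    mconv_inv (q_hat J S m \<omega>) \<circledast> random_survival M (q_hat J S m) \<omega>"


section \<open>The asymptotic variance\<close>

definition V_unit :: "'e::finite mseq \<Rightarrow> 'e \<times> 'e \<times> nat \<Rightarrow> 'e mseq"
  where "V_unit q e' =
    (mconv_inv q \<circledast> unit_mseq e' \<circledast> mconv_inv q \<circledast> survival q)
      \<oplus>\<^sub>m (mconv_inv q \<circledast> survival (unit_mseq e'))"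

definition V_row :: "'e::finite mseq \<Rightarrow> 'e \<Rightarrow> 'e mseq"
  where "V_row q i' =
    (mconv_inv q \<circledast> restrict_row q i' \<circledast> mconv_inv q \<circledast> survival q)
      \<oplus>\<^sub>m (mconv_inv q \<circledast> survival (restrict_row q i'))"

text \<open>The weights \<open>\<mu>\<^sub>i\<^sub>i * q\<^sub>i\<^sub>j(k)\<close>.\<close>

definition q_bar :: "'e mseq \<Rightarrow> ('e \<Rightarrow> real) \<Rightarrow> 'e mseq"
  where "q_bar q \<mu> = (\<lambda>(i, j, k). \<mu> i * q (i, j, k))"

definition V_P ::
  "'e::finite mseq \<Rightarrow> ('e \<Rightarrow> real) \<Rightarrow> ('e \<times> 'e \<times> nat) \<times> ('e \<times> 'e \<times> nat) \<Rightarrow> real"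
  where "V_P q \<mu> = (\<lambda>ee.
    (\<Sum>\<^sub>\<infinity>e'\<in>UNIV. q_bar q \<mu> e' * mtensor (V_unit q e') (V_unit q e') ee)
    - (\<Sum>i'\<in>UNIV. \<mu> i' * mtensor (V_row q i') (V_row q i') ee))"


section \<open>Gaussian laws and convergence in distribution on a function space\<close>

text \<open>
  A law on \<open>'i \<Rightarrow> real\<close> is centered Gaussian if every finite linear combination of the coordinates
  is centered normal, the point mass at \<open>0\<close> being allowed.
\<close>

definition centered_gaussian_law :: "('i::countable \<times> 'i \<Rightarrow> real) \<Rightarrow> ('i \<Rightarrow> real) measure \<Rightarrow> bool"
  where "centered_gaussian_law V \<gamma> \<longleftrightarrow>
    prob_space \<gamma> \<and> sets \<gamma> = sets borel \<and>
    (\<forall>F c. finite F \<longrightarrow>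
      (AE y in \<gamma>. (\<Sum>e\<in>F. c e * y e) = 0) \<or>
      (\<exists>\<sigma>>0. distributed \<gamma> lborel (\<lambda>y. \<Sum>e\<in>F. c e * y e) (\<lambda>x. ennreal (normal_density 0 \<sigma> x)))) \<and>
    (\<forall>e e'. (\<integral>y. y e * y e' \<partial>\<gamma>) = V (e, e'))"

definition converges_in_distribution ::
  "'w measure \<Rightarrow> (nat \<Rightarrow> 'w \<Rightarrow> 'b::topological_space) \<Rightarrow> 'b measure \<Rightarrow> bool"
  where "converges_in_distribution M Y \<gamma> \<longleftrightarrow>
    (\<forall>n. Y n \<in> borel_measurable M) \<and>
    (\<forall>f :: 'b \<Rightarrow> real. continuous_on UNIV f \<and> bounded (range f) \<longrightarrow>
      (\<lambda>n. \<integral>\<omega>. f (Y n \<omega>) \<partial>M) \<longlonglongrightarrow> (\<integral>y. f y \<partial>\<gamma>))"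

end

theory Submission
  imports Defs
begin

text \<open>
  The error \<open>P_hat - P\<close> is linear in \<open>q_hat - q\<close> up to a term of second order, because
  \<open>\<psi>_hat - \<psi> = \<psi> * (q_hat - q) * \<psi>_hat\<close>. Its linear part is an average of centered functions of the
  transitions, weighted by \<open>M / N\<^sub>i(M)\<close>, and every entry at lag \<open>k\<close> involves only lags up to \<open>k\<close> and the row
  sums of \<open>q_hat\<close>. Stopping at the stopping time \<open>N(M) + 1\<close> turns these averages into martingales. The
  weights converge to \<open>\<mu>\<^sub>i\<^sub>i\<close> by a law of large numbers that rests on the Poisson equation for the hitting
  times of \<open>i\<close>. The central limit theorem follows by compensating the characteristic function step by
  step. Convergence on the countable product is reduced to characteristic functions of finite
  linear combinations by the Stone--Weierstrass theorem on the cube.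
\<close>

section \<open>Weak convergence on countable products\<close>

lemma (in real_distribution) tail_small:
  assumes "0 < \<epsilon>"
  shows "\<exists>R. measure M {x. R < \<bar>x\<bar>} < \<epsilon>"
proof -
  have "(\<lambda>k. measure M {x. real k < \<bar>x\<bar>}) \<longlonglongrightarrow> measure M (\<Inter>k. {x. real k < \<bar>x\<bar>})"
    by (rule finite_Lim_measure_decseq) (auto simp: decseq_def)
  moreover have "(\<Inter>k. {x::real. real k < \<bar>x\<bar>}) = {}"
    using reals_Archimedean2 by (fastforce dest: less_asym)
  ultimately have "(\<lambda>k. measure M {x. real k < \<bar>x\<bar>}) \<longlonglongrightarrow> 0" by simp
  from order_tendstoD(2)[OF this assms] show ?thesis
    by (auto simp: eventually_sequentially)
qed

lemma weak_conv_uniformly_tight: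
  fixes M :: "nat \<Rightarrow> real measure"
  assumes M: "\<And>n. real_distribution (M n)" and M': "real_distribution M'"
    and conv: "weak_conv_m M M'" and "0 < \<epsilon>"
  shows "\<exists>R>0. (\<forall>n. measure (M n) {x. R < \<bar>x\<bar>} \<le> \<epsilon>) \<and> measure M' {x. R < \<bar>x\<bar>} \<le> \<epsilon>"
proof -
  interpret M': real_distribution M' by fact
  interpret Mn: real_distribution "M n" for n by fact
  obtain R0 where R0: "measure M' {x. R0 < \<bar>x\<bar>} < \<epsilon>"
    using M'.tail_small \<open>0 < \<epsilon>\<close> by blast
  define f where "f x = min 1 (max 0 (\<bar>x\<bar> - R0))" for x :: real
  have f: "isCont f x" "norm (f x) \<le> 1" "0 \<le> f x" for x
    by (auto simp: f_def[abs_def] intro!: continuous_intros)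
  have [measurable]: "f \<in> borel_measurable borel"
    unfolding f_def by measurable
  have inti: "integrable M' (indicator {x. s < \<bar>x\<bar>} :: real \<Rightarrow> real)"
    "integrable (M n) (indicator {x. s < \<bar>x\<bar>} :: real \<Rightarrow> real)" for n s
    by (rule M'.integrable_const_bound[where B=1] Mn.integrable_const_bound[where B=1]; simp add: indicator_def)+
  have intf: "integrable M' f" "integrable (M n) f" for n
    by (rule M'.integrable_const_bound[where B=1] Mn.integrable_const_bound[where B=1]; use f in auto)+
  have "(\<lambda>n. integral\<^sup>L (M n) f) \<longlonglongrightarrow> integral\<^sup>L M' f"
    by (rule weak_conv_imp_integral_bdd_continuous_conv[OF M M' conv, where B=1]) (use f in auto)
  moreover have "integral\<^sup>L M' f \<le> (\<integral>x. indicator {x. R0 < \<bar>x\<bar>} x \<partial>M')"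
    by (rule integral_mono) (auto simp: f_def split: split_indicator intro: intf inti)
  then have "integral\<^sup>L M' f < \<epsilon>" using R0 by simp
  ultimately have "eventually (\<lambda>n. integral\<^sup>L (M n) f < \<epsilon>) sequentially"
    by (rule order_tendstoD(2))
  then obtain N where N: "\<And>n. n \<ge> N \<Longrightarrow> integral\<^sup>L (M n) f < \<epsilon>"
    by (auto simp: eventually_sequentially)
  have late: "measure (M n) {x. R0 + 1 < \<bar>x\<bar>} \<le> \<epsilon>" if "n \<ge> N" for n
  proof -
    have "(\<integral>x. indicator {x. R0 + 1 < \<bar>x\<bar>} x \<partial>(M n)) \<le> integral\<^sup>L (M n) f"
      by (rule integral_mono) (auto simp: f_def split: split_indicator intro: intf inti)
    with N[OF that] show ?thesis by simp
  qed
  have "\<forall>n. \<exists>R. measure (M n) {x. R < \<bar>x\<bar>} < \<epsilon>"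
    using Mn.tail_small \<open>0 < \<epsilon>\<close> by blast
  then obtain r where r: "\<And>n. measure (M n) {x. r n < \<bar>x\<bar>} < \<epsilon>" by metis
  define R where "R = Max (insert 1 (insert (R0 + 1) (r ` {..<N})))"
  have R: "1 \<le> R" "R0 + 1 \<le> R" "n < N \<Longrightarrow> r n \<le> R" for n
    unfolding R_def by (rule Max_ge; auto)+
  have mono': "measure M' {x. R < \<bar>x\<bar>} \<le> measure M' {x. s < \<bar>x\<bar>}" if "s \<le> R" for s
    by (rule M'.finite_measure_mono) (use that in auto)
  have mono: "measure (M n) {x. R < \<bar>x\<bar>} \<le> measure (M n) {x. s < \<bar>x\<bar>}" if "s \<le> R" for s n
    by (rule Mn.finite_measure_mono) (use that in auto)
  have "measure (M n) {x. R < \<bar>x\<bar>} \<le> \<epsilon>" for n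
  proof (cases "n < N")
    case True
    show ?thesis using mono[OF R(3)[OF True], of n] r[of n] by linarith
  next
    case False
    then show ?thesis using mono[OF R(2), of n] late[of n] by linarith
  qed
  moreover have "measure M' {x. R < \<bar>x\<bar>} \<le> \<epsilon>"
    using mono'[of R0] R(2) R0 by linarith
  ultimately show ?thesis using R(1) by (intro exI[of _ R]) auto
qed

definition linear_forms :: "(('i \<Rightarrow> real) \<Rightarrow> real) set"
  where "linear_forms = {l. \<exists>F c. finite F \<and> l = (\<lambda>y. \<Sum>e\<in>F. c e * y e)}"

lemma linear_forms_combine:
  assumes "l \<in> linear_forms" "l' \<in> linear_forms"
  shows "(\<lambda>y. l y + a * l' y) \<in> linear_forms"
proof -
  obtain F c F' c' where F: "finite F" "finite F'"
    and l: "l = (\<lambda>y. \<Sum>e\<in>F. c e * y e)" "l' = (\<lambda>y. \<Sum>e\<in>F'. c' e * y e)"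
    using assms by (auto simp: linear_forms_def)
  have "l y = (\<Sum>e\<in>F \<union> F'. (if e \<in> F then c e else 0) * y e)"
    "l' y = (\<Sum>e\<in>F \<union> F'. (if e \<in> F' then c' e else 0) * y e)" for y
    unfolding l by (rule sum.mono_neutral_cong_left; use F in auto)+
  then have "(\<lambda>y. l y + a * l' y) =
      (\<lambda>y. \<Sum>e\<in>F \<union> F'. ((if e \<in> F then c e else 0) + a * (if e \<in> F' then c' e else 0)) * y e)"
    by (simp add: sum.distrib sum_distrib_left algebra_simps)
  then show ?thesis using F unfolding linear_forms_def
    by (intro CollectI exI[of _ "F \<union> F'"] exI conjI) auto
qed

lemma linear_forms_coordinate: "(\<lambda>y. a * y e) \<in> linear_forms"
  unfolding linear_forms_def by (intro CollectI exI[of _ "{e}"] exI[of _ "\<lambda>_. a"]) auto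

lemma linear_forms_measurable:
  fixes l :: "('i::countable \<Rightarrow> real) \<Rightarrow> real"
  assumes "l \<in> linear_forms"
  shows "l \<in> borel_measurable borel"
  using assms unfolding linear_forms_def
  by (auto intro!: borel_measurable_sum borel_measurable_times measurable_product_coordinates)

inductive_set trig_polynomials :: "(('i \<Rightarrow> real) \<Rightarrow> real) set"
  where
    cos: "l \<in> linear_forms \<Longrightarrow> (\<lambda>y. cos (l y)) \<in> trig_polynomials"
  | sin: "l \<in> linear_forms \<Longrightarrow> (\<lambda>y. sin (l y)) \<in> trig_polynomials"
  | scale: "g \<in> trig_polynomials \<Longrightarrow> (\<lambda>y. a * g y) \<in> trig_polynomials"
  | add: "g \<in> trig_polynomials \<Longrightarrow> h \<in> trig_polynomials \<Longrightarrow> (\<lambda>y. g y + h y) \<in> trig_polynomials"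

lemma trig_polynomials_const: "(\<lambda>_. a) \<in> trig_polynomials"
proof -
  have "(\<lambda>_. 0) \<in> linear_forms"
    by (auto simp: linear_forms_def intro!: exI[of _ "{}"])
  from trig_polynomials.scale[OF trig_polynomials.cos[OF this], of a] show ?thesis by simp
qed

lemma trig_polynomials_sincos_mult:
  assumes "l \<in> linear_forms" "h \<in> trig_polynomials"
  shows "(\<lambda>y. cos (l y) * h y) \<in> trig_polynomials \<and> (\<lambda>y. sin (l y) * h y) \<in> trig_polynomials"
  using assms(2)
proof induction
  case (cos l')
  note p = linear_forms_combine[OF assms(1) cos, of 1] and m = linear_forms_combine[OF assms(1) cos, of "-1"]
  have eq: "(\<lambda>y. cos (l y) * cos (l' y)) =
      (\<lambda>y. 1/2 * cos (l y + 1 * l' y) + 1/2 * cos (l y + -1 * l' y))"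
    "(\<lambda>y. sin (l y) * cos (l' y)) =
      (\<lambda>y. 1/2 * sin (l y + 1 * l' y) + 1/2 * sin (l y + -1 * l' y))"
    by (simp_all add: fun_eq_iff cos_add cos_diff sin_add sin_diff add_divide_distrib diff_divide_distrib)
  show ?case unfolding eq
    by (intro conjI trig_polynomials.add trig_polynomials.scale trig_polynomials.cos trig_polynomials.sin p m)
next
  case (sin l')
  note p = linear_forms_combine[OF assms(1) sin, of 1] and m = linear_forms_combine[OF assms(1) sin, of "-1"]
  have eq: "(\<lambda>y. cos (l y) * sin (l' y)) =
      (\<lambda>y. 1/2 * sin (l y + 1 * l' y) + (-1/2) * sin (l y + -1 * l' y))"
    "(\<lambda>y. sin (l y) * sin (l' y)) =
      (\<lambda>y. (-1/2) * cos (l y + 1 * l' y) + 1/2 * cos (l y + -1 * l' y))"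
    by (simp_all add: fun_eq_iff cos_add cos_diff sin_add sin_diff add_divide_distrib diff_divide_distrib)
  show ?case unfolding eq
    by (intro conjI trig_polynomials.add trig_polynomials.scale trig_polynomials.cos trig_polynomials.sin p m)
next
  case (scale g a)
  have eq: "(\<lambda>y. u (l y) * (a * g y)) = (\<lambda>y. a * (u (l y) * g y))" for u by auto
  show ?case unfolding eq using scale by (auto intro: trig_polynomials.scale)
next
  case (add g h)
  then show ?case by (auto simp: distrib_left intro: trig_polynomials.add)
qed

lemma trig_polynomials_mult:
  assumes "g \<in> trig_polynomials" "h \<in> trig_polynomials"
  shows "(\<lambda>y. g y * h y) \<in> trig_polynomials"
  using assms(1)
proof induction
  case (scale g a)
  then show ?case using trig_polynomials.scale[of "\<lambda>y. g y * h y" a] by (simp add: mult.assoc)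
next
  case (add g g')
  then show ?case using trig_polynomials.add by (simp add: distrib_right)
qed (use trig_polynomials_sincos_mult assms(2) in blast)+

lemma trig_polynomials_bounded:
  fixes g :: "('i::countable \<Rightarrow> real) \<Rightarrow> real"
  assumes "g \<in> trig_polynomials"
  shows "g \<in> borel_measurable borel \<and> (\<exists>B. \<forall>y. \<bar>g y\<bar> \<le> B)"
  using assms
proof induction
  case (cos l)
  then show ?case using linear_forms_measurable[of l] by (auto intro!: exI[of _ 1])
next
  case (sin l)
  then show ?case using linear_forms_measurable[of l] by (auto intro!: exI[of _ 1])
next
  case (scale g a)
  then obtain B where "\<forall>y. \<bar>g y\<bar> \<le> B" by auto
  then have "\<forall>y. \<bar>a * g y\<bar> \<le> \<bar>a\<bar> * B" by (auto simp: abs_mult intro: mult_left_mono)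
  with scale show ?case by auto
next
  case (add g h)
  then obtain B B' where "\<forall>y. \<bar>g y\<bar> \<le> B" "\<forall>y. \<bar>h y\<bar> \<le> B'" by auto
  then have "\<forall>y. \<bar>g y + h y\<bar> \<le> B + B'" by (metis abs_triangle_ineq add_mono order_trans)
  with add show ?case by auto
qed

lemma cube_compact: "compact {y :: 'i \<Rightarrow> real. \<forall>e. \<bar>y e\<bar> \<le> 1}"
proof -
  have eq: "{y :: 'i \<Rightarrow> real. \<forall>e. \<bar>y e\<bar> \<le> 1} = PiE UNIV (\<lambda>_. {-1..1})"
    by (auto simp: PiE_def Pi_def abs_le_iff minus_le_iff)
  have "compactin (product_topology (\<lambda>_::'i. euclidean) UNIV) (PiE UNIV (\<lambda>_::'i. {-1..1::real}))"
    by (subst compactin_PiE) auto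
  then show ?thesis unfolding eq euclidean_product_topology by simp
qed

lemma trig_approximation:
  fixes f :: "('i::countable \<Rightarrow> real) \<Rightarrow> real" and R :: "'i \<Rightarrow> real"
  assumes f: "continuous_on UNIV f" and R: "\<And>e. 0 < R e" and "0 < \<epsilon>"
  shows "\<exists>g\<in>trig_polynomials. \<forall>y.
    \<bar>f (\<lambda>e. 2 * R e / pi * arcsin (sin (pi / (2 * R e) * y e))) - g y\<bar> < \<epsilon>"
proof -
  define S where "S = {s :: 'i \<Rightarrow> real. \<forall>e. \<bar>s e\<bar> \<le> 1}"
  define w where "w y = (\<lambda>e. sin (pi / (2 * R e) * y e))" for y
  define F where "F s = f (\<lambda>e. 2 * R e / pi * arcsin (s e))" for s
  have coord: "continuous_on S (\<lambda>s. s e)" for e :: 'i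
    using continuous_on_product_coordinates by (rule continuous_on_subset) auto
  have "continuous_on S (\<lambda>s e. 2 * R e / pi * arcsin (s e))"
    by (intro continuous_on_coordinatewise_then_product continuous_intros coord)
      (auto simp: S_def abs_le_iff minus_le_iff)
  then have F: "continuous_on S F" unfolding F_def
    by (rule continuous_on_compose2[OF f]) auto
  let ?P = "\<lambda>p. continuous_on S p \<and> (\<lambda>y. p (w y)) \<in> trig_polynomials"
  have "\<exists>p. ?P p \<and> (\<forall>s\<in>S. \<bar>F s - p s\<bar> < \<epsilon>)"
  proof (rule Stone_Weierstrass_HOL)
    show "compact S" unfolding S_def by (rule cube_compact)
    show "?P (\<lambda>_. c)" for c by (auto intro: trig_polynomials_const)
    show "?P f \<Longrightarrow> continuous_on S f" for f by blast
    show "?P f \<and> ?P g \<Longrightarrow> ?P (\<lambda>x. f x + g x)" for f g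
      by (auto intro: continuous_on_add trig_polynomials.add)
    show "?P f \<and> ?P g \<Longrightarrow> ?P (\<lambda>x. f x * g x)" for f g
      by (auto intro: continuous_on_mult trig_polynomials_mult)
    show "\<exists>p. ?P p \<and> p x \<noteq> p y" if xy: "x \<in> S \<and> y \<in> S \<and> x \<noteq> y" for x y
    proof -
      obtain e where "x e \<noteq> y e" using xy by auto
      moreover have "?P (\<lambda>s. s e)"
        using coord[of e] trig_polynomials.sin[OF linear_forms_coordinate[of "pi / (2 * R e)" e]]
        by (simp add: w_def)
      ultimately show ?thesis by (intro exI[of _ "\<lambda>s. s e"]) simp
    qed
    show "continuous_on S F" by fact
  qed fact
  then obtain p where p: "?P p" "\<forall>s\<in>S. \<bar>F s - p s\<bar> < \<epsilon>" by blast
  have "w y \<in> S" for y by (auto simp: S_def w_def abs_sin_le_one)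
  with p show ?thesis
    by (intro bexI[of _ "\<lambda>y. p (w y)"]) (auto simp: F_def w_def)
qed

lemma arcsin_sin_id:
  assumes "\<bar>x\<bar> \<le> R" "0 < R"
  shows "2 * R / pi * arcsin (sin (pi / (2 * R) * x)) = x"
proof -
  have "\<bar>x\<bar> * pi \<le> R * pi" using assms by (intro mult_right_mono) auto
  then have "\<bar>pi / (2 * R) * x\<bar> \<le> pi / 2" using assms by (simp add: abs_mult field_simps)
  then have "arcsin (sin (pi / (2 * R) * x)) = pi / (2 * R) * x"
    by (intro arcsin_sin) linarith+
  then show ?thesis using assms by simp
qed

lemma product_weak_convI:
  fixes \<nu> :: "nat \<Rightarrow> ('i::countable \<Rightarrow> real) measure" and f :: "('i \<Rightarrow> real) \<Rightarrow> real"
  assumes prob: "\<And>n. prob_space (\<nu> n)" and sets: "\<And>n. sets (\<nu> n) = sets borel"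
    and prob': "prob_space \<gamma>" and sets': "sets \<gamma> = sets borel"
    and char: "\<And>F c. finite F \<Longrightarrow>
      (\<lambda>n. \<integral>y. iexp (\<Sum>e\<in>F. c e * y e) \<partial>\<nu> n) \<longlonglongrightarrow> (\<integral>y. iexp (\<Sum>e\<in>F. c e * y e) \<partial>\<gamma>)"
    and f: "continuous_on UNIV f" "bounded (range f)"
  shows "(\<lambda>n. \<integral>y. f y \<partial>\<nu> n) \<longlonglongrightarrow> (\<integral>y. f y \<partial>\<gamma>)"
proof -
  interpret N: prob_space "\<nu> n" for n by fact
  interpret G: prob_space \<gamma> by fact
  note [measurable_cong] = sets sets'
  have sp: "space (\<nu> n) = UNIV" "space \<gamma> = UNIV" for n
    using sets_eq_imp_space_eq[OF sets] sets_eq_imp_space_eq[OF sets'] by auto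
  have intg: "integrable (\<nu> n) g" "integrable \<gamma> g"
    if "g \<in> borel_measurable borel" "\<And>y. norm (g y) \<le> B"
    for g :: "('i \<Rightarrow> real) \<Rightarrow> 'b::{banach, second_countable_topology}" and B n
  proof -
    have [measurable]: "g \<in> borel_measurable borel" by fact
    show "integrable (\<nu> n) g" "integrable \<gamma> g"
      by (rule N.integrable_const_bound[where B=B] G.integrable_const_bound[where B=B]; use that in auto)+
  qed
  have trig: "(\<lambda>n. integral\<^sup>L (\<nu> n) g) \<longlonglongrightarrow> integral\<^sup>L \<gamma> g" if "g \<in> trig_polynomials" for g
    using that
  proof induction
    case (cos l)
    have [measurable]: "l \<in> borel_measurable borel" using linear_forms_measurable[OF cos] .
    have i: "integrable (\<nu> n) (\<lambda>y. iexp (l y))" "integrable \<gamma> (\<lambda>y. iexp (l y))" for n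
      by (rule intg(1)[of _ 1] intg(2)[of _ 1]; simp)+
    have "(\<lambda>n. \<integral>y. iexp (l y) \<partial>\<nu> n) \<longlonglongrightarrow> (\<integral>y. iexp (l y) \<partial>\<gamma>)"
      using cos char by (auto simp: linear_forms_def)
    from tendsto_Re[OF this] show ?case
      by (simp add: integral_Re[OF i(1), symmetric] integral_Re[OF i(2), symmetric] Re_exp)
  next
    case (sin l)
    have [measurable]: "l \<in> borel_measurable borel" using linear_forms_measurable[OF sin] .
    have i: "integrable (\<nu> n) (\<lambda>y. iexp (l y))" "integrable \<gamma> (\<lambda>y. iexp (l y))" for n
      by (rule intg(1)[of _ 1] intg(2)[of _ 1]; simp)+
    have "(\<lambda>n. \<integral>y. iexp (l y) \<partial>\<nu> n) \<longlonglongrightarrow> (\<integral>y. iexp (l y) \<partial>\<gamma>)"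
      using sin char by (auto simp: linear_forms_def)
    from tendsto_Im[OF this] show ?case
      by (simp add: integral_Im[OF i(1), symmetric] integral_Im[OF i(2), symmetric] Im_exp)
  next
    case (scale g a)
    then show ?case by (auto intro: tendsto_mult_left)
  next
    case (add g h)
    obtain B B' where "\<forall>y. norm (g y) \<le> B" "\<forall>y. norm (h y) \<le> B'"
      "g \<in> borel_measurable borel" "h \<in> borel_measurable borel"
      using trig_polynomials_bounded[OF add.hyps(1)] trig_polynomials_bounded[OF add.hyps(2)] by auto
    then have "integrable (\<nu> n) g" "integrable (\<nu> n) h" "integrable \<gamma> g" "integrable \<gamma> h" for n
      using intg by blast+
    then show ?case using tendsto_add[OF add.IH] by simp
  qed
  have fm[measurable]: "f \<in> borel_measurable borel" using f(1) by (rule borel_measurable_continuous_onI)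
  obtain B0 where "\<And>y. \<bar>f y\<bar> \<le> B0" using f(2) by (auto simp: bounded_iff)
  then obtain B where B: "\<And>y. \<bar>f y\<bar> \<le> B" "B > 0"
    by (metis abs_ge_zero le_max_iff_disj less_max_iff_disj order_le_less_trans zero_less_one)
  show ?thesis
  proof (rule tendstoI)
    fix \<epsilon> :: real assume "0 < \<epsilon>"
    define \<delta> where "\<delta> = \<epsilon> / (4 * (2 * B + 1))"
    have \<delta>: "0 < \<delta>" using \<open>0 < \<epsilon>\<close> B(2) by (simp add: \<delta>_def)
    have "\<exists>R>0. (\<forall>n. measure (\<nu> n) {y. R < \<bar>y e\<bar>} \<le> \<delta> * (1/2) ^ Suc (to_nat e)) \<and>
        measure \<gamma> {y. R < \<bar>y e\<bar>} \<le> \<delta> * (1/2) ^ Suc (to_nat e)" for e :: 'i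
    proof -
      have me[measurable]: "(\<lambda>y::'i\<Rightarrow>real. y e) \<in> borel_measurable borel" by (rule measurable_product_coordinates)
      have me': "(\<lambda>y. y e) \<in> measurable (\<nu> n) borel" "(\<lambda>y. y e) \<in> measurable \<gamma> borel" for n
        by measurable
      have rd: "real_distribution (distr (\<nu> n) borel (\<lambda>y. y e))" "real_distribution (distr \<gamma> borel (\<lambda>y. y e))" for n
        by (rule N.real_distribution_distr G.real_distribution_distr; use me' in simp)+
      have "weak_conv_m (\<lambda>n. distr (\<nu> n) borel (\<lambda>y. y e)) (distr \<gamma> borel (\<lambda>y. y e))"
      proof (rule levy_continuity[OF rd])
        fix t
        show "(\<lambda>n. char (distr (\<nu> n) borel (\<lambda>y. y e)) t) \<longlonglongrightarrow> char (distr \<gamma> borel (\<lambda>y. y e)) t"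
          using char[of "{e}" "\<lambda>_. t"] by (simp add: char_def integral_distr me')
      qed
      from weak_conv_uniformly_tight[OF rd this, of "\<delta> * (1/2) ^ Suc (to_nat e)"] \<delta>
      obtain R where "R > 0"
        "\<And>n. measure (distr (\<nu> n) borel (\<lambda>y. y e)) {x. R < \<bar>x\<bar>} \<le> \<delta> * (1/2) ^ Suc (to_nat e)"
        "measure (distr \<gamma> borel (\<lambda>y. y e)) {x. R < \<bar>x\<bar>} \<le> \<delta> * (1/2) ^ Suc (to_nat e)" by auto
      then show ?thesis by (intro exI[of _ R]) (simp add: measure_distr me' sp vimage_def)
    qed
    then obtain R where R: "\<And>e. 0 < R e"
      "\<And>e n. measure (\<nu> n) {y. R e < \<bar>y e\<bar>} \<le> \<delta> * (1/2) ^ Suc (to_nat e)"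
      "\<And>e. measure \<gamma> {y. R e < \<bar>y e\<bar>} \<le> \<delta> * (1/2) ^ Suc (to_nat e)" by metis
    define K where "K = {y. \<exists>e. R e < \<bar>y e\<bar>}"
    have K_eq: "K = (\<Union>k. if k \<in> range (to_nat::'i\<Rightarrow>nat) then {y. R (from_nat k) < \<bar>y (from_nat k)\<bar>} else {})"
    proof (intro set_eqI iffI)
      fix y assume "y \<in> K"
      then obtain e where "R e < \<bar>y e\<bar>" by (auto simp: K_def)
      then show "y \<in> (\<Union>k. if k \<in> range (to_nat::'i\<Rightarrow>nat) then {y. R (from_nat k) < \<bar>y (from_nat k)\<bar>} else {})"
        by (intro UN_I[of "to_nat e"]) auto
    qed (auto simp: K_def split: if_splits)
    have coordm[measurable]: "(\<lambda>y::'i\<Rightarrow>real. y e) \<in> borel_measurable borel" for e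
      by (rule measurable_product_coordinates)
    have K_small: "measure M K \<le> \<delta>" if M: "prob_space M" "sets M = sets borel"
      and small: "\<And>e. measure M {y. R e < \<bar>y e\<bar>} \<le> \<delta> * (1/2) ^ Suc (to_nat e)" for M
    proof -
      interpret M: prob_space M by fact
      note [measurable_cong] = M(2)
      have sp: "space M = UNIV" using sets_eq_imp_space_eq[OF M(2)] by simp
      let ?A = "\<lambda>k. if k \<in> range (to_nat::'i\<Rightarrow>nat) then {y. R (from_nat k) < \<bar>y (from_nat k)\<bar>} else {}"
      have "{y. R e < \<bar>y e\<bar>} \<in> sets M" for e
      proof -
        have "{y\<in>space M. R e < \<bar>y e\<bar>} \<in> sets M" by measurable
        then show ?thesis by (simp add: sp)
      qed
      then have A: "range ?A \<subseteq> sets M" by auto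
      have le: "measure M (?A k) \<le> \<delta> * (1/2) ^ Suc k" for k
        using small[of "from_nat k"] \<delta> by (auto)
      have s: "(\<lambda>k. \<delta> * (1/2) ^ Suc k) sums (\<delta> * 1)"
        by (intro sums_mult power_half_series)
      have sum: "summable (\<lambda>k. measure M (?A k))"
        by (rule summable_comparison_test'[OF sums_summable[OF s]]) (use le in auto)
      have "measure M K \<le> (\<Sum>k. measure M (?A k))"
        unfolding K_eq by (rule M.finite_measure_subadditive_countably[OF A sum])
      also have "\<dots> \<le> (\<Sum>k. \<delta> * (1/2) ^ Suc k)"
        by (rule suminf_le[OF le sum sums_summable[OF s]])
      also have "\<dots> = \<delta>" using sums_unique[OF s] by simp
      finally show ?thesis .
    qed
    define \<kappa> where "\<kappa> y = (\<lambda>e. 2 * R e / pi * arcsin (sin (pi / (2 * R e) * y e)))" for y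
    obtain g where g: "g \<in> trig_polynomials" "\<And>y. \<bar>f (\<kappa> y) - g y\<bar> < \<delta>"
      using trig_approximation[where R=R, OF f(1) R(1) \<delta>] unfolding \<kappa>_def by blast
    have id: "\<kappa> y = y" if "y \<notin> K" for y
      unfolding \<kappa>_def using that R(1) by (intro ext arcsin_sin_id) (auto simp: K_def not_less)
    obtain Bg where Bg: "\<forall>y. norm (g y) \<le> Bg" "g \<in> borel_measurable borel"
      using trig_polynomials_bounded[OF g(1)] by auto
    have close: "\<bar>integral\<^sup>L M f - integral\<^sup>L M g\<bar> \<le> \<delta> * (2 * B + 1)"
      if M: "prob_space M" "sets M = sets borel" "measure M K \<le> \<delta>"
        and int: "integrable M f" "integrable M g" for M
    proof -
      interpret M: prob_space M by fact
      note [measurable_cong] = M(2)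
      have sp: "space M = UNIV" using sets_eq_imp_space_eq[OF M(2)] by simp
      have "{y\<in>space M. \<exists>e. R e < \<bar>y e\<bar>} \<in> sets M" by measurable
      then have Km[measurable]: "K \<in> sets M" by (simp add: K_def sp)
      have iK: "integrable M (\<lambda>y. 2 * B * indicator K y + \<delta>)"
        by (auto simp: M.emeasure_finite less_top[symmetric])
      have "\<bar>f y - g y\<bar> \<le> 2 * B * indicator K y + \<delta>" for y
      proof (cases "y \<in> K")
        case True
        have "\<bar>f y - g y\<bar> \<le> \<bar>f y\<bar> + \<bar>f (\<kappa> y)\<bar> + \<bar>f (\<kappa> y) - g y\<bar>" by linarith
        with B(1)[of y] B(1)[of "\<kappa> y"] g(2)[of y] True show ?thesis by simp
      next
        case False
        then show ?thesis using g(2)[of y] id[of y] by simp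
      qed
      then have "integral\<^sup>L M (\<lambda>y. \<bar>f y - g y\<bar>) \<le> (\<integral>y. 2 * B * indicator K y + \<delta> \<partial>M)"
        by (intro integral_mono iK integrable_abs Bochner_Integration.integrable_diff int) auto
      then have "\<bar>integral\<^sup>L M (\<lambda>y. f y - g y)\<bar> \<le> (\<integral>y. 2 * B * indicator K y + \<delta> \<partial>M)"
        by (rule order_trans[OF integral_abs_bound])
      also have "\<dots> = 2 * B * measure M K + \<delta>"
      proof -
        have "integrable M (indicator K :: _ \<Rightarrow> real)"
          by (simp add: M.emeasure_finite less_top[symmetric])
        then show ?thesis using M.prob_space by simp
      qed
      also have "\<dots> \<le> \<delta> * (2 * B + 1)" using M(3) B(2) by (simp add: algebra_simps)
      finally show ?thesis using int by simp
    qed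
    have fint: "integrable (\<nu> n) f" "integrable \<gamma> f" for n
      using intg[of f B] B(1) fm by auto
    have gint: "integrable (\<nu> n) g" "integrable \<gamma> g" for n
      using intg[of g Bg] Bg by auto
    have \<delta>eq: "\<delta> * (2 * B + 1) = \<epsilon> / 4" using B(2) by (simp add: \<delta>_def field_simps)
    have "eventually (\<lambda>n. dist (integral\<^sup>L (\<nu> n) g) (integral\<^sup>L \<gamma> g) < \<epsilon> / 4) sequentially"
      using trig[OF g(1)] \<open>0 < \<epsilon>\<close> by (intro tendstoD) auto
    then show "eventually (\<lambda>n. dist (integral\<^sup>L (\<nu> n) f) (integral\<^sup>L \<gamma> f) < \<epsilon>) sequentially"
    proof eventually_elim
      case (elim n)
      have "\<bar>integral\<^sup>L (\<nu> n) f - integral\<^sup>L (\<nu> n) g\<bar> \<le> \<epsilon> / 4"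
        using close[OF prob sets K_small[OF prob sets R(2)] fint(1) gint(1)] \<delta>eq by simp
      moreover have "\<bar>integral\<^sup>L \<gamma> f - integral\<^sup>L \<gamma> g\<bar> \<le> \<epsilon> / 4"
        using close[OF prob' sets' K_small[OF prob' sets' R(3)] fint(2) gint(2)] \<delta>eq by simp
      ultimately show ?case using elim \<open>0 < \<epsilon>\<close> unfolding dist_real_def abs_less_iff abs_le_iff by linarith
    qed
  qed
qed

section \<open>Gaussian laws\<close>

definition quad_form :: "('i \<Rightarrow> 'i \<Rightarrow> real) \<Rightarrow> 'i set \<Rightarrow> ('i \<Rightarrow> real) \<Rightarrow> real"
  where "quad_form V F c = (\<Sum>a\<in>F. \<Sum>b\<in>F. c a * c b * V a b)"

definition psd :: "('i \<Rightarrow> 'i \<Rightarrow> real) \<Rightarrow> bool"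
  where "psd V \<longleftrightarrow> (\<forall>a b. V a b = V b a) \<and> (\<forall>F c. finite F \<longrightarrow> 0 \<le> quad_form V F c)"

definition schur :: "nat \<Rightarrow> (nat \<Rightarrow> nat \<Rightarrow> real) \<Rightarrow> nat \<Rightarrow> nat \<Rightarrow> real"
  where "schur m V a b = V a b - V a m * V m b / V m m"

lemma quad_form_mono_neutral:
  assumes "finite F" "F \<subseteq> G" "finite G"
  shows "quad_form V F c = quad_form V G (\<lambda>a. if a \<in> F then c a else 0)"
proof -
  have "quad_form V G (\<lambda>a. if a \<in> F then c a else 0) =
      (\<Sum>a\<in>G. if a \<in> F then (\<Sum>b\<in>G. if b \<in> F then c a * c b * V a b else 0) else 0)"
    unfolding quad_form_def by (auto intro!: sum.cong)
  also have "\<dots> = quad_form V F c"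
    using assms unfolding quad_form_def
    by (simp add: sum.If_cases Int_def[symmetric] inf.absorb2 inf.absorb1)
  finally show ?thesis ..
qed

lemma quad_form_update:
  assumes "finite F" "\<And>a b. V a b = V b a" "m \<in> F"
  shows "quad_form V F (\<lambda>a. c a + (if a = m then t else 0)) =
    quad_form V F c + 2 * t * (\<Sum>a\<in>F. c a * V a m) + t\<^sup>2 * V m m"
proof -
  define d where "d a = (if a = m then t else 0)" for a
  have delta: "(\<Sum>a\<in>F. d a * f a) = t * f m" for f
    using assms by (simp add: d_def if_distrib[of "\<lambda>x. x * _"] cong: if_cong)
  have "(c a + d a) * (c b + d b) * V a b =
      c a * c b * V a b + c a * (d b * V a b) + d a * (c b * V a b) + d a * (d b * V a b)" for a b
    by (simp add: algebra_simps)
  then have "quad_form V F (\<lambda>a. c a + d a) = quad_form V F c + (\<Sum>a\<in>F. c a * (\<Sum>b\<in>F. d b * V a b))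
      + (\<Sum>a\<in>F. d a * (\<Sum>b\<in>F. c b * V a b)) + (\<Sum>a\<in>F. d a * (\<Sum>b\<in>F. d b * V a b))"
    unfolding quad_form_def by (simp only: sum_distrib_left sum.distrib)
  also have "(\<Sum>a\<in>F. c a * (\<Sum>b\<in>F. d b * V a b)) = t * (\<Sum>a\<in>F. c a * V a m)"
    by (simp only: delta sum_distrib_left mult.left_commute)
  also have "(\<Sum>a\<in>F. d a * (\<Sum>b\<in>F. c b * V a b)) = t * (\<Sum>a\<in>F. c a * V a m)"
    by (simp only: delta assms(2)[of m])
  also have "(\<Sum>a\<in>F. d a * (\<Sum>b\<in>F. d b * V a b)) = t * (t * V m m)"
    by (simp only: delta)
  finally show ?thesis by (simp add: d_def power2_eq_square algebra_simps)
qed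

lemma psd_quad_nonneg: "psd V \<Longrightarrow> finite F \<Longrightarrow> 0 \<le> quad_form V F c"
  by (simp add: psd_def)

lemma psd_sym: "psd V \<Longrightarrow> V a b = V b a"
  by (simp add: psd_def)

lemma psd_diag: "psd V \<Longrightarrow> 0 \<le> V a a"
  using psd_quad_nonneg[of V "{a}" "\<lambda>_. 1"] by (simp add: quad_form_def)

lemma psd_zero_diag:
  assumes "psd V" "V m m = 0"
  shows "V a m = 0"
proof (cases "a = m")
  case False
  have "0 \<le> quad_form V {a, m} (\<lambda>b. (if b = a then 1 else 0) + (if b = m then t' else 0))" for t'
    using assms by (intro psd_quad_nonneg) auto
  then have *: "0 \<le> V a a + 2 * t' * V a m" for t'
    using False assms by (subst (asm) quad_form_update) (auto simp: psd_sym quad_form_def)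
  show ?thesis
  proof (rule ccontr)
    assume nz: "V a m \<noteq> 0"
    have "2 * (- (V a a + 1) / (2 * V a m)) * V a m = - (V a a + 1)" using nz by simp
    with *[of "- (V a a + 1) / (2 * V a m)"] show False by linarith
  qed
qed (use assms in simp)

lemma psd_schur:
  assumes "psd V"
  shows "psd (schur m V)"
proof (cases "V m m = 0")
  case True
  then have "schur m V = V" using psd_zero_diag[OF assms] by (auto simp: schur_def fun_eq_iff)
  with assms show ?thesis by simp
next
  case False
  have "0 \<le> quad_form (schur m V) F c" if F: "finite F" for F c
  proof -
    let ?G = "insert m F" and ?c = "\<lambda>a. if a \<in> F then c a else 0"
    define B where "B = (\<Sum>a\<in>?G. ?c a * V a m)"
    have "0 \<le> quad_form V ?G (\<lambda>a. ?c a + (if a = m then - B / V m m else 0))"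
      using assms F by (intro psd_quad_nonneg) auto
    also have "\<dots> = quad_form V ?G ?c + 2 * (- B / V m m) * B + (- B / V m m)\<^sup>2 * V m m"
      unfolding B_def by (rule quad_form_update) (use F psd_sym[OF assms] in auto)
    also have "\<dots> = quad_form V ?G ?c - B\<^sup>2 / V m m"
      using False by (simp add: field_simps power2_eq_square)
    also have "B\<^sup>2 / V m m = (\<Sum>a\<in>?G. \<Sum>b\<in>?G. ?c a * ?c b * (V a m * V m b / V m m))"
      unfolding B_def power2_eq_square sum_product sum_divide_distrib
    proof (intro sum.cong refl)
      fix a b
      show "?c a * V a m * (?c b * V b m) / V m m = ?c a * ?c b * (V a m * V m b / V m m)"
        unfolding psd_sym[OF assms, of m b] by simp
    qed
    also have "quad_form V ?G ?c - \<dots> = quad_form (schur m V) ?G ?c"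
      unfolding quad_form_def schur_def by (simp only: sum_subtractf right_diff_distrib)
    also have "\<dots> = quad_form (schur m V) F c"
      by (rule quad_form_mono_neutral[symmetric]) (use F in auto)
    finally show ?thesis .
  qed
  then show ?thesis using psd_sym[OF assms] by (auto simp: psd_def schur_def mult.commute)
qed

primrec schur_iter :: "(nat \<Rightarrow> nat \<Rightarrow> real) \<Rightarrow> nat \<Rightarrow> nat \<Rightarrow> nat \<Rightarrow> real"
  where
    "schur_iter V 0 = V"
  | "schur_iter V (Suc m) = schur m (schur_iter V m)"

text \<open>The column of a vanishing pivot is \<open>0\<close> by \<open>x / 0 = 0\<close>, as it should be.\<close>

definition cholesky :: "(nat \<Rightarrow> nat \<Rightarrow> real) \<Rightarrow> nat \<Rightarrow> nat \<Rightarrow> real"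
  where "cholesky V a m = schur_iter V m a m / sqrt (schur_iter V m m m)"

lemma psd_schur_iter: "psd V \<Longrightarrow> psd (schur_iter V m)"
  by (induction m) (auto intro: psd_schur)

lemma schur_iter_eliminated:
  assumes "psd V" "a < m"
  shows "schur_iter V m a b = 0"
  using assms(2)
proof (induction m arbitrary: b)
  case (Suc m)
  note p = psd_schur_iter[OF assms(1), of m]
  show ?case
  proof (cases "a = m")
    case True
    then show ?thesis using psd_zero_diag[OF p, of m b] psd_sym[OF p, of m b]
      by (cases "schur_iter V m m m = 0") (auto simp: schur_def)
  next
    case False
    then have "schur_iter V m a c = 0" for c using Suc.IH[of c] Suc.prems by simp
    then show ?thesis by (simp add: schur_def)
  qed
qed simp

lemma schur_iter_eq:
  assumes "psd V"
  shows "schur_iter V n a b = V a b - (\<Sum>m<n. cholesky V a m * cholesky V b m)"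
proof (induction n)
  case (Suc n)
  note p = psd_schur_iter[OF assms, of n]
  have "cholesky V a n * cholesky V b n =
      schur_iter V n a n * schur_iter V n n b / schur_iter V n n n"
    using psd_diag[OF p, of n] psd_sym[OF p, of n b] by (simp add: cholesky_def)
  with Suc show ?case by (simp add: schur_def)
qed simp

lemma cholesky_decomposition:
  assumes "psd V" "a < n"
  shows "V a b = (\<Sum>m<n. cholesky V a m * cholesky V b m)"
  using schur_iter_eq[OF assms(1), of n a b] schur_iter_eliminated[OF assms] by simp

lemma cholesky_lower:
  assumes "psd V" "a < m"
  shows "cholesky V a m = 0"
  using schur_iter_eliminated[OF assms] by (simp add: cholesky_def)

definition std_normal :: "real measure"
  where "std_normal = density lborel (\<lambda>x. ennreal (std_normal_density x))"

lemma prob_space_std_normal: "prob_space std_normal"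
  unfolding std_normal_def using prob_space_normal_density[of 1 0] by (simp add: std_normal_density_def)

definition white_noise :: "(nat \<Rightarrow> real) measure"
  where "white_noise = (\<Pi>\<^sub>M n\<in>UNIV. std_normal)"

lemma prob_space_white_noise: "prob_space white_noise"
  unfolding white_noise_def by (intro prob_space_PiM prob_space_std_normal)

lemma sets_std_normal[measurable_cong, simp]: "sets std_normal = sets borel"
  by (simp add: std_normal_def)

lemma white_noise_coordinate_measurable[measurable]: "(\<lambda>\<xi>. \<xi> n) \<in> borel_measurable white_noise"
  unfolding white_noise_def by measurable

lemma white_noise_coordinate: "distributed white_noise lborel (\<lambda>\<xi>. \<xi> n) (normal_density 0 1)"
proof -
  have "distr white_noise std_normal (\<lambda>\<xi>. \<xi> n) = std_normal"
    unfolding white_noise_def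
    using distr_PiM_component[of UNIV "\<lambda>_. std_normal" n] prob_space_std_normal by simp
  moreover have "distr white_noise std_normal (\<lambda>\<xi>. \<xi> n) = distr white_noise lborel (\<lambda>\<xi>. \<xi> n)"
    by (rule distr_cong) auto
  ultimately show ?thesis
    unfolding distributed_def by (auto simp: std_normal_def)
qed

lemma white_noise_indep: "prob_space.indep_vars white_noise (\<lambda>_. borel) (\<lambda>n \<xi>. \<xi> n) UNIV"
proof -
  interpret prob_space white_noise by (rule prob_space_white_noise)
  have "indep_vars (\<lambda>_. std_normal) (\<lambda>n \<xi>. \<xi> n) UNIV"
  proof (subst indep_vars_iff_distr_eq_PiM')
    show "random_variable std_normal (\<lambda>\<xi>. \<xi> i)" for i
      unfolding white_noise_def by measurable
    have "distr white_noise std_normal (\<lambda>\<xi>. \<xi> n) = std_normal" for n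
      unfolding white_noise_def
      using distr_PiM_component[of UNIV "\<lambda>_. std_normal" n] prob_space_std_normal by simp
    then show "distr white_noise (Pi\<^sub>M UNIV (\<lambda>i. std_normal)) (\<lambda>x. \<lambda>i\<in>UNIV. x i) =
        Pi\<^sub>M UNIV (\<lambda>i. distr white_noise std_normal (\<lambda>\<xi>. \<xi> i))"
      by (simp add: white_noise_def[symmetric] distr_id2 restrict_UNIV)
  qed auto
  then show ?thesis
    unfolding indep_vars_def by simp
qed

lemma white_noise_linear_combination:
  fixes c :: "nat \<Rightarrow> real"
  assumes "finite F"
  defines "\<sigma>2 \<equiv> (\<Sum>n\<in>F. (c n)\<^sup>2)"
  shows "(\<sigma>2 = 0 \<and> (\<forall>\<xi>. (\<Sum>n\<in>F. c n * \<xi> n) = 0)) \<or>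
    (\<sigma>2 > 0 \<and> distributed white_noise lborel (\<lambda>\<xi>. \<Sum>n\<in>F. c n * \<xi> n) (normal_density 0 (sqrt \<sigma>2)))"
proof -
  interpret prob_space white_noise by (rule prob_space_white_noise)
  define G where "G = {n\<in>F. c n \<noteq> 0}"
  have G: "finite G" "\<And>f. (\<Sum>n\<in>F. c n * f n) = (\<Sum>n\<in>G. c n * f n)" "\<sigma>2 = (\<Sum>n\<in>G. (c n)\<^sup>2)"
    using assms(1) unfolding \<sigma>2_def G_def by (auto intro!: sum.mono_neutral_right)
  show ?thesis
  proof (cases "G = {}")
    case True
    then show ?thesis using G by simp
  next
    case False
    have pos: "\<sigma>2 > 0" unfolding G(3) using G(1) False by (intro sum_pos) (auto simp: G_def)
    have "distributed white_noise lborel (\<lambda>\<xi>. \<Sum>n\<in>G. c n * \<xi> n)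
        (normal_density (\<Sum>n\<in>G. 0) (sqrt (\<Sum>n\<in>G. (\<bar>c n\<bar>)\<^sup>2)))"
    proof (rule sum_indep_normal[OF G(1) False])
      have "indep_vars (\<lambda>_. borel) (\<lambda>n. (\<lambda>x. c n * x) \<circ> (\<lambda>\<xi>. \<xi> n)) UNIV"
        by (rule indep_vars_compose[OF white_noise_indep]) auto
      then show "indep_vars (\<lambda>i. borel) (\<lambda>n \<xi>. c n * \<xi> n) G"
        using indep_vars_subset[of "\<lambda>_. borel" "\<lambda>n \<xi>. c n * \<xi> n" UNIV G] by (simp add: comp_def)
      fix n assume n: "n \<in> G"
      then show "0 < \<bar>c n\<bar>" by (simp add: G_def)
      show "distributed white_noise lborel (\<lambda>\<xi>. c n * \<xi> n) (normal_density 0 \<bar>c n\<bar>)"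
        using normal_density_affine[OF white_noise_coordinate[of n], of "c n" 0] n
        by (simp add: G_def)
    qed
    then show ?thesis using pos by (simp add: G(2,3))
  qed
qed

lemma (in prob_space) centered_normal_second_moment:
  assumes "distributed M lborel X (normal_density 0 \<sigma>)" "0 < \<sigma>"
  shows "integrable M (\<lambda>x. (X x)\<^sup>2)" "expectation (\<lambda>x. (X x)\<^sup>2) = \<sigma>\<^sup>2"
proof -
  show eq: "expectation (\<lambda>x. (X x)\<^sup>2) = \<sigma>\<^sup>2"
    using normal_distributed_variance[OF assms(2,1)] normal_distributed_expectation[OF assms(2,1)]
    by simp
  show "integrable M (\<lambda>x. (X x)\<^sup>2)"
    using eq assms(2) not_integrable_integral_eq by fastforce
qed

lemma (in prob_space) centered_normal_iexp:
  assumes "distributed M lborel X (normal_density 0 \<sigma>)" "0 < \<sigma>"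
  shows "expectation (\<lambda>x. iexp (X x)) = of_real (exp (- \<sigma>\<^sup>2 / 2))"
proof -
  have [measurable]: "X \<in> borel_measurable M"
    using distributed_measurable[OF assms(1)] by simp
  have "distributed M lborel (\<lambda>x. (X x - 0) / \<sigma>) std_normal_density"
    using assms normal_standard_normal_convert by blast
  then have D: "distr M lborel (\<lambda>x. X x / \<sigma>) = std_normal_distribution"
    unfolding distributed_def by simp
  have "distr M lborel (\<lambda>x. X x / \<sigma>) = distr M borel (\<lambda>x. X x / \<sigma>)"
    by (rule distr_cong) auto
  with D have D: "distr M borel (\<lambda>x. X x / \<sigma>) = std_normal_distribution" by simp
  have "expectation (\<lambda>x. iexp (X x)) = char (distr M borel (\<lambda>x. X x / \<sigma>)) \<sigma>"
    using assms(2) by (simp add: char_def integral_distr)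
  also have "\<dots> = of_real (exp (- \<sigma>\<^sup>2 / 2))"
    unfolding D by (simp add: char_std_normal_distribution)
  finally show ?thesis .
qed

lemma centered_gaussian_law_exists:
  fixes V :: "'i::countable \<times> 'i \<Rightarrow> real"
  assumes "psd (\<lambda>a b. V (a, b))"
  shows "\<exists>\<gamma>. centered_gaussian_law V \<gamma> \<and>
    (\<forall>F c. finite F \<longrightarrow> (\<integral>y. iexp (\<Sum>e\<in>F. c e * y e) \<partial>\<gamma>) =
      of_real (exp (- quad_form (\<lambda>a b. V (a, b)) F c / 2)))"
proof -
  interpret W: prob_space white_noise by (rule prob_space_white_noise)
  define U where "U a b = (if a \<in> range (to_nat::'i \<Rightarrow> nat) \<and> b \<in> range (to_nat::'i \<Rightarrow> nat)
    then V (from_nat a, from_nat b) else 0)" for a b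
  have U_nat[simp]: "U (to_nat a) (to_nat b) = V (a, b)" for a b by (simp add: U_def)
  have psdU: "psd U"
    unfolding psd_def
  proof (intro conjI allI impI)
    show "U a b = U b a" for a b using psd_sym[OF assms] by (auto simp: U_def)
    fix F :: "nat set" and c :: "nat \<Rightarrow> real" assume "finite F"
    let ?G = "{e. to_nat e \<in> F} :: 'i set"
    have G: "finite ?G" using finite_vimageI[OF \<open>finite F\<close>, of "to_nat :: 'i \<Rightarrow> nat"] by (simp add: vimage_def)
    have "quad_form U F c = quad_form U (to_nat ` ?G) c"
      unfolding quad_form_def
    proof (rule sum.mono_neutral_cong_right)
      show "\<forall>i\<in>F - to_nat ` ?G. (\<Sum>b\<in>F. c i * c b * U i b) = 0"
        by (auto simp: U_def intro!: sum.neutral)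
      fix x assume "x \<in> to_nat ` ?G"
      show "(\<Sum>b\<in>F. c x * c b * U x b) = (\<Sum>b\<in>to_nat ` ?G. c x * c b * U x b)"
        by (rule sum.mono_neutral_right) (use \<open>finite F\<close> in \<open>auto simp: U_def\<close>)
    qed (use \<open>finite F\<close> in auto)
    also have "\<dots> = quad_form (\<lambda>a b. V (a, b)) ?G (\<lambda>e. c (to_nat e))"
      unfolding quad_form_def by (simp add: sum.reindex inj_on_def)
    also have "0 \<le> \<dots>" using psd_quad_nonneg[OF assms G] .
    finally show "0 \<le> quad_form U F c" .
  qed
  define Y where "Y \<xi> e = (\<Sum>m\<le>to_nat e. cholesky U (to_nat e) m * \<xi> m)"
    for \<xi> :: "nat \<Rightarrow> real" and e :: 'i
  have Ym[measurable]: "Y \<in> borel_measurable white_noise"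
    unfolding Y_def[abs_def] by (rule measurable_coordinatewise_then_product) measurable
  define \<gamma> where "\<gamma> = distr white_noise borel Y"
  have lin: "\<exists>n. (\<forall>\<xi>. (\<Sum>e\<in>F. c e * Y \<xi> e) = (\<Sum>m<n. (\<Sum>e\<in>F. c e * cholesky U (to_nat e) m) * \<xi> m)) \<and>
      (\<Sum>m<n. (\<Sum>e\<in>F. c e * cholesky U (to_nat e) m)\<^sup>2) = quad_form (\<lambda>a b. V (a, b)) F c"
    if F: "finite F" for F c
  proof -
    define n where "n = Suc (Max (insert 0 (to_nat ` F)))"
    have n: "to_nat e < n" if "e \<in> F" for e
      unfolding n_def using F that by (auto simp: less_Suc_eq_le intro!: Max_ge)
    have "Y \<xi> e = (\<Sum>m<n. cholesky U (to_nat e) m * \<xi> m)" if "e \<in> F" for \<xi> e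
      unfolding Y_def using n[OF that] cholesky_lower[OF psdU]
      by (intro sum.mono_neutral_left) (auto simp: not_le)
    then have "(\<Sum>e\<in>F. c e * Y \<xi> e) = (\<Sum>e\<in>F. \<Sum>m<n. c e * cholesky U (to_nat e) m * \<xi> m)" for \<xi>
      by (simp add: sum_distrib_left mult.assoc)
    then have 1: "(\<Sum>e\<in>F. c e * Y \<xi> e) = (\<Sum>m<n. (\<Sum>e\<in>F. c e * cholesky U (to_nat e) m) * \<xi> m)" for \<xi>
      by (subst (asm) sum.swap) (simp add: sum_distrib_right)
    have "quad_form (\<lambda>a b. V (a, b)) F c = (\<Sum>a\<in>F. \<Sum>b\<in>F. c a * c b *
        (\<Sum>m<n. cholesky U (to_nat a) m * cholesky U (to_nat b) m))"
      unfolding quad_form_def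
      by (intro sum.cong refl) (simp add: cholesky_decomposition[OF psdU n, symmetric])
    also have "\<dots> = (\<Sum>a\<in>F. \<Sum>b\<in>F. \<Sum>m<n. (c a * cholesky U (to_nat a) m) * (c b * cholesky U (to_nat b) m))"
      by (simp add: sum_distrib_left ac_simps)
    also have "\<dots> = (\<Sum>a\<in>F. \<Sum>m<n. \<Sum>b\<in>F. (c a * cholesky U (to_nat a) m) * (c b * cholesky U (to_nat b) m))"
      by (intro sum.cong refl sum.swap)
    also have "\<dots> = (\<Sum>m<n. \<Sum>a\<in>F. \<Sum>b\<in>F. (c a * cholesky U (to_nat a) m) * (c b * cholesky U (to_nat b) m))"
      by (rule sum.swap)
    also have "\<dots> = (\<Sum>m<n. (\<Sum>e\<in>F. c e * cholesky U (to_nat e) m)\<^sup>2)"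
      by (simp add: power2_eq_square sum_product)
    finally show ?thesis using 1 by (intro exI[of _ n]) auto
  qed
  have normal: "((\<forall>\<xi>. (\<Sum>e\<in>F. c e * Y \<xi> e) = 0) \<and> quad_form (\<lambda>a b. V (a, b)) F c = 0) \<or>
      (quad_form (\<lambda>a b. V (a, b)) F c > 0 \<and> distributed white_noise lborel (\<lambda>\<xi>. \<Sum>e\<in>F. c e * Y \<xi> e)
        (normal_density 0 (sqrt (quad_form (\<lambda>a b. V (a, b)) F c))))" if F: "finite F" for F c
  proof -
    from lin[OF F, of c] obtain n where
      "\<And>\<xi>. (\<Sum>e\<in>F. c e * Y \<xi> e) = (\<Sum>m<n. (\<Sum>e\<in>F. c e * cholesky U (to_nat e) m) * \<xi> m)"
      "(\<Sum>m<n. (\<Sum>e\<in>F. c e * cholesky U (to_nat e) m)\<^sup>2) = quad_form (\<lambda>a b. V (a, b)) F c" by blast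
    with white_noise_linear_combination[of "{..<n}" "\<lambda>m. \<Sum>e\<in>F. c e * cholesky U (to_nat e) m"]
    show ?thesis by auto
  qed
  have sq: "integrable white_noise (\<lambda>\<xi>. (\<Sum>e\<in>F. c e * Y \<xi> e)\<^sup>2)"
    "W.expectation (\<lambda>\<xi>. (\<Sum>e\<in>F. c e * Y \<xi> e)\<^sup>2) = quad_form (\<lambda>a b. V (a, b)) F c" if F: "finite F" for F c
    using normal[OF F, of c] W.centered_normal_second_moment[of "\<lambda>\<xi>. \<Sum>e\<in>F. c e * Y \<xi> e"]
    by (auto simp: real_sqrt_pow2)
  have cm[measurable]: "(\<lambda>y::'i \<Rightarrow> real. y e) \<in> borel_measurable borel" for e
    by (rule measurable_product_coordinates)
  have char: "(\<integral>y. iexp (\<Sum>e\<in>F. c e * y e) \<partial>\<gamma>) = of_real (exp (- quad_form (\<lambda>a b. V (a, b)) F c / 2))"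
    if F: "finite F" for F c
  proof -
    have "(\<integral>y. iexp (\<Sum>e\<in>F. c e * y e) \<partial>\<gamma>) = W.expectation (\<lambda>\<xi>. iexp (\<Sum>e\<in>F. c e * Y \<xi> e))"
      unfolding \<gamma>_def by (rule integral_distr) measurable
    also have "\<dots> = of_real (exp (- quad_form (\<lambda>a b. V (a, b)) F c / 2))"
      using normal[OF F, of c]
    proof (elim disjE conjE)
      assume z: "\<forall>\<xi>. (\<Sum>e\<in>F. c e * Y \<xi> e) = 0" "quad_form (\<lambda>a b. V (a, b)) F c = 0"
      show ?thesis unfolding z(2) by (simp only: z(1)[rule_format]) (simp add: W.prob_space)
    next
      assume q: "quad_form (\<lambda>a b. V (a, b)) F c > 0" and d: "distributed white_noise lborel
        (\<lambda>\<xi>. \<Sum>e\<in>F. c e * Y \<xi> e) (normal_density 0 (sqrt (quad_form (\<lambda>a b. V (a, b)) F c)))"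
      from W.centered_normal_iexp[OF d] q show ?thesis by (simp only: real_sqrt_gt_0_iff real_sqrt_pow2 less_imp_le)
    qed
    finally show ?thesis .
  qed
  have cov: "W.expectation (\<lambda>\<xi>. Y \<xi> a * Y \<xi> b) = V (a, b)" for a b
  proof (cases "a = b")
    case True
    then show ?thesis using sq(2)[of "{a}" "\<lambda>_. 1"] by (simp add: quad_form_def power2_eq_square)
  next
    case False
    have i: "integrable white_noise (\<lambda>\<xi>. (Y \<xi> a + Y \<xi> b)\<^sup>2)" "integrable white_noise (\<lambda>\<xi>. (Y \<xi> a)\<^sup>2)"
      "integrable white_noise (\<lambda>\<xi>. (Y \<xi> b)\<^sup>2)"
      using sq(1)[of "{a, b}" "\<lambda>_. 1"] sq(1)[of "{a}" "\<lambda>_. 1"] sq(1)[of "{b}" "\<lambda>_. 1"] False by auto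
    have e: "W.expectation (\<lambda>\<xi>. (Y \<xi> a + Y \<xi> b)\<^sup>2) = V (a, a) + V (b, b) + 2 * V (a, b)"
      "W.expectation (\<lambda>\<xi>. (Y \<xi> a)\<^sup>2) = V (a, a)" "W.expectation (\<lambda>\<xi>. (Y \<xi> b)\<^sup>2) = V (b, b)"
      using sq(2)[of "{a, b}" "\<lambda>_. 1"] sq(2)[of "{a}" "\<lambda>_. 1"] sq(2)[of "{b}" "\<lambda>_. 1"] False
        psd_sym[OF assms, of a b] by (auto simp: quad_form_def)
    have "(\<lambda>\<xi>. Y \<xi> a * Y \<xi> b) = (\<lambda>\<xi>. ((Y \<xi> a + Y \<xi> b)\<^sup>2 - (Y \<xi> a)\<^sup>2 - (Y \<xi> b)\<^sup>2) / 2)"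
      by (auto simp: power2_eq_square algebra_simps)
    then show ?thesis using i e by simp
  qed
  have "centered_gaussian_law V \<gamma>"
    unfolding centered_gaussian_law_def
  proof (intro conjI allI impI)
    show "prob_space \<gamma>" unfolding \<gamma>_def by (intro W.prob_space_distr) simp
    show "sets \<gamma> = sets borel" by (simp add: \<gamma>_def)
    show "(\<integral>y. y a * y b \<partial>\<gamma>) = V (a, b)" for a b
      unfolding \<gamma>_def by (subst integral_distr) (auto simp: cov)
    fix F :: "'i set" and c assume F: "finite F"
    show "(AE y in \<gamma>. (\<Sum>e\<in>F. c e * y e) = 0) \<or>
      (\<exists>\<sigma>>0. distributed \<gamma> lborel (\<lambda>y. \<Sum>e\<in>F. c e * y e) (\<lambda>x. ennreal (normal_density 0 \<sigma> x)))"
      using normal[OF F, of c]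
    proof (elim disjE conjE)
      assume "\<forall>\<xi>. (\<Sum>e\<in>F. c e * Y \<xi> e) = 0"
      then show ?thesis unfolding \<gamma>_def by (intro disjI1) (subst AE_distr_iff; auto)
    next
      let ?q = "quad_form (\<lambda>a b. V (a, b)) F c"
      assume q: "?q > 0" and d: "distributed white_noise lborel (\<lambda>\<xi>. \<Sum>e\<in>F. c e * Y \<xi> e) (normal_density 0 (sqrt ?q))"
      have "distr \<gamma> lborel (\<lambda>y. \<Sum>e\<in>F. c e * y e) = distr white_noise lborel (\<lambda>\<xi>. \<Sum>e\<in>F. c e * Y \<xi> e)"
        unfolding \<gamma>_def by (subst distr_distr) (auto simp: comp_def)
      then have "distributed \<gamma> lborel (\<lambda>y. \<Sum>e\<in>F. c e * y e) (normal_density 0 (sqrt ?q))"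
        using d unfolding distributed_def by (auto simp: \<gamma>_def)
      then show ?thesis using q by (intro disjI2 exI[of _ "sqrt ?q"]) simp
    qed
  qed
  with char show ?thesis by blast
qed

section \<open>Matrix sequences\<close>

lemma mconv_apply: "(A \<circledast> B) (i, j, k) = (\<Sum>l\<le>k. \<Sum>u\<in>UNIV. A (i, u, l) * B (u, j, k - l))"
  by (simp add: mconv_def)

definition gen_fps :: "'e mseq \<Rightarrow> 'e \<Rightarrow> 'e \<Rightarrow> real fps"
  where "gen_fps A i j = Abs_fps (\<lambda>k. A (i, j, k))"

lemma gen_fps_mconv: "gen_fps (A \<circledast> B) i j = (\<Sum>u\<in>UNIV. gen_fps A i u * gen_fps B u j)"
  by (rule fps_ext) (simp add: gen_fps_def mconv_apply fps_sum_nth fps_mult_nth atMost_atLeast0 sum.swap[of _ UNIV])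

lemma mseq_eqI: "(\<And>i j. gen_fps A i j = gen_fps B i j) \<Longrightarrow> A = B"
  by (rule ext, clarify) (metis gen_fps_def fps_nth_Abs_fps)

lemma mconv_assoc: "(A \<circledast> B) \<circledast> C = A \<circledast> (B \<circledast> C)"
proof (rule mseq_eqI)
  fix i j
  have "gen_fps ((A \<circledast> B) \<circledast> C) i j =
      (\<Sum>u\<in>UNIV. \<Sum>v\<in>UNIV. gen_fps A i v * gen_fps B v u * gen_fps C u j)"
    by (simp add: gen_fps_mconv sum_distrib_right)
  also have "\<dots> = gen_fps (A \<circledast> (B \<circledast> C)) i j"
    by (subst sum.swap) (simp add: gen_fps_mconv sum_distrib_left mult.assoc)
  finally show "gen_fps ((A \<circledast> B) \<circledast> C) i j = gen_fps (A \<circledast> (B \<circledast> C)) i j" .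
qed

lemma gen_fps_id: "gen_fps mconv_id i j = (if i = j then 1 else 0)"
  by (rule fps_ext) (auto simp: gen_fps_def mconv_id_def)

lemma mconv_id_left: "mconv_id \<circledast> A = A"
  by (rule mseq_eqI) (simp add: gen_fps_mconv gen_fps_id if_distrib[of "\<lambda>x. x * _"] cong: if_cong)

lemma mconv_id_right: "A \<circledast> mconv_id = A"
  by (rule mseq_eqI) (simp add: gen_fps_mconv gen_fps_id if_distrib[of "\<lambda>x. _ * x"] cong: if_cong)

lemma mconv_add_left: "(\<lambda>e. A e + B e) \<circledast> C = (\<lambda>e. (A \<circledast> C) e + (B \<circledast> C) e)"
  by (auto simp: fun_eq_iff mconv_apply distrib_right sum.distrib)

lemma mconv_add_right: "C \<circledast> (\<lambda>e. A e + B e) = (\<lambda>e. (C \<circledast> A) e + (C \<circledast> B) e)"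
  by (auto simp: fun_eq_iff mconv_apply distrib_left sum.distrib)

lemma mconv_diff_left: "(\<lambda>e. A e - B e) \<circledast> C = (\<lambda>e. (A \<circledast> C) e - (B \<circledast> C) e)"
  by (auto simp: fun_eq_iff mconv_apply left_diff_distrib sum_subtractf)

lemma mconv_diff_right: "C \<circledast> (\<lambda>e. A e - B e) = (\<lambda>e. (C \<circledast> A) e - (C \<circledast> B) e)"
  by (auto simp: fun_eq_iff mconv_apply right_diff_distrib sum_subtractf)

lemma mconv_scale_left: "(\<lambda>e. c * A e) \<circledast> C = (\<lambda>e. c * (A \<circledast> C) e)"
  by (auto simp: fun_eq_iff mconv_apply sum_distrib_left mult.assoc)

lemma mconv_scale_right: "C \<circledast> (\<lambda>e. c * A e) = (\<lambda>e. c * (C \<circledast> A) e)"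
  by (auto simp: fun_eq_iff mconv_apply sum_distrib_left mult.left_commute)

lemma mconv_zero_left: "(\<lambda>e. 0) \<circledast> C = (\<lambda>e. 0)"
  by (auto simp: fun_eq_iff mconv_apply)

lemma mconv_zero_right: "C \<circledast> (\<lambda>e. 0) = (\<lambda>e. 0)"
  by (auto simp: fun_eq_iff mconv_apply)

lemma mconv_sum_left: "(\<lambda>e. \<Sum>x\<in>X. A x e) \<circledast> C = (\<lambda>e. \<Sum>x\<in>X. (A x \<circledast> C) e)"
  by (induction X rule: infinite_finite_induct) (simp_all add: mconv_zero_left mconv_add_left)

lemma mconv_sum_right: "C \<circledast> (\<lambda>e. \<Sum>x\<in>X. A x e) = (\<lambda>e. \<Sum>x\<in>X. (C \<circledast> A x) e)"
  by (induction X rule: infinite_finite_induct) (simp_all add: mconv_zero_right mconv_add_right)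

lemma mconv_power_commute: "A \<circledast> mconv_power A n = mconv_power A n \<circledast> A"
proof (induction n)
  case (Suc n)
  then show ?case by (metis mconv_assoc mconv_power.simps(2))
qed (simp add: mconv_id_left mconv_id_right)

definition vanishes_at_0 :: "'e mseq \<Rightarrow> bool"
  where "vanishes_at_0 A \<longleftrightarrow> (\<forall>i j. A (i, j, 0) = 0)"

lemma mconv_power_vanishes:
  assumes "vanishes_at_0 A" "k < n"
  shows "mconv_power A n (i, j, k) = 0"
  using assms(2)
proof (induction n arbitrary: i k)
  case (Suc n)
  have "A (i, u, l) * mconv_power A n (u, j, k - l) = 0" if "l \<le> k" for l u
    using Suc assms(1) that by (cases "l = 0") (auto simp: vanishes_at_0_def)
  then show ?case unfolding mconv_power.simps mconv_apply by (intro sum.neutral ballI) auto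
qed simp

lemma mconv_inv_finite:
  assumes "vanishes_at_0 A" "k \<le> N"
  shows "mconv_inv A (i, j, k) = (\<Sum>n\<le>N. mconv_power A n (i, j, k))"
  unfolding mconv_inv_def
  by (rule suminf_finite) (use assms mconv_power_vanishes[OF assms(1)] in auto)

lemma mconv_inv_left_unfold:
  assumes "vanishes_at_0 A"
  shows "mconv_inv A = (\<lambda>e. mconv_id e + (A \<circledast> mconv_inv A) e)"
proof (rule ext, clarify)
  fix i j k
  have "(A \<circledast> mconv_inv A) (i, j, k) =
      (\<Sum>l\<le>k. \<Sum>u\<in>UNIV. A (i, u, l) * (\<Sum>n\<le>k. mconv_power A n (u, j, k - l)))"
    unfolding mconv_apply
    by (intro sum.cong refl arg_cong2[of _ _ _ _ "(*)"] mconv_inv_finite assms) auto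
  also have "\<dots> = (A \<circledast> (\<lambda>e. \<Sum>n\<le>k. mconv_power A n e)) (i, j, k)"
    by (simp add: mconv_apply)
  also have "\<dots> = (\<Sum>n\<le>k. mconv_power A (Suc n) (i, j, k))"
    by (simp add: mconv_sum_right)
  finally have "mconv_id (i, j, k) + (A \<circledast> mconv_inv A) (i, j, k) = (\<Sum>n\<le>Suc k. mconv_power A n (i, j, k))"
    by (subst sum.atMost_Suc_shift) simp
  also have "\<dots> = mconv_inv A (i, j, k)" by (rule mconv_inv_finite[symmetric]) (use assms in auto)
  finally show "mconv_inv A (i, j, k) = mconv_id (i, j, k) + (A \<circledast> mconv_inv A) (i, j, k)" ..
qed

lemma mconv_inv_commute:
  assumes "vanishes_at_0 A"
  shows "A \<circledast> mconv_inv A = mconv_inv A \<circledast> A"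
proof (rule ext, clarify)
  fix i j k
  have "(A \<circledast> mconv_inv A) (i, j, k) = (A \<circledast> (\<lambda>e. \<Sum>n\<le>k. mconv_power A n e)) (i, j, k)"
    unfolding mconv_apply
    by (intro sum.cong refl arg_cong2[of _ _ _ _ "(*)"] mconv_inv_finite assms) auto
  also have "\<dots> = ((\<lambda>e. \<Sum>n\<le>k. mconv_power A n e) \<circledast> A) (i, j, k)"
    by (simp add: mconv_sum_left mconv_sum_right mconv_power_commute)
  also have "\<dots> = (mconv_inv A \<circledast> A) (i, j, k)"
    unfolding mconv_apply
    by (intro sum.cong refl arg_cong2[of _ _ _ _ "(*)"] mconv_inv_finite[symmetric] assms) auto
  finally show "(A \<circledast> mconv_inv A) (i, j, k) = (mconv_inv A \<circledast> A) (i, j, k)" .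
qed

lemma mconv_inv_diff:
  assumes "vanishes_at_0 A" "vanishes_at_0 B"
  shows "(\<lambda>e. mconv_inv B e - mconv_inv A e) = mconv_inv A \<circledast> (\<lambda>e. B e - A e) \<circledast> mconv_inv B"
proof -
  let ?a = "mconv_inv A" and ?b = "mconv_inv B"
  have b: "?b = (\<lambda>e. mconv_id e + (B \<circledast> ?b) e)" by (rule mconv_inv_left_unfold[OF assms(2)])
  have a: "?a = (\<lambda>e. mconv_id e + (?a \<circledast> A) e)"
    using mconv_inv_left_unfold[OF assms(1)] mconv_inv_commute[OF assms(1)] by simp
  have "?a \<circledast> (\<lambda>e. B e - A e) \<circledast> ?b = (\<lambda>e. (?a \<circledast> (B \<circledast> ?b)) e - ((?a \<circledast> A) \<circledast> ?b) e)"
    by (simp add: mconv_diff_right mconv_diff_left mconv_assoc)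
  also have "B \<circledast> ?b = (\<lambda>e. ?b e - mconv_id e)" by (subst (2) b) simp
  also have "?a \<circledast> A = (\<lambda>e. ?a e - mconv_id e)" by (subst (2) a) simp
  also have "(\<lambda>e. (?a \<circledast> (\<lambda>e. ?b e - mconv_id e)) e - ((\<lambda>e. ?a e - mconv_id e) \<circledast> ?b) e) = (\<lambda>e. ?b e - ?a e)"
    by (simp add: mconv_diff_right mconv_diff_left mconv_id_left mconv_id_right)
  finally show ?thesis ..
qed

definition tail_convergent :: "'e::finite mseq \<Rightarrow> bool"
  where "tail_convergent A \<longleftrightarrow> (\<forall>i k. convergent (tail_partial_sum A i k))"

lemma survival_tendsto:
  "tail_convergent A \<Longrightarrow> tail_partial_sum A i k \<longlonglongrightarrow> survival A (i, i, k)"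
  by (simp add: tail_convergent_def survival_def convergent_LIMSEQ_iff)

lemma survival_off_diagonal: "i \<noteq> j \<Longrightarrow> survival A (i, j, k) = 0"
  by (simp add: survival_def)

lemma survivalI:
  assumes "\<And>i k. tail_partial_sum A i k \<longlonglongrightarrow> B (i, i, k)" "\<And>i j k. i \<noteq> j \<Longrightarrow> B (i, j, k) = 0"
  shows "tail_convergent A" "survival A = B"
proof -
  show "tail_convergent A" using assms(1) by (auto simp: tail_convergent_def convergent_def)
  show "survival A = B"
  proof (rule ext, clarify)
    fix i j k
    show "survival A (i, j, k) = B (i, j, k)"
      using assms(2)[of i j] limI[OF assms(1)[of i k]] by (cases "i = j") (auto simp: survival_def)
  qed
qed

lemma tail_partial_sum_diff:
  "tail_partial_sum (\<lambda>e. A e - B e) i k K = tail_partial_sum A i k K - tail_partial_sum B i k K"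
  by (simp add: tail_partial_sum_def sum_subtractf)

lemma tail_partial_sum_scale: "tail_partial_sum (\<lambda>e. c * A e) i k K = c * tail_partial_sum A i k K"
  by (simp add: tail_partial_sum_def sum_distrib_left)

lemma tail_partial_sum_sum:
  "tail_partial_sum (\<lambda>e. \<Sum>x\<in>X. A x e) i k K = (\<Sum>x\<in>X. tail_partial_sum (A x) i k K)"
  by (induction X rule: infinite_finite_induct) (simp_all add: tail_partial_sum_def sum.distrib)

lemma survival_diff:
  assumes "tail_convergent A" "tail_convergent B"
  shows "tail_convergent (\<lambda>e. A e - B e)" "survival (\<lambda>e. A e - B e) = (\<lambda>e. survival A e - survival B e)"
proof (rule_tac [!] survivalI[where B="\<lambda>e. survival A e - survival B e"])
  show "tail_partial_sum (\<lambda>e. A e - B e) i k \<longlonglongrightarrow> survival A (i, i, k) - survival B (i, i, k)" for i k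
    unfolding tail_partial_sum_diff by (intro tendsto_diff survival_tendsto assms)
  then show "tail_partial_sum (\<lambda>e. A e - B e) i k \<longlonglongrightarrow> survival A (i, i, k) - survival B (i, i, k)" for i k .
qed (auto simp: survival_off_diagonal)

lemma survival_scale:
  assumes "tail_convergent A"
  shows "tail_convergent (\<lambda>e. c * A e)" "survival (\<lambda>e. c * A e) = (\<lambda>e. c * survival A e)"
proof (rule_tac [!] survivalI[where B="\<lambda>e. c * survival A e"])
  show "tail_partial_sum (\<lambda>e. c * A e) i k \<longlonglongrightarrow> c * survival A (i, i, k)" for i k
    unfolding tail_partial_sum_scale by (intro tendsto_mult_left survival_tendsto assms)
  then show "tail_partial_sum (\<lambda>e. c * A e) i k \<longlonglongrightarrow> c * survival A (i, i, k)" for i k .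
qed (auto simp: survival_off_diagonal)

lemma survival_sum:
  assumes "\<And>x. x \<in> X \<Longrightarrow> tail_convergent (A x)"
  shows "tail_convergent (\<lambda>e. \<Sum>x\<in>X. A x e)"
    "survival (\<lambda>e. \<Sum>x\<in>X. A x e) = (\<lambda>e. \<Sum>x\<in>X. survival (A x) e)"
proof (rule_tac [!] survivalI[where B="\<lambda>e. \<Sum>x\<in>X. survival (A x) e"])
  show "tail_partial_sum (\<lambda>e. \<Sum>x\<in>X. A x e) i k \<longlonglongrightarrow> (\<Sum>x\<in>X. survival (A x) (i, i, k))" for i k
    unfolding tail_partial_sum_sum by (intro tendsto_sum survival_tendsto assms)
  then show "tail_partial_sum (\<lambda>e. \<Sum>x\<in>X. A x e) i k \<longlonglongrightarrow> (\<Sum>x\<in>X. survival (A x) (i, i, k))" for i k .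
qed (auto simp: survival_off_diagonal)

lemma survival_unit:
  "tail_convergent (unit_mseq (i', j', k'))"
  "survival (unit_mseq (i', j', k')) = (\<lambda>(i, j, k). if i = j \<and> i = i' \<and> k < k' then 1 else 0)"
proof (rule_tac [!] survivalI[where B="\<lambda>(i, j, k). if i = j \<and> i = i' \<and> k < k' then 1 else 0"])
  have *: "tail_partial_sum (unit_mseq (i', j', k')) i k K = (if i = i' \<and> k < k' then 1 else 0)"
    if "k' \<le> K" for i k K
  proof -
    have "tail_partial_sum (unit_mseq (i', j', k')) i k K =
        (\<Sum>j\<in>UNIV. if j = j' then (\<Sum>l\<in>{k<..K}. if l = k' then (if i = i' then 1 else 0) else 0) else 0)"
      unfolding tail_partial_sum_def unit_mseq_def by (intro sum.cong refl) auto
    also have "\<dots> = (if i = i' \<and> k < k' then 1 else 0)"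
      using that by (simp del: sum.delta) (auto simp: sum.delta)
    finally show ?thesis .
  qed
  then show l: "tail_partial_sum (unit_mseq (i', j', k')) i k \<longlonglongrightarrow>
      (case (i, i, k) of (i, j, k) \<Rightarrow> if i = j \<and> i = i' \<and> k < k' then 1 else 0)" for i k
    by (intro tendsto_eventually) (auto simp: eventually_sequentially intro!: exI[of _ k'])
  show "tail_partial_sum (unit_mseq (i', j', k')) i k \<longlonglongrightarrow>
      (case (i, i, k) of (i, j, k) \<Rightarrow> if i = j \<and> i = i' \<and> k < k' then 1 else 0)" for i k by (rule l)
qed auto

definition semi_markov_law :: "'e::finite mseq \<Rightarrow> 'e mseq"
  where "semi_markov_law A = mconv_inv A \<circledast> survival A"

definition semi_markov_law_deriv :: "'e::finite mseq \<Rightarrow> 'e mseq \<Rightarrow> 'e mseq"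
  where "semi_markov_law_deriv A H =
    (\<lambda>e. (mconv_inv A \<circledast> H \<circledast> semi_markov_law A) e + (mconv_inv A \<circledast> survival H) e)"

lemma semi_markov_law_diff:
  assumes "vanishes_at_0 A" "vanishes_at_0 B" "tail_convergent A" "tail_convergent B"
  shows "(\<lambda>e. semi_markov_law B e - semi_markov_law A e) =
    (\<lambda>e. (mconv_inv A \<circledast> (\<lambda>e. B e - A e) \<circledast> semi_markov_law B) e
      + (mconv_inv A \<circledast> survival (\<lambda>e. B e - A e)) e)"
proof -
  have "mconv_inv A \<circledast> (\<lambda>e. B e - A e) \<circledast> semi_markov_law B =
      (\<lambda>e. mconv_inv B e - mconv_inv A e) \<circledast> survival B"
    unfolding mconv_inv_diff[OF assms(1,2)] by (simp add: mconv_assoc semi_markov_law_def)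
  then show ?thesis
    by (simp add: semi_markov_law_def mconv_diff_left mconv_diff_right survival_diff(2)[OF assms(4,3)])
qed

lemma semi_markov_law_linearization:
  assumes "vanishes_at_0 A" "vanishes_at_0 B" "tail_convergent A" "tail_convergent B"
  shows "semi_markov_law B e - semi_markov_law A e = semi_markov_law_deriv A (\<lambda>e. B e - A e) e
    + (mconv_inv A \<circledast> (\<lambda>e. B e - A e) \<circledast> (\<lambda>e. semi_markov_law B e - semi_markov_law A e)) e"
  using fun_cong[OF semi_markov_law_diff[OF assms], of e]
  by (simp add: semi_markov_law_deriv_def mconv_diff_right)

lemma semi_markov_law_deriv_diff:
  assumes "tail_convergent H" "tail_convergent H'"
  shows "semi_markov_law_deriv A (\<lambda>e. H e - H' e) = (\<lambda>e. semi_markov_law_deriv A H e - semi_markov_law_deriv A H' e)"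
  by (auto simp: semi_markov_law_deriv_def survival_diff(2)[OF assms] mconv_diff_left mconv_diff_right)

lemma semi_markov_law_deriv_scale:
  assumes "tail_convergent H"
  shows "semi_markov_law_deriv A (\<lambda>e. c * H e) = (\<lambda>e. c * semi_markov_law_deriv A H e)"
  by (auto simp: semi_markov_law_deriv_def survival_scale(2)[OF assms] mconv_scale_left mconv_scale_right distrib_left)

lemma semi_markov_law_deriv_sum:
  assumes "\<And>x. x \<in> X \<Longrightarrow> tail_convergent (H x)"
  shows "semi_markov_law_deriv A (\<lambda>e. \<Sum>x\<in>X. H x e) = (\<lambda>e. \<Sum>x\<in>X. semi_markov_law_deriv A (H x) e)"
  by (auto simp: semi_markov_law_deriv_def survival_sum(2)[OF assms] mconv_sum_left mconv_sum_right sum.distrib)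

lemma V_unit_deriv: "V_unit q e' = semi_markov_law_deriv q (unit_mseq e')"
  by (simp add: V_unit_def semi_markov_law_deriv_def semi_markov_law_def mplus_def mconv_assoc)

lemma V_row_deriv: "V_row q i = semi_markov_law_deriv q (restrict_row q i)"
  by (simp add: V_row_def semi_markov_law_deriv_def semi_markov_law_def mplus_def mconv_assoc)

section \<open>Histories and stopped sums\<close>

lemma integrable_measure_pmf_bounded:
  fixes f :: "'a \<Rightarrow> 'b::{banach, second_countable_topology}"
  assumes "\<And>x. x \<in> set_pmf p \<Longrightarrow> norm (f x) \<le> B"
  shows "integrable (measure_pmf p) f"
  by (rule measure_pmf.integrable_const_bound[where B=B]) (auto simp: AE_measure_pmf_iff assms)

lemma expectation_bounded_pmf:
  fixes f :: "'a \<Rightarrow> 'b::{banach, second_countable_topology}"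
  assumes "\<And>x. x \<in> set_pmf p \<Longrightarrow> norm (f x) \<le> B"
  shows "norm (measure_pmf.expectation p f) \<le> B"
proof -
  have "norm (measure_pmf.expectation p f) \<le> measure_pmf.expectation p (\<lambda>x. norm (f x))"
    by (rule integral_norm_bound)
  also have "\<dots> \<le> measure_pmf.expectation p (\<lambda>_. B)"
    by (rule integral_mono_AE) (auto simp: AE_measure_pmf_iff assms integrable_measure_pmf_bounded[where B=B])
  finally show ?thesis by simp
qed

lemma integral_bind_pmf:
  fixes f :: "'a \<Rightarrow> real"
  assumes "\<And>x. \<bar>f x\<bar> \<le> B"
  shows "measure_pmf.expectation (bind_pmf M N) f = (\<integral>x. measure_pmf.expectation (N x) f \<partial>measure_pmf M)"
  unfolding measure_pmf_bind
  by (rule integral_bind[where K="count_space UNIV" and B=B and B'=1])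
    (use assms in \<open>auto simp: measure_pmf_in_subprob_algebra measure_pmf.emeasure_space_1 measure_pmf.finite_measure_axioms\<close>)

lemma integral_bind_pmf_complex:
  fixes f :: "'a \<Rightarrow> complex"
  assumes "\<And>x. norm (f x) \<le> B"
  shows "measure_pmf.expectation (bind_pmf M N) f = (\<integral>x. measure_pmf.expectation (N x) f \<partial>measure_pmf M)"
proof -
  have i: "integrable (measure_pmf p) f" for p
    by (rule integrable_measure_pmf_bounded) (rule assms)
  have b: "\<bar>Re (f x)\<bar> \<le> B" "\<bar>Im (f x)\<bar> \<le> B" for x
    using assms[of x] abs_Re_le_cmod[of "f x"] abs_Im_le_cmod[of "f x"] by auto
  have j: "integrable (measure_pmf M) (\<lambda>x. measure_pmf.expectation (N x) f)"
    by (rule integrable_measure_pmf_bounded[where B=B]) (rule expectation_bounded_pmf[OF assms])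
  show ?thesis
    by (rule complex_eqI)
      (simp_all add: integral_Re[OF i, symmetric] integral_Im[OF i, symmetric]
        integral_Re[OF j, symmetric] integral_Im[OF j, symmetric]
        integral_bind_pmf[where B=B] b)
qed

definition jump_pmf :: "'e::finite mseq \<Rightarrow> 'e \<Rightarrow> ('e \<times> nat) pmf"
  where "jump_pmf q i = embed_pmf (\<lambda>(j, k). q (i, j, k))"

text \<open>Histories \<open>(J\<^sub>n, X\<^sub>n), \<dots>, (J\<^sub>0, X\<^sub>0)\<close> are lists with the most recent transition first.\<close>

type_synonym 'e hist = "('e \<times> nat) list"

definition cur :: "'e hist \<Rightarrow> 'e"
  where "cur h = fst (hd h)"

definition total :: "'e hist \<Rightarrow> nat"
  where "total h = sum_list (map snd h)"

lemma cur_Cons[simp]: "cur (y # h) = fst y" by (simp add: cur_def)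

lemma total_Cons[simp]: "total (y # h) = snd y + total h" by (simp add: total_def)

primrec psum :: "('e \<times> nat \<Rightarrow> 'e hist \<Rightarrow> real) \<Rightarrow> 'e hist \<Rightarrow> real"
  where
    "psum f [] = 0"
  | "psum f (y # h) = psum f h + (if h = [] then 0 else f y h)"

text \<open>
  \<open>wsum m\<close> sums over the transitions \<open>1, \<dots>, N(m) + 1\<close>, and \<open>csum m\<close> over \<open>1, \<dots>, N(m)\<close>. Only the
  former is the value of a stopped additive functional, since \<open>N(m) + 1\<close> is a stopping time.
\<close>

definition wsum :: "nat \<Rightarrow> ('e \<Rightarrow> 'e \<times> nat \<Rightarrow> real) \<Rightarrow> 'e hist \<Rightarrow> real"
  where "wsum m d = psum (\<lambda>y h. if total h \<le> m then d (cur h) y else 0)"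

definition csum :: "nat \<Rightarrow> ('e \<Rightarrow> 'e \<times> nat \<Rightarrow> real) \<Rightarrow> 'e hist \<Rightarrow> real"
  where "csum m d = psum (\<lambda>y h. if total (y # h) \<le> m then d (cur h) y else 0)"

lemma wsum_simps[simp]:
  "wsum m d [] = 0" "wsum m d [y] = 0"
  "h \<noteq> [] \<Longrightarrow> wsum m d (y # h) = wsum m d h + (if total h \<le> m then d (cur h) y else 0)"
  by (simp_all add: wsum_def)

lemma csum_simps[simp]:
  "csum m d [] = 0" "csum m d [y] = 0"
  "h \<noteq> [] \<Longrightarrow> csum m d (y # h) = csum m d h + (if total (y # h) \<le> m then d (cur h) y else 0)"
  by (simp_all add: csum_def)

lemma wsum_add: "wsum m (\<lambda>x y. d x y + d' x y) h = wsum m d h + wsum m d' h"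
  by (induction h) (simp_all add: wsum_def)

lemma wsum_diff: "wsum m (\<lambda>x y. d x y - d' x y) h = wsum m d h - wsum m d' h"
  by (induction h) (simp_all add: wsum_def)

lemma wsum_scale: "wsum m (\<lambda>x y. c * d x y) h = c * wsum m d h"
  by (induction h) (simp_all add: wsum_def distrib_left)

lemma wsum_sum: "wsum m (\<lambda>x y. \<Sum>i\<in>I. d i x y) h = (\<Sum>i\<in>I. wsum m (d i) h)"
  by (induction h) (simp_all add: wsum_def sum.distrib)

lemma csum_diff: "csum m (\<lambda>x y. d x y - d' x y) h = csum m d h - csum m d' h"
  by (induction h) (simp_all add: csum_def)

lemma csum_scale: "csum m (\<lambda>x y. c * d x y) h = c * csum m d h"
  by (induction h) (simp_all add: csum_def distrib_left)

lemma csum_sum: "csum m (\<lambda>x y. \<Sum>i\<in>I. d i x y) h = (\<Sum>i\<in>I. csum m (d i) h)"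
  by (induction h) (simp_all add: csum_def sum.distrib)

lemma psum_bound:
  fixes B :: real
  assumes "\<And>y h. \<bar>f y h\<bar> \<le> B"
  shows "\<bar>psum f h\<bar> \<le> real (length h - 1) * B"
proof (induction h)
  case (Cons y h)
  have "0 \<le> B" using assms[of y h] by linarith
  then show ?case
    using Cons assms[of y h] by (cases h) (auto simp: algebra_simps of_nat_diff)
qed simp

lemma wsum_bound:
  fixes B :: real
  assumes "\<And>x y. \<bar>d x y\<bar> \<le> B"
  shows "\<bar>wsum m d h\<bar> \<le> real (length h - 1) * B"
proof -
  have "0 \<le> B" using assms[of undefined undefined] by linarith
  then show ?thesis unfolding wsum_def by (intro psum_bound) (auto simp: assms)
qed

lemma wsum_nonneg: "(\<And>x y. 0 \<le> d x y) \<Longrightarrow> 0 \<le> wsum m d h"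
  by (induction h) (auto simp: wsum_def)

lemma csum_nonneg: "(\<And>x y. 0 \<le> d x y) \<Longrightarrow> 0 \<le> csum m d h"
  by (induction h) (auto simp: csum_def)

lemma csum_mono: "(\<And>x y. d x y \<le> d' x y) \<Longrightarrow> csum m d h \<le> csum m d' h"
  by (induction h) (auto simp: csum_def intro: add_mono)

lemma csum_total_le: "h \<noteq> [] \<Longrightarrow> total h \<le> m \<Longrightarrow> csum m d h = wsum m d h"
proof (induction h)
  case (Cons y h)
  then show ?case by (cases h) (auto simp: wsum_def csum_def)
qed simp

text \<open>The two sums differ at most in the one transition that crosses the level \<open>m\<close>.\<close>

lemma wsum_csum_diff:
  assumes "\<And>x y. \<bar>d x y\<bar> \<le> B"
  shows "\<bar>wsum m d h - csum m d h\<bar> \<le> B"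
proof (induction h)
  case Nil
  show ?case using assms[of undefined undefined] by (simp)
next
  case (Cons y h)
  show ?case
  proof (cases "h = []")
    case False
    then show ?thesis using Cons assms[of "cur h" y] csum_total_le[of h m d]
      by (auto simp: not_le)
  qed (use assms[of undefined undefined] in simp)
qed

primrec history :: "('e \<Rightarrow> ('e \<times> nat) pmf) \<Rightarrow> 'e \<Rightarrow> nat \<Rightarrow> 'e hist pmf"
  where
    "history K i 0 = return_pmf [(i, 0)]"
  | "history K i (Suc n) = bind_pmf (history K i n) (\<lambda>h. map_pmf (\<lambda>y. y # h) (K (cur h)))"

lemma length_history: "h \<in> set_pmf (history K i n) \<Longrightarrow> length h = Suc n"
  by (induction n arbitrary: h) auto

lemma history_nonempty: "h \<in> set_pmf (history K i n) \<Longrightarrow> h \<noteq> []"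
  using length_history by fastforce

lemma last_history: "h \<in> set_pmf (history K i n) \<Longrightarrow> last h = (i, 0)"
  by (induction n arbitrary: h) (auto dest: history_nonempty)

lemma expectation_pmf_cong:
  assumes "\<And>x. x \<in> set_pmf p \<Longrightarrow> f x = g x"
  shows "measure_pmf.expectation p f = measure_pmf.expectation p g"
  by (rule integral_cong_AE) (auto simp: AE_measure_pmf_iff assms)

lemma expectation_history_Suc:
  fixes F :: "'e hist \<Rightarrow> real"
  assumes "\<And>h. length h = Suc (Suc n) \<Longrightarrow> \<bar>F h\<bar> \<le> B"
  shows "measure_pmf.expectation (history K i (Suc n)) F =
    measure_pmf.expectation (history K i n) (\<lambda>h. measure_pmf.expectation (K (cur h)) (\<lambda>y. F (y # h)))"
proof -
  define G where "G h = (if length h = Suc (Suc n) then F h else 0)" for h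
  have G: "\<bar>G h\<bar> \<le> \<bar>B\<bar>" for h using assms[of h] by (auto simp: G_def)
  have "measure_pmf.expectation (history K i (Suc n)) F = measure_pmf.expectation (history K i (Suc n)) G"
    by (rule expectation_pmf_cong) (auto simp: G_def dest: length_history)
  also have "\<dots> = measure_pmf.expectation (history K i n)
      (\<lambda>h. measure_pmf.expectation (K (cur h)) (\<lambda>y. G (y # h)))"
    by (simp add: integral_bind_pmf[where B="\<bar>B\<bar>", OF G])
  also have "\<dots> = measure_pmf.expectation (history K i n)
      (\<lambda>h. measure_pmf.expectation (K (cur h)) (\<lambda>y. F (y # h)))"
    by (intro expectation_pmf_cong) (auto simp: G_def dest: length_history)
  finally show ?thesis .
qed

lemma expectation_history_Suc_complex:
  fixes F :: "'e hist \<Rightarrow> complex"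
  assumes "\<And>h. length h = Suc (Suc n) \<Longrightarrow> norm (F h) \<le> B"
  shows "measure_pmf.expectation (history K i (Suc n)) F =
    measure_pmf.expectation (history K i n) (\<lambda>h. measure_pmf.expectation (K (cur h)) (\<lambda>y. F (y # h)))"
proof -
  define G where "G h = (if length h = Suc (Suc n) then F h else 0)" for h
  have G: "norm (G h) \<le> \<bar>B\<bar>" for h using assms[of h] by (auto simp: G_def)
  have "measure_pmf.expectation (history K i (Suc n)) F = measure_pmf.expectation (history K i (Suc n)) G"
    by (rule expectation_pmf_cong) (auto simp: G_def dest: length_history)
  also have "\<dots> = measure_pmf.expectation (history K i n)
      (\<lambda>h. measure_pmf.expectation (K (cur h)) (\<lambda>y. G (y # h)))"
    by (simp add: integral_bind_pmf_complex[where B="\<bar>B\<bar>", OF G])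
  also have "\<dots> = measure_pmf.expectation (history K i n)
      (\<lambda>h. measure_pmf.expectation (K (cur h)) (\<lambda>y. F (y # h)))"
    by (intro expectation_pmf_cong) (auto simp: G_def dest: length_history)
  finally show ?thesis .
qed

locale semi_markov =
  fixes q :: "'e::finite mseq"
  assumes semi_markov_kernel: "semi_markov_kernel q"
begin

abbreviation K :: "'e \<Rightarrow> ('e \<times> nat) pmf" where "K \<equiv> jump_pmf q"

lemma q_nonneg: "0 \<le> q e" using semi_markov_kernel by (cases e) (simp add: semi_markov_kernel_def)

lemma q_vanishes: "vanishes_at_0 q"
  using semi_markov_kernel by (simp add: semi_markov_kernel_def vanishes_at_0_def)

lemma q_sums: "(\<lambda>k. \<Sum>j\<in>UNIV. q (i, j, k)) sums 1"
  using semi_markov_kernel by (simp add: semi_markov_kernel_def)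

lemma pmf_K: "pmf (K i) y = q (i, y)"
proof -
  have "(\<integral>\<^sup>+y. ennreal (case y of (j, k) \<Rightarrow> q (i, j, k)) \<partial>count_space UNIV) =
      (\<integral>\<^sup>+k. \<integral>\<^sup>+j. ennreal (q (i, j, k)) \<partial>count_space UNIV \<partial>count_space UNIV)"
    using nn_integral_snd_count_space[of "\<lambda>y. ennreal (case y of (j, k) \<Rightarrow> q (i, j, k))"] by simp
  also have "\<dots> = (\<Sum>k. ennreal (\<Sum>j\<in>UNIV. q (i, j, k)))"
    by (simp add: nn_integral_count_space_nat nn_integral_count_space_finite q_nonneg)
  also have "\<dots> = ennreal 1"
    by (rule suminf_ennreal_eq[OF _ q_sums]) (simp add: sum_nonneg q_nonneg)
  finally have "pmf (jump_pmf q i) y = (case y of (j, k) \<Rightarrow> q (i, j, k))"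
    unfolding jump_pmf_def by (intro pmf_embed_pmf) (auto simp: q_nonneg)
  then show ?thesis by (cases y) simp
qed

lemma sojourn_positive: "y \<in> set_pmf (K i) \<Longrightarrow> 0 < snd y"
  using q_vanishes by (cases y) (auto simp: set_pmf_eq pmf_K vanishes_at_0_def intro!: Nat.gr0I)

lemma history_positive:
  "h \<in> set_pmf (history K i n) \<Longrightarrow> n \<le> total h"
proof (induction n arbitrary: h)
  case (Suc n)
  then show ?case using sojourn_positive by (fastforce simp: less_eq_Suc_le)
qed simp

lemma tail_partial_sum_q: "tail_partial_sum q i k n = measure (K i) {y. k < snd y \<and> snd y \<le> n}"
proof -
  have eq: "{y :: 'e \<times> nat. k < snd y \<and> snd y \<le> n} = UNIV \<times> {k<..n}" by auto
  have "measure (K i) {y. k < snd y \<and> snd y \<le> n} = (\<Sum>y\<in>UNIV \<times> {k<..n}. q (i, y))"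
    unfolding eq by (subst measure_measure_pmf_finite) (auto simp: pmf_K)
  also have "\<dots> = tail_partial_sum q i k n"
    by (simp add: tail_partial_sum_def sum.cartesian_product)
  finally show ?thesis ..
qed

lemma survival_q:
  "tail_convergent q"
  "survival q = (\<lambda>(i, j, k). if i = j then measure (K i) {y. k < snd y} else 0)"
proof (rule_tac [!] survivalI[where B="\<lambda>(i, j, k). if i = j then measure (K i) {y. k < snd y} else 0"])
  have "(\<lambda>n. measure (K i) {y. k < snd y \<and> snd y \<le> n}) \<longlonglongrightarrow> measure (K i) (\<Union>n. {y. k < snd y \<and> snd y \<le> n})" for i k
    by (rule measure_pmf.finite_Lim_measure_incseq) (auto simp: incseq_def)
  moreover have "(\<Union>n. {y. k < snd y \<and> snd y \<le> n}) = {y::'e \<times> nat. k < snd y}" for k by auto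
  ultimately show l: "tail_partial_sum q i k \<longlonglongrightarrow>
      (case (i, i, k) of (i, j, k) \<Rightarrow> if i = j then measure (K i) {y. k < snd y} else 0)" for i k
    by (simp add: tail_partial_sum_q[abs_def])
  show "tail_partial_sum q i k \<longlonglongrightarrow>
      (case (i, i, k) of (i, j, k) \<Rightarrow> if i = j then measure (K i) {y. k < snd y} else 0)" for i k by (rule l)
qed auto

lemma has_sum_expectation:
  fixes f :: "'e \<times> nat \<Rightarrow> real"
  assumes "\<And>y. \<bar>f y\<bar> \<le> B"
  shows "((\<lambda>y. q (i, y) * f y) has_sum measure_pmf.expectation (K i) f) UNIV"
proof -
  have "integrable (measure_pmf (K i)) f"
    by (rule integrable_measure_pmf_bounded[where B=B]) (simp add: assms)
  then have "Infinite_Set_Sum.abs_summable_on (\<lambda>y. pmf (K i) y * f y) UNIV"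
    unfolding abs_summable_on_def
    by (subst (asm) measure_pmf_eq_density, subst (asm) integrable_density) auto
  then have s: "Infinite_Set_Sum.abs_summable_on (\<lambda>y. q (i, y) * f y) UNIV" by (simp add: pmf_K)
  have "measure_pmf.expectation (K i) f = infsetsum (\<lambda>y. q (i, y) * f y) UNIV"
    by (simp add: pmf_expectation_eq_infsetsum pmf_K)
  also have "\<dots> = infsum (\<lambda>y. q (i, y) * f y) UNIV"
    by (rule infsetsum_infsum[OF s])
  finally show ?thesis
    using s abs_summable_equivalent abs_summable_summable has_sum_infsum by metis
qed

lemma has_sum_total_expectation:
  fixes f :: "'e \<times> 'e \<times> nat \<Rightarrow> real"
  assumes "\<And>e. \<bar>f e\<bar> \<le> B"
  shows "((\<lambda>e. q e * f e) has_sum (\<Sum>i\<in>UNIV. measure_pmf.expectation (K i) (\<lambda>y. f (i, y)))) UNIV"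
proof -
  have "((\<lambda>e. q e * f e) has_sum (\<Sum>i\<in>I. measure_pmf.expectation (K i) (\<lambda>y. f (i, y)))) (I \<times> UNIV)"
    if "finite I" for I :: "'e set"
    using that
  proof induction
    case (insert i I)
    have "((\<lambda>e. q e * f e) has_sum measure_pmf.expectation (K i) (\<lambda>y. f (i, y))) (Pair i ` UNIV)"
      by (subst has_sum_reindex) (auto simp: comp_def inj_on_def intro: has_sum_expectation assms)
    from has_sum_Un_disjoint[OF this insert.IH] insert.hyps
    have "((\<lambda>e. q e * f e) has_sum (\<Sum>i\<in>insert i I. measure_pmf.expectation (K i) (\<lambda>y. f (i, y))))
      (Pair i ` UNIV \<union> I \<times> UNIV)" by auto
    moreover have "Pair i ` UNIV \<union> I \<times> UNIV = insert i I \<times> (UNIV :: ('e \<times> nat) set)" by auto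
    ultimately show ?case by simp
  qed simp
  from this[of UNIV] show ?thesis by simp
qed

end

section \<open>Limit theorems for stopped sums\<close>

definition visit :: "'e \<Rightarrow> 'e \<Rightarrow> 'e \<times> nat \<Rightarrow> real"
  where "visit i x y = (if x = i then 1 else 0)"

lemma abs_visit_le: "\<bar>visit i x y\<bar> \<le> 1"
  by (simp add: visit_def)

lemma visit_nonneg: "0 \<le> visit i x y"
  by (simp add: visit_def)

lemma wsum_state: "wsum m (\<lambda>x y. f x) h = (\<Sum>i\<in>UNIV. f i * wsum m (visit i) h)" for f :: "'e::finite \<Rightarrow> real"
proof -
  have "(\<Sum>i\<in>UNIV. f i * visit i x y) = f x" for x y
    by (simp add: visit_def if_distrib[of "\<lambda>z. _ * z"] cong: if_cong)
  then have "wsum m (\<lambda>x y. f x) h = wsum m (\<lambda>x y. \<Sum>i\<in>UNIV. f i * visit i x y) h" by simp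
  then show ?thesis by (simp add: wsum_sum wsum_scale)
qed

lemma visit_average_bound:
  assumes "h \<in> set_pmf (history K i (Suc m))"
  shows "\<bar>c * wsum m (visit x) h / m - 1\<bar> \<le> \<bar>c\<bar> * real (Suc m) / m + 1"
proof -
  have "\<bar>wsum m (visit x) h\<bar> \<le> real (Suc m)"
    using wsum_bound[of "visit x" 1 m h] abs_visit_le[of x] length_history[OF assms] by simp
  then have "\<bar>c\<bar> * \<bar>wsum m (visit x) h\<bar> / real m \<le> \<bar>c\<bar> * real (Suc m) / real m"
    by (intro divide_right_mono mult_left_mono) auto
  then have "\<bar>c * wsum m (visit x) h / m\<bar> \<le> \<bar>c\<bar> * real (Suc m) / real m"
    by (simp add: abs_mult)
  then show ?thesis by linarith
qed

lemma visit_average_integrable: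
  "integrable (history K i (Suc m)) (\<lambda>h. (c * wsum m (visit x) h / m - 1)\<^sup>2)"
proof (rule integrable_measure_pmf_bounded[where B="(\<bar>c\<bar> * real (Suc m) / m + 1)\<^sup>2"])
  fix h assume "h \<in> set_pmf (history K i (Suc m))"
  from visit_average_bound[OF this, of c x]
  have "\<bar>c * wsum m (visit x) h / m - 1\<bar> \<le> \<bar>\<bar>c\<bar> * real (Suc m) / m + 1\<bar>" by linarith
  then have "(c * wsum m (visit x) h / m - 1)\<^sup>2 \<le> (\<bar>c\<bar> * real (Suc m) / m + 1)\<^sup>2"
    by (simp only: abs_le_square_iff)
  then show "norm ((c * wsum m (visit x) h / m - 1)\<^sup>2) \<le> (\<bar>c\<bar> * real (Suc m) / m + 1)\<^sup>2" by simp
qed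

lemma exp_diff_one_bound:
  fixes x :: real
  assumes "x \<le> C" "0 \<le> C"
  shows "\<bar>exp x - 1\<bar> \<le> exp C * \<bar>x\<bar>"
proof (cases "0 \<le> x")
  case True
  have "1 - x \<le> exp (- x)" using exp_ge_add_one_self[of "- x"] by simp
  then have "exp x * (1 - x) \<le> exp x * exp (- x)" by (intro mult_left_mono) auto
  then have "exp x - 1 \<le> exp x * x" by (simp add: exp_minus algebra_simps)
  also have "\<dots> \<le> exp C * x" using True assms by (intro mult_right_mono) auto
  finally show ?thesis using True by simp
next
  case False
  have "\<bar>exp x - 1\<bar> = 1 - exp x" using False by simp
  also have "\<dots> \<le> - x" using exp_ge_add_one_self[of x] by linarith
  also have "\<dots> \<le> exp C * \<bar>x\<bar>" using False assms mult_right_mono[of 1 "exp C" "- x"] by simp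
  finally show ?thesis .
qed

lemma (in prob_space) expectation_abs_le_sqrt:
  fixes X :: "'a \<Rightarrow> real"
  assumes "random_variable borel X" "integrable M (\<lambda>x. (X x)\<^sup>2)"
  shows "expectation (\<lambda>x. \<bar>X x\<bar>) \<le> sqrt (expectation (\<lambda>x. (X x)\<^sup>2))"
proof -
  have i: "integrable M (\<lambda>x. \<bar>X x\<bar>)"
    using square_integrable_imp_integrable[OF assms] by simp
  have "0 \<le> variance (\<lambda>x. \<bar>X x\<bar>)" by (rule variance_positive)
  also have "\<dots> = expectation (\<lambda>x. (X x)\<^sup>2) - (expectation (\<lambda>x. \<bar>X x\<bar>))\<^sup>2"
    using i assms by (subst variance_eq) auto
  finally show ?thesis by (intro real_le_rsqrt) simp
qed

context semi_markov
begin

lemma wsum_second_moment: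
  assumes B: "\<And>x y. \<bar>d x y\<bar> \<le> B"
    and centered: "\<And>x. measure_pmf.expectation (K x) (d x) = 0"
    and v: "\<And>x. measure_pmf.expectation (K x) (\<lambda>y. (d x y)\<^sup>2) \<le> v"
  shows "measure_pmf.expectation (history K i n) (\<lambda>h. (wsum m d h)\<^sup>2) \<le> real n * v"
proof (induction n)
  case (Suc n)
  have B0: "0 \<le> B" using B[of undefined undefined] by linarith
  have v0: "0 \<le> v" by (rule order_trans[OF _ v[of undefined]]) (rule Bochner_Integration.integral_nonneg, simp)
  have wb: "(wsum m d h)\<^sup>2 \<le> (real (length h - 1) * B)\<^sup>2" for h
  proof -
    have "\<bar>wsum m d h\<bar> \<le> \<bar>real (length h - 1) * B\<bar>" using wsum_bound[of d B m h] B B0 by auto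
    then show ?thesis by (simp only: abs_le_square_iff)
  qed
  have dint: "integrable (K x) (d x)" "integrable (K x) (\<lambda>y. (d x y)\<^sup>2)" for x
  proof -
    show "integrable (K x) (d x)"
      by (rule integrable_measure_pmf_bounded[where B=B]) (simp add: B)
    have "(d x y)\<^sup>2 \<le> B\<^sup>2" for y
      using B[of x y] by (simp add: abs_le_square_iff[symmetric])
    then show "integrable (K x) (\<lambda>y. (d x y)\<^sup>2)"
      by (intro integrable_measure_pmf_bounded[where B="B\<^sup>2"]) simp
  qed
  have step: "measure_pmf.expectation (K (cur h)) (\<lambda>y. (wsum m d (y # h))\<^sup>2) \<le> (wsum m d h)\<^sup>2 + v"
    if "h \<noteq> []" for h
  proof (cases "total h \<le> m")
    case True
    have "measure_pmf.expectation (K (cur h)) (\<lambda>y. (wsum m d (y # h))\<^sup>2) =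
        measure_pmf.expectation (K (cur h)) (\<lambda>y. (wsum m d h)\<^sup>2 + (2 * wsum m d h * d (cur h) y + (d (cur h) y)\<^sup>2))"
      using that True by (simp add: power2_sum algebra_simps)
    also have "\<dots> = (wsum m d h)\<^sup>2 + measure_pmf.expectation (K (cur h)) (\<lambda>y. (d (cur h) y)\<^sup>2)"
      using dint by (simp add: centered)
    finally show ?thesis using v by simp
  qed (use that v0 in simp)
  have "measure_pmf.expectation (history K i (Suc n)) (\<lambda>h. (wsum m d h)\<^sup>2) =
      measure_pmf.expectation (history K i n) (\<lambda>h. measure_pmf.expectation (K (cur h)) (\<lambda>y. (wsum m d (y # h))\<^sup>2))"
  proof (rule expectation_history_Suc[where B="(real (Suc n) * B)\<^sup>2"])
    show "\<bar>(wsum m d h)\<^sup>2\<bar> \<le> (real (Suc n) * B)\<^sup>2" if "length h = Suc (Suc n)" for h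
      using wb[of h] that by simp
  qed
  also have "\<dots> \<le> measure_pmf.expectation (history K i n) (\<lambda>h. (wsum m d h)\<^sup>2 + v)"
  proof (rule integral_mono_AE)
    show "integrable (history K i n) (\<lambda>h. (wsum m d h)\<^sup>2 + v)"
      by (rule integrable_measure_pmf_bounded[where B="(real n * B)\<^sup>2 + v"])
        (use wb v0 in \<open>auto dest!: length_history simp: abs_of_nonneg\<close>, metis diff_Suc_1 length_history wb)
    show "integrable (history K i n) (\<lambda>h. measure_pmf.expectation (K (cur h)) (\<lambda>y. (wsum m d (y # h))\<^sup>2))"
    proof (rule integrable_measure_pmf_bounded[where B="(real n * B)\<^sup>2 + v"])
      fix h assume h: "h \<in> set_pmf (history K i n)"
      show "norm (measure_pmf.expectation (K (cur h)) (\<lambda>y. (wsum m d (y # h))\<^sup>2)) \<le> (real n * B)\<^sup>2 + v"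
        using step[OF history_nonempty[OF h]] wb[of h] length_history[OF h] by simp
    qed
  qed (auto simp: AE_measure_pmf_iff intro!: step dest: history_nonempty)
  also have "\<dots> = measure_pmf.expectation (history K i n) (\<lambda>h. (wsum m d h)\<^sup>2) + v"
  proof (subst Bochner_Integration.integral_add)
    show "integrable (history K i n) (\<lambda>h. (wsum m d h)\<^sup>2)"
    proof (rule integrable_measure_pmf_bounded[where B="(real n * B)\<^sup>2"])
      fix h assume h: "h \<in> set_pmf (history K i n)"
      show "norm ((wsum m d h)\<^sup>2) \<le> (real n * B)\<^sup>2"
        using wb[of h] length_history[OF h] by simp
    qed
  qed auto
  finally show ?case using Suc by (simp add: algebra_simps)
qed simp

lemma wsum_first_moment:
  assumes B: "\<And>x y. \<bar>d x y\<bar> \<le> B"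
    and v: "\<And>x. measure_pmf.expectation (K x) (d x) \<le> v" "0 \<le> v"
  shows "measure_pmf.expectation (history K i n) (wsum m d) \<le> real n * v"
proof (induction n)
  case (Suc n)
  have wb: "\<bar>wsum m d h\<bar> \<le> (length h - 1) * B" for h by (rule wsum_bound[OF B])
  have dint: "integrable (K x) (d x)" for x
    by (rule integrable_measure_pmf_bounded[where B=B]) (simp add: B)
  have step: "measure_pmf.expectation (K (cur h)) (\<lambda>y. wsum m d (y # h)) =
      wsum m d h + (if total h \<le> m then measure_pmf.expectation (K (cur h)) (d (cur h)) else 0)"
    if "h \<noteq> []" for h
    using that dint by simp
  have i1: "integrable (history K i n) (wsum m d)"
  proof (rule integrable_measure_pmf_bounded[where B="real n * B"])
    fix h assume h: "h \<in> set_pmf (history K i n)"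
    show "norm (wsum m d h) \<le> real n * B" using wb[of h] length_history[OF h] by simp
  qed
  have i2: "integrable (history K i n) (\<lambda>h. if total h \<le> m then measure_pmf.expectation (K (cur h)) (d (cur h)) else 0)"
  proof (rule integrable_measure_pmf_bounded[where B="\<bar>B\<bar>"])
    fix h
    show "norm (if total h \<le> m then measure_pmf.expectation (K (cur h)) (d (cur h)) else 0) \<le> \<bar>B\<bar>"
      using expectation_bounded_pmf[of "K (cur h)" "d (cur h)" B] B by auto
  qed
  have "measure_pmf.expectation (history K i (Suc n)) (wsum m d) =
      measure_pmf.expectation (history K i n) (\<lambda>h. measure_pmf.expectation (K (cur h)) (\<lambda>y. wsum m d (y # h)))"
    by (rule expectation_history_Suc[where B="Suc n * B"]) (use wb in \<open>metis diff_Suc_1\<close>)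
  also have "\<dots> = measure_pmf.expectation (history K i n) (\<lambda>h. wsum m d h +
      (if total h \<le> m then measure_pmf.expectation (K (cur h)) (d (cur h)) else 0))"
    by (rule expectation_pmf_cong) (rule step, erule history_nonempty)
  also have "\<dots> = measure_pmf.expectation (history K i n) (wsum m d) + measure_pmf.expectation (history K i n)
      (\<lambda>h. if total h \<le> m then measure_pmf.expectation (K (cur h)) (d (cur h)) else 0)"
    by (rule Bochner_Integration.integral_add[OF i1 i2])
  also have "measure_pmf.expectation (history K i n)
      (\<lambda>h. if total h \<le> m then measure_pmf.expectation (K (cur h)) (d (cur h)) else 0) \<le>
      measure_pmf.expectation (history K i n) (\<lambda>_. v)"
    by (rule integral_mono_AE[OF i2]) (use v in auto)
  finally show ?case using Suc by (simp add: algebra_simps)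
qed simp

text \<open>
  The factor \<open>exp (b x)\<close> compensates the characteristic function of one increment up to \<open>\<epsilon>\<close>, so the
  compensated exponential is a martingale up to \<open>\<epsilon>\<close> per step.
\<close>

lemma wsum_iexp_compensated:
  assumes b: "\<And>x. 0 \<le> b x" "\<And>x. b x \<le> \<beta>"
    and \<epsilon>: "\<And>x. norm (measure_pmf.expectation (K x) (\<lambda>y. iexp (d x y)) * exp (b x) - 1) \<le> \<epsilon>"
  shows "norm (measure_pmf.expectation (history K i n)
      (\<lambda>h. iexp (wsum m d h) * exp (wsum m (\<lambda>x y. b x) h)) - 1) \<le> n * \<epsilon> * exp (real n * \<beta>)"
proof (induction n)
  case (Suc n)
  have \<epsilon>0: "0 \<le> \<epsilon>" using \<epsilon>[of undefined] norm_ge_zero order_trans by blast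
  have \<beta>0: "0 \<le> \<beta>" using b[of undefined] by linarith
  define F where "F h = iexp (wsum m d h) * complex_of_real (exp (wsum m (\<lambda>x y. b x) h))" for h
  define \<phi> where "\<phi> x = measure_pmf.expectation (K x) (\<lambda>y. iexp (d x y)) * exp (b x)" for x
  have Fb: "norm (F h) \<le> exp (real (length h - 1) * \<beta>)" for h
  proof -
    have "norm (F h) = exp (wsum m (\<lambda>x y. b x) h)" by (simp add: F_def norm_mult)
    also have "\<dots> \<le> exp (real (length h - 1) * \<beta>)"
      using wsum_bound[of "\<lambda>x y. b x" \<beta> m h] b by auto
    finally show ?thesis .
  qed
  have step: "measure_pmf.expectation (K (cur h)) (\<lambda>y. F (y # h)) =
      F h + F h * (if total h \<le> m then \<phi> (cur h) - 1 else 0)" if "h \<noteq> []" for h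
  proof (cases "total h \<le> m")
    case True
    have "F (y # h) = (F h * exp (b (cur h))) * iexp (d (cur h) y)" for y
      using that True by (simp add: F_def exp_add distrib_left ac_simps)
    then show ?thesis using True by (simp add: \<phi>_def algebra_simps)
  qed (use that in \<open>simp add: F_def\<close>)
  have i1: "integrable (history K i n) F"
  proof (rule integrable_measure_pmf_bounded[where B="exp (real n * \<beta>)"])
    fix h assume h: "h \<in> set_pmf (history K i n)"
    show "norm (F h) \<le> exp (real n * \<beta>)" using Fb[of h] length_history[OF h] by simp
  qed
  have rb: "norm (F h * (if total h \<le> m then \<phi> (cur h) - 1 else 0)) \<le> exp (real n * \<beta>) * \<epsilon>"
    if h: "h \<in> set_pmf (history K i n)" for h
    using Fb[of h] length_history[OF h] \<epsilon>[of "cur h"] \<epsilon>0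
    by (auto simp: norm_mult \<phi>_def exp_of_real intro!: mult_mono)
  have i2: "integrable (history K i n) (\<lambda>h. F h * (if total h \<le> m then \<phi> (cur h) - 1 else 0))"
    by (rule integrable_measure_pmf_bounded[OF rb])
  have "measure_pmf.expectation (history K i (Suc n)) F =
      measure_pmf.expectation (history K i n) (\<lambda>h. measure_pmf.expectation (K (cur h)) (\<lambda>y. F (y # h)))"
    by (rule expectation_history_Suc_complex[where B="exp (real (Suc n) * \<beta>)"]) (use Fb in \<open>metis diff_Suc_1\<close>)
  also have "\<dots> = measure_pmf.expectation (history K i n) (\<lambda>h. F h + F h * (if total h \<le> m then \<phi> (cur h) - 1 else 0))"
    by (rule expectation_pmf_cong) (rule step, erule history_nonempty)
  also have "\<dots> = measure_pmf.expectation (history K i n) F +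
      measure_pmf.expectation (history K i n) (\<lambda>h. F h * (if total h \<le> m then \<phi> (cur h) - 1 else 0))"
    by (rule Bochner_Integration.integral_add[OF i1 i2])
  finally have E: "measure_pmf.expectation (history K i (Suc n)) F = measure_pmf.expectation (history K i n) F +
      measure_pmf.expectation (history K i n) (\<lambda>h. F h * (if total h \<le> m then \<phi> (cur h) - 1 else 0))" .
  have "norm (a + b - 1) \<le> norm (a - 1) + norm b" for a b :: complex
    using norm_triangle_ineq[of "a - 1" b] by (simp add: algebra_simps)
  then have "norm (measure_pmf.expectation (history K i (Suc n)) F - 1) \<le>
      norm (measure_pmf.expectation (history K i n) F - 1) +
      norm (measure_pmf.expectation (history K i n) (\<lambda>h. F h * (if total h \<le> m then \<phi> (cur h) - 1 else 0)))"
    unfolding E .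
  also have "norm (measure_pmf.expectation (history K i n) F - 1) \<le> n * \<epsilon> * exp (real n * \<beta>)"
    using Suc unfolding F_def by (simp add: exp_of_real)
  also have "norm (measure_pmf.expectation (history K i n)
      (\<lambda>h. F h * (if total h \<le> m then \<phi> (cur h) - 1 else 0))) \<le> exp (real n * \<beta>) * \<epsilon>"
    by (rule expectation_bounded_pmf[OF rb])
  also have "n * \<epsilon> * exp (real n * \<beta>) + exp (real n * \<beta>) * \<epsilon> = Suc n * \<epsilon> * exp (real n * \<beta>)" by (simp add: algebra_simps)
  also have "\<dots> \<le> Suc n * \<epsilon> * exp (real (Suc n) * \<beta>)"
    using \<epsilon>0 \<beta>0 by (intro mult_left_mono) (auto intro!: mult_right_mono)
  finally show ?case unfolding F_def by (simp add: exp_of_real)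
qed simp

end

lemma wsum_telescope:
  fixes g :: "'e \<Rightarrow> real"
  assumes "\<And>x. \<bar>g x\<bar> \<le> G" "h \<noteq> []"
  shows "(total h \<le> m \<longrightarrow> wsum m (\<lambda>x y. g (fst y) - g x) h = g (cur h) - g (fst (last h))) \<and>
    \<bar>wsum m (\<lambda>x y. g (fst y) - g x) h\<bar> \<le> 2 * G"
  using assms(2)
proof (induction h)
  case (Cons y h)
  show ?case
  proof (cases "h = []")
    case True
    then show ?thesis using assms(1)[of "fst y"] by simp
  next
    case False
    then have IH: "total h \<le> m \<longrightarrow> wsum m (\<lambda>x y. g (fst y) - g x) h = g (cur h) - g (fst (last h))"
      "\<bar>wsum m (\<lambda>x y. g (fst y) - g x) h\<bar> \<le> 2 * G" using Cons by auto
    have "\<bar>g (fst y) - g (fst (last h))\<bar> \<le> 2 * G"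
      using assms(1)[of "fst y"] assms(1)[of "fst (last h)"] by linarith
    then show ?thesis using IH False by auto
  qed
qed simp

lemma wsum_truncated_total:
  assumes "h \<noteq> []" "snd (last h) = 0"
  shows "(total h \<le> m \<longrightarrow> wsum m (\<lambda>x y. min (real (snd y)) m) h = total h) \<and>
    (m < total h \<longrightarrow> m \<le> wsum m (\<lambda>x y. min (real (snd y)) m) h \<and>
      (wsum m (\<lambda>x y. min (real (snd y)) m) h - m)\<^sup>2 \<le> wsum m (\<lambda>x y. (min (real (snd y)) m)\<^sup>2) h)"
  using assms
proof (induction h)
  case (Cons y h)
  show ?case
  proof (cases "h = []")
    case True
    then show ?thesis using Cons by (simp add: total_def)
  next
    case False
    let ?w = "wsum m (\<lambda>x y. min (real (snd y)) m)" and ?v = "wsum m (\<lambda>x y. (min (real (snd y)) m)\<^sup>2)"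
    have IH: "total h \<le> m \<longrightarrow> ?w h = total h"
      "m < total h \<longrightarrow> m \<le> ?w h \<and> (?w h - m)\<^sup>2 \<le> ?v h" using Cons False by auto
    have v0: "0 \<le> ?v h" by (rule wsum_nonneg) simp
    show ?thesis
    proof (cases "total h \<le> m")
      case True
      have "(real (total h) + min (real (snd y)) m - m)\<^sup>2 \<le> ?v h + (min (real (snd y)) m)\<^sup>2" if "m < snd y + total h"
      proof -
        have "(real (total h) + min (real (snd y)) m - m)\<^sup>2 \<le> (min (real (snd y)) m)\<^sup>2"
          using True that by (intro power_mono) (auto simp: min_def)
        with v0 show ?thesis by linarith
      qed
      moreover have "m < snd y + total h \<Longrightarrow> real m \<le> real (total h) + min (real (snd y)) m"
        "snd y + total h \<le> m \<Longrightarrow> min (real (snd y)) m = snd y" by (auto simp: min_def)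
      ultimately show ?thesis using True IH(1) False v0
        by (cases "m < snd y + total h") (simp_all add: not_less)
    next
      case F: False
      then show ?thesis using IH False by auto
    qed
  qed
qed simp

context semi_markov
begin

lemma truncated_moments:
  assumes "integrable (K x) (\<lambda>y. real (snd y))"
  shows "(\<lambda>m. measure_pmf.expectation (K x) (\<lambda>y. min (real (snd y)) (real m))) \<longlonglongrightarrow>
      measure_pmf.expectation (K x) (\<lambda>y. real (snd y))"
    and "(\<lambda>m. measure_pmf.expectation (K x) (\<lambda>y. (min (real (snd y)) (real m))\<^sup>2) / real m) \<longlonglongrightarrow> 0"
proof -
  show "(\<lambda>m. measure_pmf.expectation (K x) (\<lambda>y. min (real (snd y)) (real m))) \<longlonglongrightarrow>
      measure_pmf.expectation (K x) (\<lambda>y. real (snd y))"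
  proof (rule integral_dominated_convergence[where w="\<lambda>y. real (snd y)"])
    show "AE y in K x. (\<lambda>m. min (real (snd y)) (real m)) \<longlonglongrightarrow> real (snd y)"
    proof (rule AE_I2)
      fix y :: "'e \<times> nat"
      show "(\<lambda>m. min (real (snd y)) (real m)) \<longlonglongrightarrow> real (snd y)"
        by (rule tendsto_eventually) (auto simp: eventually_sequentially intro!: exI[of _ "snd y"])
    qed
  qed (use assms in auto)
  have "(\<lambda>m. measure_pmf.expectation (K x) (\<lambda>y. (min (real (snd y)) (real m))\<^sup>2 / real m)) \<longlonglongrightarrow>
      measure_pmf.expectation (K x) (\<lambda>y. 0)"
  proof (rule integral_dominated_convergence[where w="\<lambda>y. real (snd y)"])
    show "AE y in K x. (\<lambda>m. (min (real (snd y)) (real m))\<^sup>2 / real m) \<longlonglongrightarrow> 0"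
    proof (rule AE_I2)
      fix y :: "'e \<times> nat"
      have "(\<lambda>m. (real (snd y))\<^sup>2 / real m) \<longlonglongrightarrow> 0" by (rule lim_const_over_n)
      then show "(\<lambda>m. (min (real (snd y)) (real m))\<^sup>2 / real m) \<longlonglongrightarrow> 0"
        by (rule Lim_transform_eventually) (auto simp: eventually_sequentially intro!: exI[of _ "snd y"])
    qed
    have "(min k m)\<^sup>2 / m \<le> k" if "0 \<le> k" "0 \<le> m" for k m :: real
    proof (cases "m = 0")
      case False
      have "(min k m)\<^sup>2 \<le> k * m" unfolding power2_eq_square using that by (intro mult_mono) auto
      then show ?thesis using that False by (simp add: divide_le_eq)
    qed (use that in simp)
    then show "AE y in K x. norm ((min (real (snd y)) (real m))\<^sup>2 / real m) \<le> real (snd y)" for m by simp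
  qed (use assms in auto)
  then show "(\<lambda>m. measure_pmf.expectation (K x) (\<lambda>y. (min (real (snd y)) (real m))\<^sup>2) / real m) \<longlonglongrightarrow> 0"
    by simp
qed

text \<open>
  \<open>g\<close> solves the Poisson equation for the sojourn times with the visits to \<open>i\<close> as compensator: with
  \<open>g x\<close> the expected time to reach \<open>i\<close> from \<open>x \<noteq> i\<close> and \<open>g i = 0\<close>, the process
  \<open>S\<^sub>n + g (J\<^sub>n) - \<mu> * #{k < n. J\<^sub>k = i}\<close> is a martingale.
\<close>

lemma visits_law_of_large_numbers:
  assumes int: "\<And>x. integrable (K x) (\<lambda>y. real (snd y))"
    and g: "\<And>x. measure_pmf.expectation (K x) (\<lambda>y. real (snd y)) + measure_pmf.expectation (K x) (\<lambda>y. g (fst y))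
      = g x + (if x = i then \<mu> else 0)"
  shows "(\<lambda>m. measure_pmf.expectation (history K i\<^sub>0 (Suc m)) (\<lambda>h. (\<mu> * wsum m (visit i) h / m - 1)\<^sup>2)) \<longlonglongrightarrow> 0"
proof -
  define G where "G = (\<Sum>x\<in>UNIV. \<bar>g x\<bar>)"
  have G: "\<bar>g x\<bar> \<le> G" for x unfolding G_def by (rule member_le_sum) auto
  have G0: "0 \<le> G" using G[of undefined] by linarith
  define mean where "mean x = measure_pmf.expectation (K x) (\<lambda>y. real (snd y))" for x
  define t where "t m x = measure_pmf.expectation (K x) (\<lambda>y. min (real (snd y)) (real m))" for m x
  define s where "s m = (\<Sum>x\<in>UNIV. measure_pmf.expectation (K x) (\<lambda>y. (min (real (snd y)) (real m))\<^sup>2))" for m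
  define \<delta> where "\<delta> m = (\<Sum>x\<in>UNIV. \<bar>mean x - t m x\<bar>)" for m
  have \<delta>: "\<delta> \<longlonglongrightarrow> 0"
  proof -
    have "(\<lambda>m. \<Sum>x\<in>UNIV. \<bar>mean x - t m x\<bar>) \<longlonglongrightarrow> (\<Sum>x::'e\<in>UNIV. \<bar>mean x - mean x\<bar>)"
      unfolding t_def mean_def by (intro tendsto_intros truncated_moments int)
    then show ?thesis by (simp add: \<delta>_def[abs_def])
  qed
  have s: "(\<lambda>m. s m / m) \<longlonglongrightarrow> 0"
  proof -
    have "(\<lambda>m. \<Sum>x\<in>UNIV. measure_pmf.expectation (K x) (\<lambda>y. (min (real (snd y)) (real m))\<^sup>2) / real m) \<longlonglongrightarrow> (\<Sum>x::'e\<in>UNIV. 0)"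
      by (intro tendsto_sum truncated_moments int)
    then show ?thesis by (simp add: s_def sum_divide_distrib)
  qed
  have s_ge: "measure_pmf.expectation (K x) (\<lambda>y. (min (real (snd y)) (real m))\<^sup>2) \<le> s m" for x m
    unfolding s_def by (rule member_le_sum) (auto intro!: Bochner_Integration.integral_nonneg)
  have s0: "0 \<le> s m" for m unfolding s_def by (intro sum_nonneg Bochner_Integration.integral_nonneg) auto
  define R where "R m = 4 * (real (Suc m) * s m + (2 * G)\<^sup>2 + (real (Suc m) * \<delta> m)\<^sup>2 + real (Suc m) * (2 * s m + 2 * G\<^sup>2))" for m
  have bound: "measure_pmf.expectation (history K i\<^sub>0 (Suc m)) (\<lambda>h. (\<mu> * wsum m (visit i) h / m - 1)\<^sup>2) \<le> R m / (real m)\<^sup>2"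
    if m: "m > 0" for m
  proof -
    define c where "c x = t m x + g x + (if x = i then \<mu> else 0) - mean x" for x
    define d where "d x y = min (real (snd y)) (real m) + g (fst y) - c x" for x and y :: "'e \<times> nat"
    let ?min = "\<lambda>y::'e \<times> nat. min (real (snd y)) (real m)"
    have imin: "integrable (K x) ?min" "integrable (K x) (\<lambda>y. (?min y)\<^sup>2)" for x
      by (rule integrable_measure_pmf_bounded[where B="m"], simp)
        (rule integrable_measure_pmf_bounded[where B="(real m)\<^sup>2"], simp add: power_mono)
    have ig: "integrable (K x) (\<lambda>y. g (fst y))" for x
      by (rule integrable_measure_pmf_bounded[where B=G]) (simp add: G)
    have Ez: "measure_pmf.expectation (K x) (\<lambda>y. ?min y + g (fst y)) = c x" for x
      using imin[of x] ig[of x] g[of x] by (simp add: c_def t_def mean_def)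
    have centered: "measure_pmf.expectation (K x) (d x) = 0" for x
      using Ez[of x] imin[of x] ig[of x] unfolding d_def by simp
    define B where "B = real m + G + (\<Sum>x\<in>UNIV. \<bar>c x\<bar>)"
    have "\<bar>c x\<bar> \<le> (\<Sum>x\<in>UNIV. \<bar>c x\<bar>)" for x by (rule member_le_sum) auto
    moreover have "0 \<le> ?min y" "?min y \<le> real m" for y by auto
    ultimately have dB: "\<bar>d x y\<bar> \<le> B" for x y
      using G[of "fst y"] unfolding d_def B_def abs_le_iff by (smt (verit))
    have i2: "integrable (K x) (\<lambda>y. (?min y + g (fst y))\<^sup>2)" for x
    proof (rule integrable_measure_pmf_bounded[where B="(m + G)\<^sup>2"])
      fix y show "norm ((?min y + g (fst y))\<^sup>2) \<le> (m + G)\<^sup>2"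
        using G[of "fst y"] by (auto simp: abs_le_square_iff[symmetric] min_def)
    qed
    have v: "measure_pmf.expectation (K x) (\<lambda>y. (d x y)\<^sup>2) \<le> 2 * s m + 2 * G\<^sup>2" for x
    proof -
      have "measure_pmf.expectation (K x) (\<lambda>y. (d x y)\<^sup>2) =
          measure_pmf.variance (K x) (\<lambda>y. ?min y + g (fst y))"
        by (simp only: Ez d_def)
      also have "\<dots> = measure_pmf.expectation (K x) (\<lambda>y. (?min y + g (fst y))\<^sup>2) - (c x)\<^sup>2"
        using i2[of x] imin(1)[of x] ig[of x] by (subst measure_pmf.variance_eq) (auto simp: Ez)
      also have "\<dots> \<le> measure_pmf.expectation (K x) (\<lambda>y. (?min y + g (fst y))\<^sup>2)" by simp
      also have "\<dots> \<le> measure_pmf.expectation (K x) (\<lambda>y. 2 * (?min y)\<^sup>2 + 2 * G\<^sup>2)"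
      proof (rule integral_mono[OF i2])
        show "integrable (K x) (\<lambda>y. 2 * (?min y)\<^sup>2 + 2 * G\<^sup>2)" using imin[of x] by simp
        fix y :: "'e \<times> nat"
        have "(g (fst y))\<^sup>2 \<le> G\<^sup>2" using G[of "fst y"] G0 by (simp add: abs_le_square_iff[symmetric])
        moreover have "(a + b)\<^sup>2 \<le> 2 * a\<^sup>2 + 2 * b\<^sup>2" for a b :: real
          using sum_squares_bound[of a b] by (simp add: power2_sum)
        ultimately show "(?min y + g (fst y))\<^sup>2 \<le> 2 * (?min y)\<^sup>2 + 2 * G\<^sup>2"
          by (meson add_left_mono mult_left_mono order_trans zero_le_numeral)
      qed
      also have "\<dots> \<le> 2 * s m + 2 * G\<^sup>2" using s_ge[of x m] imin[of x] by simp
      finally show ?thesis .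
    qed
    have E1: "measure_pmf.expectation (history K i\<^sub>0 (Suc m)) (\<lambda>h. (wsum m d h)\<^sup>2) \<le> real (Suc m) * (2 * s m + 2 * G\<^sup>2)"
      by (rule wsum_second_moment[OF dB centered v])
    have E2: "measure_pmf.expectation (history K i\<^sub>0 (Suc m)) (wsum m (\<lambda>x y. (?min y)\<^sup>2)) \<le> real (Suc m) * s m"
      by (rule wsum_first_moment[where B="(real m)\<^sup>2"]) (auto simp: power_mono s_ge s0)
    have pointwise: "(\<mu> * wsum m (visit i) h / m - 1)\<^sup>2 \<le>
        4 * (wsum m (\<lambda>x y. (?min y)\<^sup>2) h + (2 * G)\<^sup>2 + (real (Suc m) * \<delta> m)\<^sup>2 + (wsum m d h)\<^sup>2) / (real m)\<^sup>2"
      if h: "h \<in> set_pmf (history K i\<^sub>0 (Suc m))" for h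
    proof -
      note ne = history_nonempty[OF h]
      define w where "w = wsum m (\<lambda>x y. ?min y) h"
      define tel where "tel = wsum m (\<lambda>x y. g (fst y) - g x) h"
      define r where "r = wsum m (\<lambda>x y. mean x - t m x) h"
      have "d x y = ?min y + ((g (fst y) - g x) + ((mean x - t m x) - \<mu> * visit i x y))" for x y
        by (simp add: d_def c_def visit_def)
      then have "d = (\<lambda>x y. ?min y + ((g (fst y) - g x) + ((mean x - t m x) - \<mu> * visit i x y)))"
        by (intro ext)
      then have wd: "wsum m d h = w + tel + r - \<mu> * wsum m (visit i) h"
        by (simp add: wsum_add wsum_diff wsum_scale w_def tel_def r_def)
      have "m < total h" using history_positive[OF h] by simp
      then have w: "(w - m)\<^sup>2 \<le> wsum m (\<lambda>x y. (?min y)\<^sup>2) h"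
        using wsum_truncated_total[OF ne, of m] last_history[OF h] by (simp add: w_def)
      have "\<bar>tel\<bar> \<le> 2 * G" using wsum_telescope[of g G h m] G ne by (simp add: tel_def)
      then have tel: "tel\<^sup>2 \<le> (2 * G)\<^sup>2" using abs_le_square_iff[of tel "2 * G"] G0 by linarith
      have "\<bar>mean x - t m x\<bar> \<le> \<delta> m" for x unfolding \<delta>_def by (rule member_le_sum) auto
      with wsum_bound[of "\<lambda>x y. mean x - t m x" "\<delta> m" m h] length_history[OF h]
      have "\<bar>r\<bar> \<le> real (Suc m) * \<delta> m" by (simp add: r_def)
      then have r: "r\<^sup>2 \<le> (real (Suc m) * \<delta> m)\<^sup>2"
        using abs_le_square_iff[of r "real (Suc m) * \<delta> m"] by linarith
      have four: "(a + b + c - e)\<^sup>2 \<le> 4 * (a\<^sup>2 + b\<^sup>2 + c\<^sup>2 + e\<^sup>2)" for a b c e :: real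
      proof -
        have "4 * (a\<^sup>2 + b\<^sup>2 + c\<^sup>2 + e\<^sup>2) - (a + b + c - e)\<^sup>2 =
            (a - b)\<^sup>2 + (a - c)\<^sup>2 + (b - c)\<^sup>2 + (a + e)\<^sup>2 + (b + e)\<^sup>2 + (c + e)\<^sup>2"
          by (simp add: power2_eq_square algebra_simps)
        then show ?thesis by (smt (verit) zero_le_power2)
      qed
      have "\<mu> * wsum m (visit i) h / m - 1 = ((w - m) + tel + r - wsum m d h) / m"
        using wd \<open>m > 0\<close> by (simp add: field_simps)
      then have "(\<mu> * wsum m (visit i) h / m - 1)\<^sup>2 = ((w - m) + tel + r - wsum m d h)\<^sup>2 / (real m)\<^sup>2"
        by (simp add: power_divide)
      also have "\<dots> \<le> 4 * ((w - m)\<^sup>2 + tel\<^sup>2 + r\<^sup>2 + (wsum m d h)\<^sup>2) / (real m)\<^sup>2"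
        by (intro divide_right_mono four) simp
      also have "\<dots> \<le> 4 * (wsum m (\<lambda>x y. (?min y)\<^sup>2) h + (2 * G)\<^sup>2 + (real (Suc m) * \<delta> m)\<^sup>2 + (wsum m d h)\<^sup>2) / (real m)\<^sup>2"
        using w tel r by (intro divide_right_mono mult_left_mono add_mono) auto
      finally show ?thesis .
    qed
    have i1: "integrable (history K i\<^sub>0 (Suc m)) (wsum m (\<lambda>x y. (?min y)\<^sup>2))"
    proof (rule integrable_measure_pmf_bounded[where B="real (Suc m) * (real m)\<^sup>2"])
      fix h assume h: "h \<in> set_pmf (history K i\<^sub>0 (Suc m))"
      show "norm (wsum m (\<lambda>x y. (?min y)\<^sup>2) h) \<le> real (Suc m) * (real m)\<^sup>2"
        using wsum_bound[of "\<lambda>x y. (?min y)\<^sup>2" "(real m)\<^sup>2" m h] length_history[OF h] by (simp add: power_mono)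
    qed
    have i3: "integrable (history K i\<^sub>0 (Suc m)) (\<lambda>h. (wsum m d h)\<^sup>2)"
    proof (rule integrable_measure_pmf_bounded[where B="(real (Suc m) * B)\<^sup>2"])
      fix h assume h: "h \<in> set_pmf (history K i\<^sub>0 (Suc m))"
      have "\<bar>wsum m d h\<bar> \<le> \<bar>real (Suc m) * B\<bar>" using wsum_bound[of d B m h] dB length_history[OF h] by simp
      then show "norm ((wsum m d h)\<^sup>2) \<le> (real (Suc m) * B)\<^sup>2" by (simp add: abs_le_square_iff)
    qed
    have "measure_pmf.expectation (history K i\<^sub>0 (Suc m)) (\<lambda>h. (\<mu> * wsum m (visit i) h / m - 1)\<^sup>2) \<le>
        measure_pmf.expectation (history K i\<^sub>0 (Suc m)) (\<lambda>h. 4 * (wsum m (\<lambda>x y. (?min y)\<^sup>2) h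
          + (2 * G)\<^sup>2 + (real (Suc m) * \<delta> m)\<^sup>2 + (wsum m d h)\<^sup>2) / (real m)\<^sup>2)"
      by (rule integral_mono_AE[OF visit_average_integrable]) (use i1 i3 pointwise in \<open>auto simp: AE_measure_pmf_iff\<close>)
    also have "\<dots> = 4 * (measure_pmf.expectation (history K i\<^sub>0 (Suc m)) (wsum m (\<lambda>x y. (?min y)\<^sup>2))
          + (2 * G)\<^sup>2 + (real (Suc m) * \<delta> m)\<^sup>2
          + measure_pmf.expectation (history K i\<^sub>0 (Suc m)) (\<lambda>h. (wsum m d h)\<^sup>2)) / (real m)\<^sup>2"
      using i1 i3 by simp
    also have "\<dots> \<le> R m / (real m)\<^sup>2"
      unfolding R_def using E1 E2 by (intro divide_right_mono mult_left_mono) auto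
    finally show ?thesis .
  qed
  have "(\<lambda>m. R m / (real m)\<^sup>2) \<longlonglongrightarrow> 0"
  proof -
    have one: "(\<lambda>m. real (Suc m) / m) \<longlonglongrightarrow> 1" by (rule LIMSEQ_Suc_n_over_n)
    have inv: "(\<lambda>m. 1 / real m) \<longlonglongrightarrow> 0" by (rule lim_const_over_n)
    have "(\<lambda>m. 4 * ((real (Suc m) / m) * (s m / m) + (2 * G)\<^sup>2 * (1 / real m) * (1 / real m) + ((real (Suc m) / m) * \<delta> m)\<^sup>2
        + (real (Suc m) / m) * (2 * (s m / m) + 2 * G\<^sup>2 * (1 / real m)))) \<longlonglongrightarrow>
        4 * (1 * 0 + (2 * G)\<^sup>2 * 0 * 0 + (1 * 0)\<^sup>2 + 1 * (2 * 0 + 2 * G\<^sup>2 * 0))"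
      by (intro tendsto_intros one inv s \<delta>)
    moreover have "4 * ((real (Suc m) / m) * (s m / m) + (2 * G)\<^sup>2 * (1 / real m) * (1 / real m) + ((real (Suc m) / m) * \<delta> m)\<^sup>2
        + (real (Suc m) / m) * (2 * (s m / m) + 2 * G\<^sup>2 * (1 / real m))) = R m / (real m)\<^sup>2" for m
      unfolding R_def power2_eq_square by (cases "m = 0") (simp_all add: field_simps del: of_nat_Suc)
    ultimately show ?thesis by simp
  qed
  then show ?thesis
  proof (rule Lim_null_comparison[rotated])
    show "\<forall>\<^sub>F m in sequentially. norm (measure_pmf.expectation (history K i\<^sub>0 (Suc m))
        (\<lambda>h. (\<mu> * wsum m (visit i) h / m - 1)\<^sup>2)) \<le> R m / (real m)\<^sup>2"
      using eventually_gt_at_top[of 0] by eventually_elim (use bound in \<open>simp add: Bochner_Integration.integral_nonneg\<close>)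
  qed
qed

end

context semi_markov
begin

lemma iexp_expectation_bound:
  assumes B: "\<And>y. \<bar>f y\<bar> \<le> B" and centered: "measure_pmf.expectation p f = 0"
  defines "\<sigma>2 \<equiv> measure_pmf.expectation p (\<lambda>y. (f y)\<^sup>2)"
  assumes s: "0 \<le> s" "s\<^sup>2 * B\<^sup>2 / 2 \<le> 1"
  shows "norm (measure_pmf.expectation p (\<lambda>y. iexp (s * f y)) * exp (s\<^sup>2 * \<sigma>2 / 2) - 1)
    \<le> s ^ 3 * B ^ 3 / 2 + s ^ 4 * B ^ 4 / 4"
proof -
  have B0: "0 \<le> B" using B[of undefined] by linarith
  have sq: "(f y)\<^sup>2 \<le> B\<^sup>2" for y using B[of y] B0 by (simp add: abs_le_square_iff[symmetric])
  have int: "integrable p f" "integrable p (\<lambda>y. (f y)\<^sup>2)" "integrable p (\<lambda>y. min (6 * (f y)\<^sup>2) (\<bar>s\<bar> * \<bar>f y\<bar> ^ 3))"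
  proof -
    show "integrable p f" by (rule integrable_measure_pmf_bounded[where B=B]) (simp add: B)
    show "integrable p (\<lambda>y. (f y)\<^sup>2)" by (rule integrable_measure_pmf_bounded[where B="B\<^sup>2"]) (simp add: sq)
    have "norm (min (6 * (f y)\<^sup>2) (\<bar>s\<bar> * \<bar>f y\<bar> ^ 3)) \<le> 6 * B\<^sup>2" for y
      using sq[of y] by (auto simp: min_def)
    then show "integrable p (\<lambda>y. min (6 * (f y)\<^sup>2) (\<bar>s\<bar> * \<bar>f y\<bar> ^ 3))"
      by (rule integrable_measure_pmf_bounded)
  qed
  have \<sigma>2: "0 \<le> \<sigma>2" "\<sigma>2 \<le> B\<^sup>2"
  proof -
    show "0 \<le> \<sigma>2" unfolding \<sigma>2_def by (rule Bochner_Integration.integral_nonneg) simp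
    have "\<sigma>2 \<le> measure_pmf.expectation p (\<lambda>_. B\<^sup>2)"
      unfolding \<sigma>2_def by (rule integral_mono) (use int sq in auto)
    then show "\<sigma>2 \<le> B\<^sup>2" by simp
  qed
  define b where "b = s\<^sup>2 * \<sigma>2 / 2"
  have b: "0 \<le> b" "b \<le> s\<^sup>2 * B\<^sup>2 / 2" "b \<le> 1"
    using \<sigma>2 s mult_left_mono[OF \<sigma>2(2), of "s\<^sup>2"] by (auto simp: b_def)
  define \<phi> where "\<phi> = measure_pmf.expectation p (\<lambda>y. iexp (s * f y))"
  have "norm (char (distr p borel f) s - (1 - s\<^sup>2 * \<sigma>2 / 2)) \<le>
      (s\<^sup>2 / 6) * measure_pmf.expectation p (\<lambda>y. min (6 * (f y)\<^sup>2) (\<bar>s\<bar> * \<bar>f y\<bar> ^ 3))"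
    by (rule prob_space.char_approx3'[OF measure_pmf.prob_space_axioms]) (use int centered in \<open>auto simp: \<sigma>2_def\<close>)
  also have "char (distr p borel f) s = \<phi>"
    by (simp add: char_def integral_distr \<phi>_def)
  also have "measure_pmf.expectation p (\<lambda>y. min (6 * (f y)\<^sup>2) (\<bar>s\<bar> * \<bar>f y\<bar> ^ 3)) \<le> measure_pmf.expectation p (\<lambda>y. s * B ^ 3)"
  proof (rule integral_mono[OF int(3)])
    fix y
    have "\<bar>s\<bar> * \<bar>f y\<bar> ^ 3 \<le> s * B ^ 3"
      using s B[of y] by (auto intro!: mult_left_mono power_mono)
    then show "min (6 * (f y)\<^sup>2) (\<bar>s\<bar> * \<bar>f y\<bar> ^ 3) \<le> s * B ^ 3" by linarith
  qed simp
  finally have "norm (\<phi> - (1 - b)) \<le> (s\<^sup>2 / 6) * (s * B ^ 3)"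
    by (simp add: b_def mult_left_mono)
  then have 1: "norm (\<phi> - complex_of_real (1 - b)) \<le> s ^ 3 * B ^ 3 / 6"
    by (simp add: power2_eq_square power3_eq_cube ac_simps)
  have eb: "exp b \<le> 3"
    using exp_le_cancel_iff[of b 1] b(3) exp_le by linarith
  have 2: "\<bar>(1 - b) * exp b - 1\<bar> \<le> b\<^sup>2"
  proof -
    have "(1 - b) * exp b \<le> exp (- b) * exp b"
      using exp_ge_add_one_self[of "- b"] by (intro mult_right_mono) auto
    then have "(1 - b) * exp b \<le> 1" by (simp add: exp_minus)
    moreover have "(1 - b) * (1 + b) \<le> (1 - b) * exp b"
      using exp_ge_add_one_self[of b] b(3) by (intro mult_left_mono) auto
    ultimately show ?thesis by (simp add: power2_eq_square algebra_simps)
  qed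
  have "\<phi> * exp b - 1 = (\<phi> - complex_of_real (1 - b)) * complex_of_real (exp b) + complex_of_real ((1 - b) * exp b - 1)"
    by (simp add: algebra_simps exp_of_real)
  then have "norm (\<phi> * exp b - 1) \<le> norm ((\<phi> - complex_of_real (1 - b)) * complex_of_real (exp b)) + \<bar>(1 - b) * exp b - 1\<bar>"
    by (metis norm_of_real norm_triangle_ineq)
  also have "\<dots> \<le> s ^ 3 * B ^ 3 / 6 * 3 + b\<^sup>2"
  proof (rule add_mono[OF _ 2])
    have "norm (\<phi> - complex_of_real (1 - b)) * exp b \<le> s ^ 3 * B ^ 3 / 6 * 3"
      by (rule mult_mono[OF 1 eb]) (use s B0 in auto)
    then show "norm ((\<phi> - complex_of_real (1 - b)) * complex_of_real (exp b)) \<le> s ^ 3 * B ^ 3 / 6 * 3"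
      by (simp only: norm_mult norm_of_real abs_exp_cancel)
  qed
  also have "b\<^sup>2 \<le> (s\<^sup>2 * B\<^sup>2 / 2)\<^sup>2" using b by (intro power_mono) auto
  also have "\<dots> = s ^ 4 * B ^ 4 / 4" by (simp add: power2_eq_square power4_eq_xxxx)
  finally show ?thesis by (simp add: \<phi>_def b_def mult.commute)
qed

theorem wsum_central_limit:
  assumes B: "\<And>x y. \<bar>d x y\<bar> \<le> B"
    and centered: "\<And>x. measure_pmf.expectation (K x) (d x) = 0"
    and \<mu>: "\<And>x. 0 < \<mu> x"
    and lln: "\<And>x. (\<lambda>m. measure_pmf.expectation (history K i (Suc m)) (\<lambda>h. (\<mu> x * wsum m (visit x) h / m - 1)\<^sup>2)) \<longlonglongrightarrow> 0"
  shows "(\<lambda>m. measure_pmf.expectation (history K i (Suc m)) (\<lambda>h. iexp (wsum m d h / sqrt m))) \<longlonglongrightarrow>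
    of_real (exp (- (\<Sum>x\<in>UNIV. measure_pmf.expectation (K x) (\<lambda>y. (d x y)\<^sup>2) / \<mu> x) / 2))"
proof -
  have B0: "0 \<le> B" using B[of undefined undefined] by linarith
  define \<sigma>2 where "\<sigma>2 x = measure_pmf.expectation (K x) (\<lambda>y. (d x y)\<^sup>2)" for x
  have \<sigma>2: "0 \<le> \<sigma>2 x" "\<sigma>2 x \<le> B\<^sup>2" for x
  proof -
    show "0 \<le> \<sigma>2 x" unfolding \<sigma>2_def by (rule Bochner_Integration.integral_nonneg) simp
    have "norm (\<sigma>2 x) \<le> B\<^sup>2"
      unfolding \<sigma>2_def by (rule expectation_bounded_pmf) (use B[of x] B0 in \<open>simp add: abs_le_square_iff[symmetric]\<close>)
    then show "\<sigma>2 x \<le> B\<^sup>2" by simp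
  qed
  define a where "a = (\<Sum>x\<in>UNIV. \<sigma>2 x / \<mu> x) / 2"
  have a0: "0 \<le> a" unfolding a_def using \<sigma>2 \<mu> by (auto intro!: sum_nonneg divide_nonneg_pos)
  define D where "D m h = wsum m d h / sqrt m" for m h
  define A where "A m h = wsum m (\<lambda>x y. \<sigma>2 x / (2 * m)) h" for m h
  define Z where "Z m x h = \<mu> x * wsum m (visit x) h / m - 1" for m x h
  define C where "C = B\<^sup>2 + a"
  have mean_abs: "(\<lambda>m. measure_pmf.expectation (history K i (Suc m)) (\<lambda>h. \<bar>Z m x h\<bar>)) \<longlonglongrightarrow> 0" for x
  proof (rule Lim_null_comparison[of _ "\<lambda>m. sqrt (measure_pmf.expectation (history K i (Suc m)) (\<lambda>h. (Z m x h)\<^sup>2))"])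
    have "integrable (history K i (Suc m)) (\<lambda>h. (Z m x h)\<^sup>2)" for m
      unfolding Z_def by (rule visit_average_integrable)
    then show "\<forall>\<^sub>F m in sequentially. norm (measure_pmf.expectation (history K i (Suc m)) (\<lambda>h. \<bar>Z m x h\<bar>))
        \<le> sqrt (measure_pmf.expectation (history K i (Suc m)) (\<lambda>h. (Z m x h)\<^sup>2))"
      using measure_pmf.expectation_abs_le_sqrt[of "Z _ x"]
      by (intro always_eventually allI) (simp add: Bochner_Integration.integral_nonneg)
    show "(\<lambda>m. sqrt (measure_pmf.expectation (history K i (Suc m)) (\<lambda>h. (Z m x h)\<^sup>2))) \<longlonglongrightarrow> 0"
      using tendsto_real_sqrt[OF lln[of x]] by (simp add: Z_def)
  qed
  have zint: "integrable (history K i (Suc m)) (\<lambda>h. \<bar>Z m x h\<bar>)" for m x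
    unfolding Z_def
    by (rule integrable_measure_pmf_bounded[where B="\<bar>\<mu> x\<bar> * real (Suc m) / m + 1"])
      (use visit_average_bound in \<open>simp del: history.simps of_nat_Suc\<close>)
  have A_a: "A m h - a = (\<Sum>x\<in>UNIV. \<sigma>2 x / (2 * \<mu> x) * Z m x h)" if "m > 0" for m h
  proof -
    have "\<sigma>2 x / (2 * \<mu> x) * Z m x h = \<sigma>2 x / (2 * m) * wsum m (visit x) h - \<sigma>2 x / \<mu> x / 2" for x
      using \<mu>[of x] that by (simp add: Z_def field_simps)
    then show ?thesis unfolding A_def wsum_state a_def
      by (simp add: sum_subtractf sum_divide_distrib)
  qed
  have A_bound: "A m h - a \<le> C" if m: "m > 0" and h: "h \<in> set_pmf (history K i (Suc m))" for m h
  proof -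
    have "\<bar>A m h\<bar> \<le> real (Suc m) * (B\<^sup>2 / (2 * m))"
      using wsum_bound[of "\<lambda>x y. \<sigma>2 x / (2 * m)" "B\<^sup>2 / (2 * m)" m h] \<sigma>2 length_history[OF h]
      by (simp add: A_def divide_right_mono)
    also have "\<dots> \<le> (2 * real m) * (B\<^sup>2 / (2 * m))"
      using m by (intro mult_right_mono) auto
    also have "\<dots> = B\<^sup>2" using m by simp
    finally show ?thesis using a0 by (simp add: C_def)
  qed
  have C0: "0 \<le> C" using a0 by (simp add: C_def)
  have lim1: "(\<lambda>m. exp C * (\<Sum>x\<in>UNIV. \<sigma>2 x / (2 * \<mu> x) *
      measure_pmf.expectation (history K i (Suc m)) (\<lambda>h. \<bar>Z m x h\<bar>))) \<longlonglongrightarrow> 0"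
  proof -
    have "(\<lambda>m. exp C * (\<Sum>x\<in>UNIV. \<sigma>2 x / (2 * \<mu> x) *
      measure_pmf.expectation (history K i (Suc m)) (\<lambda>h. \<bar>Z m x h\<bar>))) \<longlonglongrightarrow> exp C * (\<Sum>x::'e\<in>UNIV. \<sigma>2 x / (2 * \<mu> x) * 0)"
      by (intro tendsto_mult_left tendsto_sum mean_abs)
    then show ?thesis by simp
  qed
  define \<epsilon> where "\<epsilon> m = (B ^ 3 * (1 / sqrt (real m)) + B ^ 4 * (1 / sqrt (real m))\<^sup>2 / 2) * exp (B\<^sup>2)" for m
  have lim2: "\<epsilon> \<longlonglongrightarrow> 0"
  proof -
    have s: "(\<lambda>m. 1 / sqrt (real m)) \<longlonglongrightarrow> 0"
      by (intro tendsto_divide_0[OF tendsto_const] filterlim_at_top_imp_at_infinity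
        filterlim_compose[OF sqrt_at_top filterlim_real_sequentially])
    have "\<epsilon> \<longlonglongrightarrow> (B ^ 3 * 0 + B ^ 4 * 0\<^sup>2 / 2) * exp (B\<^sup>2)"
      unfolding \<epsilon>_def by (intro tendsto_intros s) auto
    then show ?thesis by simp
  qed
  have comp: "norm (measure_pmf.expectation (history K i (Suc m)) (\<lambda>h. iexp (D m h) * exp (A m h)) - 1) \<le> \<epsilon> m"
    if m: "m > 0" "B\<^sup>2 / 2 \<le> m" for m
  proof -
    define s where "s = 1 / sqrt (real m)"
    have s: "0 \<le> s" "s\<^sup>2 = 1 / m" using m by (auto simp: s_def power_divide)
    have "norm (measure_pmf.expectation (history K i (Suc m)) (\<lambda>h. iexp (wsum m (\<lambda>x y. s * d x y) h) *
        exp (wsum m (\<lambda>x y. \<sigma>2 x / (2 * m)) h)) - 1) \<le>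
        Suc m * (s ^ 3 * B ^ 3 / 2 + s ^ 4 * B ^ 4 / 4) * exp (Suc m * (B\<^sup>2 / (2 * m)))"
    proof (rule wsum_iexp_compensated)
      show "0 \<le> \<sigma>2 x / (2 * m)" for x using \<sigma>2 by simp
      show "\<sigma>2 x / (2 * m) \<le> B\<^sup>2 / (2 * m)" for x using \<sigma>2 by (simp add: divide_right_mono)
      fix x
      have "s\<^sup>2 * B\<^sup>2 / 2 \<le> 1" using m by (simp add: s divide_simps)
      from iexp_expectation_bound[OF B centered s(1) this, of x]
      have "norm (measure_pmf.expectation (K x) (\<lambda>y. iexp (s * d x y)) * complex_of_real (exp (\<sigma>2 x / (2 * m))) - 1)
          \<le> s ^ 3 * B ^ 3 / 2 + s ^ 4 * B ^ 4 / 4"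
        by (simp add: s \<sigma>2_def mult.commute)
      then show "norm (measure_pmf.expectation (K x) (\<lambda>y. iexp (s * d x y)) * exp (complex_of_real (\<sigma>2 x / (2 * m))) - 1)
          \<le> s ^ 3 * B ^ 3 / 2 + s ^ 4 * B ^ 4 / 4"
        by (simp only: exp_of_real)
    qed
    also have "\<dots> \<le> (2 * real m) * (s ^ 3 * B ^ 3 / 2 + s ^ 4 * B ^ 4 / 4) * exp (B\<^sup>2)"
    proof -
      have "real (Suc m) * (B\<^sup>2 / (2 * m)) \<le> (2 * real m) * (B\<^sup>2 / (2 * m))"
        using m by (intro mult_right_mono) auto
      then have "real (Suc m) * (B\<^sup>2 / (2 * m)) \<le> B\<^sup>2" using m by simp
      then show ?thesis using m s B0 by (intro mult_mono) auto
    qed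
    also have "\<dots> = \<epsilon> m"
    proof -
      have "s ^ 3 = s / m" "s ^ 4 = s\<^sup>2 / m"
        using s(2) by (auto simp: power3_eq_cube power4_eq_xxxx power2_eq_square)
      then have ms: "real m * s ^ 3 = s" "real m * s ^ 4 = s\<^sup>2" using m by auto
      have "(2 * real m) * (s ^ 3 * B ^ 3 / 2 + s ^ 4 * B ^ 4 / 4) =
          (real m * s ^ 3) * B ^ 3 + (real m * s ^ 4) * B ^ 4 / 2" by (simp add: algebra_simps)
      then show ?thesis unfolding ms by (simp add: \<epsilon>_def s_def[symmetric] mult.commute)
    qed
    finally show ?thesis by (simp only: wsum_scale D_def A_def) (simp add: s_def)
  qed
  have main: "norm (measure_pmf.expectation (history K i (Suc m)) (\<lambda>h. iexp (D m h)) - of_real (exp (- a))) \<le>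
      exp C * (\<Sum>x\<in>UNIV. \<sigma>2 x / (2 * \<mu> x) * measure_pmf.expectation (history K i (Suc m)) (\<lambda>h. \<bar>Z m x h\<bar>)) + \<epsilon> m"
    if m: "m > 0" "B\<^sup>2 / 2 \<le> m" for m
  proof -
    let ?E = "measure_pmf.expectation (history K i (Suc m))"
    define r where "r h = 1 - exp (A m h - a)" for h
    have rb: "\<bar>r h\<bar> \<le> exp C * \<bar>A m h - a\<bar>" if "h \<in> set_pmf (history K i (Suc m))" for h
      using exp_diff_one_bound[OF A_bound[OF m(1) that] C0] by (simp add: r_def abs_minus_commute)
    have sumint: "integrable (history K i (Suc m)) (\<lambda>h. exp C * (\<Sum>x\<in>UNIV. \<sigma>2 x / (2 * \<mu> x) * \<bar>Z m x h\<bar>))"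
      by (intro integrable_mult_right Bochner_Integration.integrable_sum zint)
    have rb': "\<bar>r h\<bar> \<le> exp C * (\<Sum>x\<in>UNIV. \<sigma>2 x / (2 * \<mu> x) * \<bar>Z m x h\<bar>)"
      if "h \<in> set_pmf (history K i (Suc m))" for h
    proof -
      have "\<bar>A m h - a\<bar> \<le> (\<Sum>x\<in>UNIV. \<bar>\<sigma>2 x / (2 * \<mu> x) * Z m x h\<bar>)"
        unfolding A_a[OF m(1)] by (rule sum_abs)
      also have "\<dots> = (\<Sum>x\<in>UNIV. \<sigma>2 x / (2 * \<mu> x) * \<bar>Z m x h\<bar>)"
        using \<sigma>2 \<mu> by (simp add: abs_mult less_imp_le)
      finally have "exp C * \<bar>A m h - a\<bar> \<le> exp C * (\<Sum>x\<in>UNIV. \<sigma>2 x / (2 * \<mu> x) * \<bar>Z m x h\<bar>)"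
        by (intro mult_left_mono) auto
      with rb[OF that] show ?thesis by linarith
    qed
    have r1: "\<bar>r h\<bar> \<le> 1 + exp C" if "h \<in> set_pmf (history K i (Suc m))" for h
    proof -
      have "exp (A m h - a) \<le> exp C" using A_bound[OF m(1) that] by simp
      then show ?thesis unfolding r_def abs_le_iff using exp_gt_zero[of "A m h - a"] by linarith
    qed
    have i1: "integrable (history K i (Suc m)) (\<lambda>h. iexp (D m h) * complex_of_real (r h))"
      by (rule integrable_measure_pmf_bounded[where B="1 + exp C"]) (use r1 in \<open>simp add: norm_mult\<close>)
    have i0: "integrable (history K i (Suc m)) (\<lambda>h. \<bar>r h\<bar>)"
      by (rule integrable_measure_pmf_bounded[where B="1 + exp C"]) (use r1 in simp)
    have i2: "integrable (history K i (Suc m)) (\<lambda>h. iexp (D m h))"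
      by (rule integrable_measure_pmf_bounded[where B=1]) simp
    have i3: "integrable (history K i (Suc m)) (\<lambda>h. iexp (D m h) * exp (A m h))"
    proof -
      have "iexp (D m h) * exp (A m h) = complex_of_real (exp a) * (iexp (D m h) - iexp (D m h) * complex_of_real (r h))" for h
        by (simp add: r_def exp_diff field_simps exp_of_real)
      moreover have "integrable (history K i (Suc m)) (\<lambda>h. complex_of_real (exp a) * (iexp (D m h) - iexp (D m h) * complex_of_real (r h)))"
        by (intro integrable_mult_right Bochner_Integration.integrable_diff i1 i2)
      ultimately show ?thesis by simp
    qed
    have "iexp (D m h) = iexp (D m h) * complex_of_real (r h) + of_real (exp (- a)) * (iexp (D m h) * exp (A m h))" for h
      by (simp add: r_def exp_diff exp_minus field_simps exp_of_real)
    then have "?E (\<lambda>h. iexp (D m h)) = ?E (\<lambda>h. iexp (D m h) * complex_of_real (r h) + of_real (exp (- a)) * (iexp (D m h) * exp (A m h)))"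
      by simp
    also have "\<dots> = ?E (\<lambda>h. iexp (D m h) * complex_of_real (r h)) + of_real (exp (- a)) * ?E (\<lambda>h. iexp (D m h) * exp (A m h))"
      using i1 i3 by simp
    finally have "?E (\<lambda>h. iexp (D m h)) - of_real (exp (- a)) =
        ?E (\<lambda>h. iexp (D m h) * complex_of_real (r h)) + of_real (exp (- a)) * (?E (\<lambda>h. iexp (D m h) * exp (A m h)) - 1)"
      by (simp add: algebra_simps)
    then have "norm (?E (\<lambda>h. iexp (D m h)) - of_real (exp (- a))) \<le>
        norm (?E (\<lambda>h. iexp (D m h) * complex_of_real (r h))) + norm (complex_of_real (exp (- a)) * (?E (\<lambda>h. iexp (D m h) * exp (A m h)) - 1))"
      by (simp only: norm_triangle_ineq)
    also have "norm (?E (\<lambda>h. iexp (D m h) * complex_of_real (r h))) \<le> ?E (\<lambda>h. exp C * (\<Sum>x\<in>UNIV. \<sigma>2 x / (2 * \<mu> x) * \<bar>Z m x h\<bar>))"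
      by (rule order_trans[OF integral_norm_bound integral_mono_AE])
        (use i0 i1 sumint rb' in \<open>auto simp: AE_measure_pmf_iff norm_mult\<close>)
    also have "\<dots> = exp C * (\<Sum>x\<in>UNIV. \<sigma>2 x / (2 * \<mu> x) * ?E (\<lambda>h. \<bar>Z m x h\<bar>))"
      by (simp add: zint del: history.simps)
    also have "norm (complex_of_real (exp (- a)) * (?E (\<lambda>h. iexp (D m h) * exp (A m h)) - 1)) \<le> 1 * \<epsilon> m"
      unfolding norm_mult using comp[OF m] a0 by (intro mult_mono) auto
    finally show ?thesis by simp
  qed
  have "(\<lambda>m. measure_pmf.expectation (history K i (Suc m)) (\<lambda>h. iexp (D m h)) - of_real (exp (- a))) \<longlonglongrightarrow> 0"
  proof (rule Lim_null_comparison)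
    obtain N where N: "B\<^sup>2 / 2 \<le> real N" using real_arch_simple by blast
    show "\<forall>\<^sub>F m in sequentially. norm (measure_pmf.expectation (history K i (Suc m)) (\<lambda>h. iexp (D m h)) - of_real (exp (- a))) \<le>
      exp C * (\<Sum>x\<in>UNIV. \<sigma>2 x / (2 * \<mu> x) * measure_pmf.expectation (history K i (Suc m)) (\<lambda>h. \<bar>Z m x h\<bar>)) + \<epsilon> m"
      using eventually_gt_at_top[of 0] eventually_ge_at_top[of N]
      by eventually_elim (rule main; use N in linarith)
    show "(\<lambda>m. exp C * (\<Sum>x\<in>UNIV. \<sigma>2 x / (2 * \<mu> x) *
      measure_pmf.expectation (history K i (Suc m)) (\<lambda>h. \<bar>Z m x h\<bar>)) + \<epsilon> m) \<longlonglongrightarrow> 0"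
      using tendsto_add[OF lim1 lim2] by simp
  qed
  from LIM_zero_cancel[OF this] show ?thesis by (simp add: D_def a_def \<sigma>2_def)
qed

end

section \<open>Convergence in probability\<close>

definition neg_in_prob :: "(nat \<Rightarrow> 'a pmf) \<Rightarrow> (nat \<Rightarrow> 'a \<Rightarrow> real) \<Rightarrow> bool"
  where "neg_in_prob p X \<longleftrightarrow> (\<forall>\<epsilon>>0. (\<lambda>m. measure (p m) {h. \<epsilon> < \<bar>X m h\<bar>}) \<longlonglongrightarrow> 0)"

definition tight_in_prob :: "(nat \<Rightarrow> 'a pmf) \<Rightarrow> (nat \<Rightarrow> 'a \<Rightarrow> real) \<Rightarrow> bool"
  where "tight_in_prob p X \<longleftrightarrow>
    (\<forall>\<epsilon>>0. \<exists>R>0. eventually (\<lambda>m. measure (p m) {h. R < \<bar>X m h\<bar>} < \<epsilon>) sequentially)"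

lemma measure_pmf_mono: "A \<subseteq> B \<Longrightarrow> measure (measure_pmf p) A \<le> measure (measure_pmf p) B"
  by (rule measure_pmf.finite_measure_mono) auto

lemma measure_pmf_Un_le: "measure (measure_pmf p) (A \<union> B) \<le> measure (measure_pmf p) A + measure (measure_pmf p) B"
  by (rule measure_Un_le) auto

lemma neg_in_prob_dominated:
  assumes X: "neg_in_prob p X" and G: "(\<lambda>m. measure (p m) (G m)) \<longlonglongrightarrow> 0"
    and dom: "\<And>\<epsilon>. \<epsilon> > 0 \<Longrightarrow> \<exists>\<delta>>0. eventually (\<lambda>m. \<forall>h\<in>set_pmf (p m). \<epsilon> < \<bar>Y m h\<bar> \<longrightarrow> \<delta> < \<bar>X m h\<bar> \<or> h \<in> G m) sequentially"
  shows "neg_in_prob p Y"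
  unfolding neg_in_prob_def
proof (intro allI impI)
  fix \<epsilon> :: real assume "0 < \<epsilon>"
  from dom[OF this] obtain \<delta> where \<delta>: "\<delta> > 0"
    "eventually (\<lambda>m. \<forall>h\<in>set_pmf (p m). \<epsilon> < \<bar>Y m h\<bar> \<longrightarrow> \<delta> < \<bar>X m h\<bar> \<or> h \<in> G m) sequentially" by blast
  have lim: "(\<lambda>m. measure (p m) {h. \<delta> < \<bar>X m h\<bar>} + measure (p m) (G m)) \<longlonglongrightarrow> 0"
    using tendsto_add[OF X[unfolded neg_in_prob_def, rule_format, OF \<delta>(1)] G] by simp
  show "(\<lambda>m. measure (p m) {h. \<epsilon> < \<bar>Y m h\<bar>}) \<longlonglongrightarrow> 0"
  proof (rule Lim_null_comparison[OF _ lim])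
    show "\<forall>\<^sub>F m in sequentially. norm (measure (p m) {h. \<epsilon> < \<bar>Y m h\<bar>}) \<le> measure (p m) {h. \<delta> < \<bar>X m h\<bar>} + measure (p m) (G m)"
      using \<delta>(2)
    proof eventually_elim
      case (elim m)
      have "measure (p m) {h. \<epsilon> < \<bar>Y m h\<bar>} = measure (p m) ({h. \<epsilon> < \<bar>Y m h\<bar>} \<inter> set_pmf (p m))"
        by (simp add: measure_Int_set_pmf)
      also have "\<dots> \<le> measure (p m) ({h. \<delta> < \<bar>X m h\<bar>} \<union> G m)"
        using elim by (intro measure_pmf_mono) auto
      also have "\<dots> \<le> measure (p m) {h. \<delta> < \<bar>X m h\<bar>} + measure (p m) (G m)" by (rule measure_pmf_Un_le)
      finally show ?case by simp
    qed
  qed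
qed

lemma neg_in_prob_cong:
  assumes X: "neg_in_prob p X" and G: "(\<lambda>m. measure (p m) (G m)) \<longlonglongrightarrow> 0"
    and eq: "eventually (\<lambda>m. \<forall>h\<in>set_pmf (p m). h \<notin> G m \<longrightarrow> Y m h = X m h) sequentially"
  shows "neg_in_prob p Y"
proof (rule neg_in_prob_dominated[OF X G])
  fix \<epsilon> :: real assume "0 < \<epsilon>"
  then show "\<exists>\<delta>>0. \<forall>\<^sub>F m in sequentially. \<forall>h\<in>set_pmf (p m). \<epsilon> < \<bar>Y m h\<bar> \<longrightarrow> \<delta> < \<bar>X m h\<bar> \<or> h \<in> G m"
    by (intro exI[of _ \<epsilon>] conjI) (use eq in \<open>auto elim!: eventually_mono\<close>)
qed

lemma neg_in_prob_tendsto: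
  assumes "b \<longlonglongrightarrow> 0" "\<And>m h. h \<in> set_pmf (p m) \<Longrightarrow> \<bar>X m h\<bar> \<le> b m"
  shows "neg_in_prob p X"
proof (rule neg_in_prob_dominated[where X="\<lambda>_ _. 0" and G="\<lambda>_. {}"])
  fix \<epsilon> :: real assume "0 < \<epsilon>"
  with assms(1) have "eventually (\<lambda>m. b m < \<epsilon>) sequentially" by (rule order_tendstoD)
  then have "\<forall>\<^sub>F m in sequentially. \<forall>h\<in>set_pmf (p m). \<not> \<epsilon> < \<bar>X m h\<bar>"
    by eventually_elim (use assms(2) in force)
  then show "\<exists>\<delta>>0. \<forall>\<^sub>F m in sequentially. \<forall>h\<in>set_pmf (p m). \<epsilon> < \<bar>X m h\<bar> \<longrightarrow> \<delta> < \<bar>0::real\<bar> \<or> h \<in> {}"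
    by (intro exI[of _ 1]) (auto elim!: eventually_mono)
qed (simp_all add: neg_in_prob_def)

lemma neg_in_prob_add:
  assumes "neg_in_prob p X" "neg_in_prob p Y"
  shows "neg_in_prob p (\<lambda>m h. X m h + Y m h)"
  unfolding neg_in_prob_def
proof (intro allI impI)
  fix \<epsilon> :: real assume "0 < \<epsilon>"
  have lim: "(\<lambda>m. measure (p m) {h. \<epsilon> / 2 < \<bar>X m h\<bar>} + measure (p m) {h. \<epsilon> / 2 < \<bar>Y m h\<bar>}) \<longlonglongrightarrow> 0"
    using tendsto_add[OF assms(1)[unfolded neg_in_prob_def, rule_format, of "\<epsilon> / 2"]
      assms(2)[unfolded neg_in_prob_def, rule_format, of "\<epsilon> / 2"]] \<open>0 < \<epsilon>\<close> by simp
  show "(\<lambda>m. measure (p m) {h. \<epsilon> < \<bar>X m h + Y m h\<bar>}) \<longlonglongrightarrow> 0"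
  proof (rule Lim_null_comparison[OF always_eventually lim], rule allI)
    fix m
    have "measure (p m) {h. \<epsilon> < \<bar>X m h + Y m h\<bar>} \<le> measure (p m) ({h. \<epsilon> / 2 < \<bar>X m h\<bar>} \<union> {h. \<epsilon> / 2 < \<bar>Y m h\<bar>})"
      by (rule measure_pmf_mono) auto
    also have "\<dots> \<le> measure (p m) {h. \<epsilon> / 2 < \<bar>X m h\<bar>} + measure (p m) {h. \<epsilon> / 2 < \<bar>Y m h\<bar>}" by (rule measure_pmf_Un_le)
    finally show "norm (measure (p m) {h. \<epsilon> < \<bar>X m h + Y m h\<bar>}) \<le>
      measure (p m) {h. \<epsilon> / 2 < \<bar>X m h\<bar>} + measure (p m) {h. \<epsilon> / 2 < \<bar>Y m h\<bar>}" by simp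
  qed
qed

lemma tight_in_prob_add:
  assumes "tight_in_prob p X" "tight_in_prob p Y"
  shows "tight_in_prob p (\<lambda>m h. X m h + Y m h)"
  unfolding tight_in_prob_def
proof (intro allI impI)
  fix \<epsilon> :: real assume "0 < \<epsilon>"
  then obtain R S where R: "R > 0" "eventually (\<lambda>m. measure (p m) {h. R < \<bar>X m h\<bar>} < \<epsilon> / 2) sequentially"
    and S: "S > 0" "eventually (\<lambda>m. measure (p m) {h. S < \<bar>Y m h\<bar>} < \<epsilon> / 2) sequentially"
    using assms unfolding tight_in_prob_def by (meson half_gt_zero)
  have "eventually (\<lambda>m. measure (p m) {h. R + S < \<bar>X m h + Y m h\<bar>} < \<epsilon>) sequentially"
    using R(2) S(2)
  proof eventually_elim
    case (elim m)
    have "measure (p m) {h. R + S < \<bar>X m h + Y m h\<bar>} \<le> measure (p m) ({h. R < \<bar>X m h\<bar>} \<union> {h. S < \<bar>Y m h\<bar>})"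
      by (rule measure_pmf_mono) auto
    also have "\<dots> \<le> measure (p m) {h. R < \<bar>X m h\<bar>} + measure (p m) {h. S < \<bar>Y m h\<bar>}" by (rule measure_pmf_Un_le)
    finally show ?case using elim by linarith
  qed
  then show "\<exists>R>0. eventually (\<lambda>m. measure (p m) {h. R < \<bar>X m h + Y m h\<bar>} < \<epsilon>) sequentially"
    using R(1) S(1) by (intro exI[of _ "R + S"]) auto
qed

lemma tight_in_prob_mult:
  assumes "tight_in_prob p X" "tight_in_prob p Y"
  shows "tight_in_prob p (\<lambda>m h. X m h * Y m h)"
  unfolding tight_in_prob_def
proof (intro allI impI)
  fix \<epsilon> :: real assume "0 < \<epsilon>"
  then obtain R S where R: "R > 0" "eventually (\<lambda>m. measure (p m) {h. R < \<bar>X m h\<bar>} < \<epsilon> / 2) sequentially"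
    and S: "S > 0" "eventually (\<lambda>m. measure (p m) {h. S < \<bar>Y m h\<bar>} < \<epsilon> / 2) sequentially"
    using assms unfolding tight_in_prob_def by (meson half_gt_zero)
  have "eventually (\<lambda>m. measure (p m) {h. R * S < \<bar>X m h * Y m h\<bar>} < \<epsilon>) sequentially"
    using R(2) S(2)
  proof eventually_elim
    case (elim m)
    have "\<bar>X m h * Y m h\<bar> \<le> R * S" if "\<bar>X m h\<bar> \<le> R" "\<bar>Y m h\<bar> \<le> S" for h
      using that R(1) unfolding abs_mult by (intro mult_mono) auto
    then have "measure (p m) {h. R * S < \<bar>X m h * Y m h\<bar>} \<le> measure (p m) ({h. R < \<bar>X m h\<bar>} \<union> {h. S < \<bar>Y m h\<bar>})"
      by (intro measure_pmf_mono) (auto simp: not_le[symmetric])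
    also have "\<dots> \<le> measure (p m) {h. R < \<bar>X m h\<bar>} + measure (p m) {h. S < \<bar>Y m h\<bar>}" by (rule measure_pmf_Un_le)
    finally show ?case using elim by linarith
  qed
  then show "\<exists>R>0. eventually (\<lambda>m. measure (p m) {h. R < \<bar>X m h * Y m h\<bar>} < \<epsilon>) sequentially"
    using R(1) S(1) by (intro exI[of _ "R * S"]) auto
qed

lemma neg_in_prob_mult:
  assumes "neg_in_prob p X" "tight_in_prob p Y"
  shows "neg_in_prob p (\<lambda>m h. X m h * Y m h)"
  unfolding neg_in_prob_def
proof (intro allI impI)
  fix \<epsilon> :: real assume "0 < \<epsilon>"
  show "(\<lambda>m. measure (p m) {h. \<epsilon> < \<bar>X m h * Y m h\<bar>}) \<longlonglongrightarrow> 0"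
  proof (rule order_tendstoI)
    fix \<eta> :: real assume "0 < \<eta>"
    then obtain R where R: "R > 0" "eventually (\<lambda>m. measure (p m) {h. R < \<bar>Y m h\<bar>} < \<eta> / 2) sequentially"
      using assms(2) unfolding tight_in_prob_def by (meson half_gt_zero)
    have "(\<lambda>m. measure (p m) {h. \<epsilon> / R < \<bar>X m h\<bar>}) \<longlonglongrightarrow> 0"
      using assms(1) R(1) \<open>0 < \<epsilon>\<close> by (simp add: neg_in_prob_def)
    then have "eventually (\<lambda>m. measure (p m) {h. \<epsilon> / R < \<bar>X m h\<bar>} < \<eta> / 2) sequentially"
      by (rule order_tendstoD) (use \<open>0 < \<eta>\<close> in auto)
    with R(2) show "eventually (\<lambda>m. measure (p m) {h. \<epsilon> < \<bar>X m h * Y m h\<bar>} < \<eta>) sequentially"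
    proof eventually_elim
      case (elim m)
      have "\<bar>X m h * Y m h\<bar> \<le> \<epsilon>" if "\<bar>X m h\<bar> \<le> \<epsilon> / R" "\<bar>Y m h\<bar> \<le> R" for h
      proof -
        have "\<bar>X m h\<bar> * \<bar>Y m h\<bar> \<le> \<epsilon> / R * R" using that \<open>0 < \<epsilon>\<close> R(1) by (intro mult_mono) auto
        then show ?thesis using R(1) by (simp add: abs_mult)
      qed
      then have "measure (p m) {h. \<epsilon> < \<bar>X m h * Y m h\<bar>} \<le> measure (p m) ({h. \<epsilon> / R < \<bar>X m h\<bar>} \<union> {h. R < \<bar>Y m h\<bar>})"
        by (intro measure_pmf_mono) (auto simp: not_le[symmetric])
      also have "\<dots> \<le> measure (p m) {h. \<epsilon> / R < \<bar>X m h\<bar>} + measure (p m) {h. R < \<bar>Y m h\<bar>}" by (rule measure_pmf_Un_le)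
      finally show ?case using elim by linarith
    qed
  qed (auto intro!: always_eventually less_le_trans[OF _ measure_nonneg])
qed

lemma neg_imp_tight:
  assumes "neg_in_prob p X"
  shows "tight_in_prob p X"
  unfolding tight_in_prob_def
proof (intro allI impI)
  fix \<epsilon> :: real assume "0 < \<epsilon>"
  have "(\<lambda>m. measure (p m) {h. 1 < \<bar>X m h\<bar>}) \<longlonglongrightarrow> 0"
    using assms by (simp add: neg_in_prob_def)
  from order_tendstoD(2)[OF this \<open>0 < \<epsilon>\<close>]
  show "\<exists>R>0. eventually (\<lambda>m. measure (p m) {h. R < \<bar>X m h\<bar>} < \<epsilon>) sequentially"
    by (intro exI[of _ 1]) auto
qed

lemma tight_in_prob_bounded:
  assumes "eventually (\<lambda>m. \<forall>h\<in>set_pmf (p m). \<bar>X m h\<bar> \<le> B) sequentially"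
  shows "tight_in_prob p X"
  unfolding tight_in_prob_def
proof (intro allI impI)
  fix \<epsilon> :: real assume "0 < \<epsilon>"
  have "eventually (\<lambda>m. measure (p m) {h. \<bar>B\<bar> + 1 < \<bar>X m h\<bar>} < \<epsilon>) sequentially"
    using assms
  proof eventually_elim
    case (elim m)
    have "measure (p m) {h. \<bar>B\<bar> + 1 < \<bar>X m h\<bar>} = measure (p m) ({h. \<bar>B\<bar> + 1 < \<bar>X m h\<bar>} \<inter> set_pmf (p m))"
      by (simp add: measure_Int_set_pmf)
    also have "{h. \<bar>B\<bar> + 1 < \<bar>X m h\<bar>} \<inter> set_pmf (p m) = {}" using elim by force
    finally show ?case using \<open>0 < \<epsilon>\<close> by simp
  qed
  then show "\<exists>R>0. eventually (\<lambda>m. measure (p m) {h. R < \<bar>X m h\<bar>} < \<epsilon>) sequentially"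
    by (intro exI[of _ "\<bar>B\<bar> + 1"]) auto
qed

lemma tight_in_prob_const: "tight_in_prob p (\<lambda>m h. c)"
  by (rule tight_in_prob_bounded[where B="\<bar>c\<bar>"]) simp

lemma tight_in_prob_cong:
  assumes "tight_in_prob p X" and G: "(\<lambda>m. measure (p m) (G m)) \<longlonglongrightarrow> 0"
    and eq: "eventually (\<lambda>m. \<forall>h\<in>set_pmf (p m). h \<notin> G m \<longrightarrow> Y m h = X m h) sequentially"
  shows "tight_in_prob p Y"
proof -
  have "neg_in_prob p (\<lambda>m h. Y m h - X m h)"
  proof (rule neg_in_prob_cong[where X="\<lambda>_ _. 0", OF _ G])
    show "\<forall>\<^sub>F m in sequentially. \<forall>h\<in>set_pmf (p m). h \<notin> G m \<longrightarrow> Y m h - X m h = 0"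
      using eq by eventually_elim auto
  qed (simp add: neg_in_prob_def)
  from tight_in_prob_add[OF assms(1) neg_imp_tight[OF this]] show ?thesis by simp
qed

lemma neg_in_prob_zero: "neg_in_prob p (\<lambda>m h. 0)"
  by (simp add: neg_in_prob_def)

lemma neg_in_prob_sum: "(\<And>i. i \<in> I \<Longrightarrow> neg_in_prob p (X i)) \<Longrightarrow> neg_in_prob p (\<lambda>m h. \<Sum>i\<in>I. X i m h)"
  by (induction I rule: infinite_finite_induct) (auto simp: neg_in_prob_zero intro: neg_in_prob_add)

lemma tight_in_prob_sum: "(\<And>i. i \<in> I \<Longrightarrow> tight_in_prob p (X i)) \<Longrightarrow> tight_in_prob p (\<lambda>m h. \<Sum>i\<in>I. X i m h)"
  by (induction I rule: infinite_finite_induct) (auto simp: tight_in_prob_const intro: tight_in_prob_add)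

lemma neg_in_prob_scale: "neg_in_prob p X \<Longrightarrow> neg_in_prob p (\<lambda>m h. c * X m h)"
  using neg_in_prob_mult[of p X "\<lambda>_ _. c"] tight_in_prob_const[of p c] by (simp add: mult.commute)

lemma pmf_chebyshev:
  assumes "integrable (measure_pmf p) (\<lambda>h. (f h)\<^sup>2)" "0 < \<epsilon>"
  shows "measure (measure_pmf p) {h. \<epsilon> < \<bar>f h\<bar>} \<le> measure_pmf.expectation p (\<lambda>h. (f h)\<^sup>2) / \<epsilon>\<^sup>2"
proof -
  have "measure (measure_pmf p) {h. \<epsilon> < \<bar>f h\<bar>} \<le> measure (measure_pmf p) {h\<in>space (measure_pmf p). \<epsilon>\<^sup>2 \<le> (f h)\<^sup>2}"
    using \<open>0 < \<epsilon>\<close> by (intro measure_pmf_mono) (auto simp: abs_le_square_iff[symmetric])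
  also have "\<dots> \<le> measure_pmf.expectation p (\<lambda>h. (f h)\<^sup>2) / \<epsilon>\<^sup>2"
    by (rule integral_Markov_inequality_measure[where A="{}"]) (use assms in auto)
  finally show ?thesis .
qed

lemma neg_in_prob_second_moment:
  assumes "\<And>m. integrable (measure_pmf (p m)) (\<lambda>h. (X m h)\<^sup>2)" "(\<lambda>m. measure_pmf.expectation (p m) (\<lambda>h. (X m h)\<^sup>2)) \<longlonglongrightarrow> 0"
  shows "neg_in_prob p X"
  unfolding neg_in_prob_def
proof (intro allI impI)
  fix \<epsilon> :: real assume "0 < \<epsilon>"
  have "(\<lambda>m. measure_pmf.expectation (p m) (\<lambda>h. (X m h)\<^sup>2) / \<epsilon>\<^sup>2) \<longlonglongrightarrow> 0"
    using tendsto_divide[OF assms(2) tendsto_const, of "\<epsilon>\<^sup>2"] \<open>0 < \<epsilon>\<close> by simp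
  then show "(\<lambda>m. measure (p m) {h. \<epsilon> < \<bar>X m h\<bar>}) \<longlonglongrightarrow> 0"
    by (rule Lim_null_comparison[rotated]) (use pmf_chebyshev[OF assms(1) \<open>0 < \<epsilon>\<close>] in auto)
qed

lemma tight_in_prob_second_moment:
  assumes "\<And>m. integrable (measure_pmf (p m)) (\<lambda>h. (X m h)\<^sup>2)"
    "eventually (\<lambda>m. measure_pmf.expectation (p m) (\<lambda>h. (X m h)\<^sup>2) \<le> c) sequentially"
  shows "tight_in_prob p X"
  unfolding tight_in_prob_def
proof (intro allI impI)
  fix \<epsilon> :: real assume "0 < \<epsilon>"
  define R where "R = sqrt ((\<bar>c\<bar> + 1) / \<epsilon>)"
  have R: "R > 0" "R\<^sup>2 = (\<bar>c\<bar> + 1) / \<epsilon>" using \<open>0 < \<epsilon>\<close> by (auto simp: R_def)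
  have "eventually (\<lambda>m. measure (p m) {h. R < \<bar>X m h\<bar>} < \<epsilon>) sequentially"
    using assms(2)
  proof eventually_elim
    case (elim m)
    have "measure (p m) {h. R < \<bar>X m h\<bar>} \<le> measure_pmf.expectation (p m) (\<lambda>h. (X m h)\<^sup>2) / R\<^sup>2"
      by (rule pmf_chebyshev[OF assms(1) R(1)])
    also have "\<dots> < (\<bar>c\<bar> + 1) / R\<^sup>2" using elim R(1) by (intro divide_strict_right_mono) auto
    also have "\<dots> = \<epsilon>" unfolding R(2) using \<open>0 < \<epsilon>\<close> by (simp add: field_simps)
    finally show ?case .
  qed
  then show "\<exists>R>0. eventually (\<lambda>m. measure (p m) {h. R < \<bar>X m h\<bar>} < \<epsilon>) sequentially"
    using R(1) by blast
qed

lemma slutsky_iexp: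
  assumes "(\<lambda>m. measure_pmf.expectation (p m) (\<lambda>h. iexp (X m h))) \<longlonglongrightarrow> c"
    and "neg_in_prob p (\<lambda>m h. Y m h - X m h)"
  shows "(\<lambda>m. measure_pmf.expectation (p m) (\<lambda>h. iexp (Y m h))) \<longlonglongrightarrow> c"
proof -
  have int: "integrable (p m) (\<lambda>h. iexp (Z h))" for Z :: "'a \<Rightarrow> real" and m
    by (rule integrable_measure_pmf_bounded[where B=1]) simp
  have "(\<lambda>m. measure_pmf.expectation (p m) (\<lambda>h. iexp (Y m h)) - measure_pmf.expectation (p m) (\<lambda>h. iexp (X m h))) \<longlonglongrightarrow> 0"
  proof (rule tendstoI)
    fix \<epsilon> :: real assume "0 < \<epsilon>"
    then have "(\<lambda>m. measure (p m) {h. \<epsilon> / 2 < \<bar>Y m h - X m h\<bar>}) \<longlonglongrightarrow> 0"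
      by (intro assms(2)[unfolded neg_in_prob_def, rule_format]) simp
    then have "eventually (\<lambda>m. measure (p m) {h. \<epsilon> / 2 < \<bar>Y m h - X m h\<bar>} < \<epsilon> / 4) sequentially"
      by (rule order_tendstoD) (use \<open>0 < \<epsilon>\<close> in auto)
    then show "\<forall>\<^sub>F m in sequentially. dist (measure_pmf.expectation (p m) (\<lambda>h. iexp (Y m h)) -
        measure_pmf.expectation (p m) (\<lambda>h. iexp (X m h))) 0 < \<epsilon>"
    proof eventually_elim
      case (elim m)
      let ?A = "{h. \<epsilon> / 2 < \<bar>Y m h - X m h\<bar>}"
      have b: "norm (iexp (Y m h) - iexp (X m h)) \<le> \<epsilon> / 2 + 2 * indicator ?A h" for h
      proof (cases "h \<in> ?A")
        case True
        then show ?thesis using norm_triangle_ineq4[of "iexp (Y m h)" "iexp (X m h)"] \<open>0 < \<epsilon>\<close> by simp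
      next
        case False
        have "iexp (Y m h) - iexp (X m h) = iexp (X m h) * (iexp (Y m h - X m h) - 1)"
          by (simp add: right_diff_distrib exp_add[symmetric] algebra_simps)
        then have "norm (iexp (Y m h) - iexp (X m h)) = norm (iexp (Y m h - X m h) - 1)"
          by (simp only: norm_mult norm_exp_i_times mult_1_left)
        also have "\<dots> \<le> \<bar>Y m h - X m h\<bar>" using iexp_approx1[of "Y m h - X m h" 0] by simp
        finally show ?thesis using False by simp
      qed
      have "norm (measure_pmf.expectation (p m) (\<lambda>h. iexp (Y m h)) - measure_pmf.expectation (p m) (\<lambda>h. iexp (X m h)))
          = norm (measure_pmf.expectation (p m) (\<lambda>h. iexp (Y m h) - iexp (X m h)))"
        by (simp add: int)
      also have "\<dots> \<le> measure_pmf.expectation (p m) (\<lambda>h. norm (iexp (Y m h) - iexp (X m h)))"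
        by (rule integral_norm_bound)
      also have "\<dots> \<le> measure_pmf.expectation (p m) (\<lambda>h. \<epsilon> / 2 + 2 * indicator ?A h)"
      proof (rule integral_mono)
        show "integrable (p m) (\<lambda>h. norm (iexp (Y m h) - iexp (X m h)))"
          by (intro integrable_norm Bochner_Integration.integrable_diff int)
        show "integrable (p m) (\<lambda>h. \<epsilon> / 2 + 2 * indicator ?A h :: real)"
          by (rule integrable_measure_pmf_bounded[where B="\<epsilon> / 2 + 2"]) (use \<open>0 < \<epsilon>\<close> in \<open>auto split: split_indicator\<close>)
      qed (rule b)
      also have "\<dots> = \<epsilon> / 2 + 2 * measure (p m) ?A"
      proof -
        have "integrable (p m) (\<lambda>h. 2 * indicator ?A h :: real)"
          by (rule integrable_measure_pmf_bounded[where B=2]) (auto split: split_indicator)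
        from Bochner_Integration.integral_add[OF measure_pmf.integrable_const this, of "\<epsilon> / 2"] show ?thesis by simp
      qed
      also have "\<dots> < \<epsilon>" using elim by linarith
      finally show ?case by simp
    qed
  qed
  from tendsto_add[OF this assms(1)] show ?thesis by simp
qed

lemma survival_add:
  assumes "tail_convergent A" "tail_convergent B"
  shows "tail_convergent (\<lambda>e. A e + B e)" "survival (\<lambda>e. A e + B e) = (\<lambda>e. survival A e + survival B e)"
  using survival_sum[of "{True, False}" "\<lambda>b. if b then A else B"] assms by simp_all

lemma semi_markov_law_deriv_add:
  assumes "tail_convergent H" "tail_convergent H'"
  shows "semi_markov_law_deriv A (\<lambda>e. H e + H' e) = (\<lambda>e. semi_markov_law_deriv A H e + semi_markov_law_deriv A H' e)"
  using semi_markov_law_deriv_sum[of "{True, False}" "\<lambda>b. if b then H else H'"] assms by simp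

definition transition_sum :: "nat \<Rightarrow> ('e \<Rightarrow> real) \<Rightarrow> 'e::finite hist \<Rightarrow> 'e mseq"
  where "transition_sum m w h = (\<lambda>e'. csum m (\<lambda>x y. w x * unit_mseq (x, y) e') h)"

lemma tail_convergent_zero: "tail_convergent (\<lambda>e. 0)"
  using survival_sum(1)[of "{}"] by simp

lemma survival_zero: "survival (\<lambda>e. 0) = (\<lambda>e. 0)"
  using survival_sum(2)[of "{}"] by simp

lemma tail_convergent_unit: "tail_convergent (unit_mseq e')"
  using survival_unit(1) by (cases e') auto

lemma transition_sum_simps:
  "transition_sum m w [] = (\<lambda>e. 0)"
  "transition_sum m w (y # h) = (\<lambda>e. transition_sum m w h e +
    (if h \<noteq> [] \<and> total (y # h) \<le> m then w (cur h) else 0) * unit_mseq (cur h, y) e)"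
  by (auto simp: transition_sum_def csum_def)

lemma tail_convergent_transition_sum: "tail_convergent (transition_sum m w h)"
  by (induction h) (simp_all only: transition_sum_simps tail_convergent_zero survival_add(1) survival_scale(1) tail_convergent_unit)

lemma survival_transition_sum:
  "survival (transition_sum m w h) e = csum m (\<lambda>x y. w x * survival (unit_mseq (x, y)) e) h"
proof (induction h)
  case (Cons y h)
  show ?case
    unfolding transition_sum_simps survival_add(2)[OF tail_convergent_transition_sum survival_scale(1)[OF tail_convergent_unit]]
      survival_scale(2)[OF tail_convergent_unit]
    using Cons by (simp add: csum_def)
qed (simp add: transition_sum_simps survival_zero)

lemma deriv_transition_sum:
  "semi_markov_law_deriv A (transition_sum m w h) e = csum m (\<lambda>x y. w x * semi_markov_law_deriv A (unit_mseq (x, y)) e) h"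
proof (induction h)
  case Nil
  show ?case using semi_markov_law_deriv_sum[of "{}" _ A] by (simp add: transition_sum_simps)
next
  case (Cons y h)
  show ?case
    unfolding transition_sum_simps semi_markov_law_deriv_add[OF tail_convergent_transition_sum survival_scale(1)[OF tail_convergent_unit]]
      semi_markov_law_deriv_scale[OF tail_convergent_unit]
    using Cons by (simp add: csum_def)
qed

lemma csum_state: "csum m (\<lambda>x y. f x) h = (\<Sum>i\<in>UNIV. f i * csum m (visit i) h)" for f :: "'e::finite \<Rightarrow> real"
proof -
  have "(\<Sum>i\<in>UNIV. f i * visit i x y) = f x" for x y
    by (simp add: visit_def if_distrib[of "\<lambda>z. _ * z"] cong: if_cong)
  then have "csum m (\<lambda>x y. f x) h = csum m (\<lambda>x y. \<Sum>i\<in>UNIV. f i * visit i x y) h" by simp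
  then show ?thesis by (simp add: csum_sum csum_scale)
qed

lemma csum_split: "csum m (\<lambda>x y. f x * d x y) h = (\<Sum>i\<in>UNIV. f i * csum m (\<lambda>x y. visit i x y * d x y) h)"
  for f :: "'e::finite \<Rightarrow> real"
proof -
  have "(\<Sum>i\<in>UNIV. f i * (visit i x y * d x y)) = f x * d x y" for x y
    by (simp add: visit_def if_distrib[of "\<lambda>z. _ * z"] if_distrib[of "\<lambda>z. z * _"] cong: if_cong)
  then have "csum m (\<lambda>x y. f x * d x y) h = csum m (\<lambda>x y. \<Sum>i\<in>UNIV. f i * (visit i x y * d x y)) h" by simp
  then show ?thesis by (simp add: csum_sum csum_scale)
qed

text \<open>Division by zero makes the rows of unvisited states vanish.\<close>

definition empirical_kernel :: "nat \<Rightarrow> 'e::finite hist \<Rightarrow> 'e mseq"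
  where "empirical_kernel m h = transition_sum m (\<lambda>x. 1 / csum m (visit x) h) h"

lemma tight_in_prob_mconv:
  assumes "\<And>e. tight_in_prob p (\<lambda>m h. A m h e)" "\<And>e. tight_in_prob p (\<lambda>m h. B m h e)"
  shows "tight_in_prob p (\<lambda>m h. (A m h \<circledast> B m h) e)"
  by (cases e) (simp only: mconv_apply, intro tight_in_prob_sum tight_in_prob_mult assms)

lemma neg_in_prob_mconv:
  assumes "\<And>e. tight_in_prob p (\<lambda>m h. A m h e)" "\<And>e. neg_in_prob p (\<lambda>m h. B m h e)"
  shows "neg_in_prob p (\<lambda>m h. (A m h \<circledast> B m h) e)"
proof (cases e)
  case (fields i j k)
  have "neg_in_prob p (\<lambda>m h. \<Sum>l\<le>k. \<Sum>u\<in>UNIV. B m h (u, j, k - l) * A m h (i, u, l))"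
    by (intro neg_in_prob_sum neg_in_prob_mult assms)
  then show ?thesis unfolding fields mconv_apply by (simp add: mult.commute)
qed

section \<open>Linearization of the estimator\<close>

lemma mconv_integral_right:
  fixes M :: "'a measure"
  assumes "\<And>e. integrable M (\<lambda>y. A y e)"
  shows "integrable M (\<lambda>y. (C \<circledast> A y) e)" "(\<integral>y. (C \<circledast> A y) e \<partial>M) = (C \<circledast> (\<lambda>e. \<integral>y. A y e \<partial>M)) e"
  by (cases e; simp add: mconv_apply assms)+

lemma mconv_integral_left:
  fixes M :: "'a measure"
  assumes "\<And>e. integrable M (\<lambda>y. A y e)"
  shows "integrable M (\<lambda>y. (A y \<circledast> C) e)" "(\<integral>y. (A y \<circledast> C) e \<partial>M) = ((\<lambda>e. \<integral>y. A y e \<partial>M) \<circledast> C) e"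
  by (cases e; simp add: mconv_apply assms)+

lemma sum_uniformly_bounded:
  fixes f :: "'i \<Rightarrow> 'a \<Rightarrow> real"
  assumes "\<And>i. i \<in> I \<Longrightarrow> \<exists>B. \<forall>y. \<bar>f i y\<bar> \<le> B"
  shows "\<exists>B. \<forall>y. \<bar>\<Sum>i\<in>I. f i y\<bar> \<le> B"
  using assms
proof (induction I rule: infinite_finite_induct)
  case (insert i I)
  then obtain B B' where "\<forall>y. \<bar>f i y\<bar> \<le> B" "\<forall>y. \<bar>\<Sum>i\<in>I. f i y\<bar> \<le> B'" by blast
  then have "\<forall>y. \<bar>\<Sum>i\<in>insert i I. f i y\<bar> \<le> B + B'"
    using insert.hyps by (auto intro: order_trans[OF abs_triangle_ineq add_mono])
  then show ?case by blast
qed (auto intro: exI[of _ 0])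

lemma scaled_uniformly_bounded:
  fixes f :: "'a \<Rightarrow> real"
  assumes "\<exists>B. \<forall>y. \<bar>f y\<bar> \<le> B"
  shows "\<exists>B. \<forall>y. \<bar>c * f y\<bar> \<le> B"
proof -
  from assms obtain B where "\<And>y. \<bar>f y\<bar> \<le> B" by blast
  then have "\<bar>c * f y\<bar> \<le> \<bar>c\<bar> * B" for y unfolding abs_mult by (rule mult_left_mono) simp
  then show ?thesis by blast
qed

lemma abs_mult_bound: "\<bar>a\<bar> \<le> B \<Longrightarrow> \<bar>b\<bar> \<le> B' \<Longrightarrow> \<bar>a * b\<bar> \<le> B * B'" for a b :: real
  unfolding abs_mult by (rule mult_mono) auto

lemma mconv_bounded_right:
  assumes "\<And>e. \<exists>B. \<forall>y. \<bar>A y e\<bar> \<le> B"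
  shows "\<exists>B. \<forall>y. \<bar>(C \<circledast> A y) e\<bar> \<le> B"
  by (cases e) (simp only: mconv_apply, intro sum_uniformly_bounded scaled_uniformly_bounded assms)

lemma mconv_bounded_left:
  assumes "\<And>e. \<exists>B. \<forall>y. \<bar>A y e\<bar> \<le> B"
  shows "\<exists>B. \<forall>y. \<bar>(A y \<circledast> C) e\<bar> \<le> B"
proof (cases e)
  case (fields i j k)
  have "\<exists>B. \<forall>y. \<bar>\<Sum>l\<le>k. \<Sum>u\<in>UNIV. C (u, j, k - l) * A y (i, u, l)\<bar> \<le> B"
    by (intro sum_uniformly_bounded scaled_uniformly_bounded assms)
  then show ?thesis unfolding fields mconv_apply by (simp add: mult.commute)
qed

lemma unit_bounded: "\<bar>unit_mseq e' e\<bar> \<le> 1"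
  by (simp add: unit_mseq_def)

lemma survival_unit_bounded: "\<bar>survival (unit_mseq e') e\<bar> \<le> 1"
  by (cases e'; cases e) (simp add: survival_unit)

lemma V_unit_bounded: "\<exists>B. \<forall>e'. \<bar>V_unit q e' e\<bar> \<le> B"
proof -
  have "\<exists>B. \<forall>e'. \<bar>(mconv_inv q \<circledast> unit_mseq e' \<circledast> semi_markov_law q) e\<bar> \<le> B"
    by (intro mconv_bounded_left mconv_bounded_right) (use unit_bounded in blast)
  moreover have "\<exists>B. \<forall>e'. \<bar>(mconv_inv q \<circledast> survival (unit_mseq e')) e\<bar> \<le> B"
    by (intro mconv_bounded_right) (use survival_unit_bounded in blast)
  ultimately obtain B B' where "\<forall>e'. \<bar>(mconv_inv q \<circledast> unit_mseq e' \<circledast> semi_markov_law q) e\<bar> \<le> B"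
    "\<forall>e'. \<bar>(mconv_inv q \<circledast> survival (unit_mseq e')) e\<bar> \<le> B'" by blast
  then have "\<forall>e'. \<bar>V_unit q e' e\<bar> \<le> B + B'"
    unfolding V_unit_deriv semi_markov_law_deriv_def by (auto intro: order_trans[OF abs_triangle_ineq add_mono])
  then show ?thesis by blast
qed

context semi_markov
begin

lemma restrict_row_integral:
  "measure_pmf.expectation (K i) (\<lambda>y. unit_mseq (i, y) e) = restrict_row q i e"
proof (cases e)
  case (fields a b k)
  have "(\<lambda>y. unit_mseq (i, y) e) = (\<lambda>y. (if a = i then 1 else 0) * indicator {(b, k)} y)"
    by (auto simp: fields unit_mseq_def indicator_def)
  then have "measure_pmf.expectation (K i) (\<lambda>y. unit_mseq (i, y) e) = (if a = i then 1 else 0) * measure (K i) {(b, k)}"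
    by simp
  then show ?thesis by (simp add: fields restrict_row_def measure_pmf_single pmf_K)
qed

lemma tail_convergent_restrict_row: "tail_convergent (restrict_row q i)"
  and survival_restrict_row: "survival (restrict_row q i) = (\<lambda>(a, b, k). if a = b \<and> a = i then measure (K i) {y. k < snd y} else 0)"
proof (rule_tac [!] survivalI[where B="\<lambda>(a, b, k). if a = b \<and> a = i then measure (K i) {y. k < snd y} else 0"])
  have eq: "tail_partial_sum (restrict_row q i) a k = (\<lambda>n. (if a = i then 1 else 0) * tail_partial_sum q a k n)" for a k
    by (auto simp: fun_eq_iff tail_partial_sum_def restrict_row_def)
  have "tail_partial_sum (restrict_row q i) a k \<longlonglongrightarrow> (if a = i then 1 else 0) * survival q (a, a, k)" for a k
    unfolding eq by (intro tendsto_mult_left survival_tendsto survival_q)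
  moreover have "(if a = i then 1 else 0) * survival q (a, a, k) = (case (a, a, k) of (a, b, k) \<Rightarrow> if a = b \<and> a = i then measure (K i) {y. k < snd y} else 0)" for a k
    by (simp add: survival_q)
  ultimately show l: "tail_partial_sum (restrict_row q i) a k \<longlonglongrightarrow>
      (case (a, a, k) of (a, b, k) \<Rightarrow> if a = b \<and> a = i then measure (K i) {y. k < snd y} else 0)" for a k
    by simp
  show "tail_partial_sum (restrict_row q i) a k \<longlonglongrightarrow>
      (case (a, a, k) of (a, b, k) \<Rightarrow> if a = b \<and> a = i then measure (K i) {y. k < snd y} else 0)" for a k by (rule l)
qed auto

lemma survival_row_integral:
  "measure_pmf.expectation (K i) (\<lambda>y. survival (unit_mseq (i, y)) e) = survival (restrict_row q i) e"
proof (cases e)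
  case (fields a b k)
  have "(\<lambda>y. survival (unit_mseq (i, y)) e) = (\<lambda>y. (if a = b \<and> a = i then 1 else 0) * indicator {y. k < snd y} y)"
    by (auto simp: fields survival_unit fun_eq_iff)
  then have "measure_pmf.expectation (K i) (\<lambda>y. survival (unit_mseq (i, y)) e) =
      (if a = b \<and> a = i then 1 else 0) * measure (K i) {y. k < snd y}"
    by simp
  then show ?thesis by (auto simp: fields survival_restrict_row)
qed

lemma V_unit_expectation:
  "measure_pmf.expectation (K i) (\<lambda>y. V_unit q (i, y) e) = V_row q i e"
proof -
  have i1: "integrable (K i) (\<lambda>y. unit_mseq (i, y) e)" for e
    by (rule integrable_measure_pmf_bounded[where B=1]) (simp add: unit_bounded)
  have i2: "integrable (K i) (\<lambda>y. survival (unit_mseq (i, y)) e)" for e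
    by (rule integrable_measure_pmf_bounded[where B=1]) (simp add: survival_unit_bounded)
  show ?thesis
    unfolding V_unit_deriv V_row_deriv semi_markov_law_deriv_def
    by (simp add: mconv_integral_right mconv_integral_left i1 i2 restrict_row_integral survival_row_integral)
qed

lemma sum_V_row: "(\<Sum>i\<in>UNIV. V_row q i e) = semi_markov_law_deriv q q e"
proof -
  have "q = (\<lambda>e. \<Sum>i\<in>UNIV. restrict_row q i e)"
    by (auto simp: fun_eq_iff restrict_row_def)
  then have "semi_markov_law_deriv q q e = semi_markov_law_deriv q (\<lambda>e. \<Sum>i\<in>UNIV. restrict_row q i e) e" by simp
  also have "\<dots> = (\<Sum>i\<in>UNIV. V_row q i e)"
    by (simp add: semi_markov_law_deriv_sum tail_convergent_restrict_row V_row_deriv)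
  finally show ?thesis ..
qed

definition influence :: "'e \<times> 'e \<times> nat \<Rightarrow> 'e \<Rightarrow> 'e \<times> nat \<Rightarrow> real"
  where "influence e x y = V_unit q (x, y) e - V_row q x e"

lemma V_row_bounded: "\<exists>B. \<forall>x. \<bar>V_row q x e\<bar> \<le> B"
  by (rule exI[of _ "\<Sum>x\<in>UNIV. \<bar>V_row q x e\<bar>"]) (auto intro: member_le_sum)

lemma influence_bounded: "\<exists>B. \<forall>x y. \<bar>influence e x y\<bar> \<le> B"
proof -
  obtain B B' where "\<forall>e'. \<bar>V_unit q e' e\<bar> \<le> B" "\<forall>x. \<bar>V_row q x e\<bar> \<le> B'"
    using V_unit_bounded V_row_bounded by metis
  then have "\<forall>x y. \<bar>influence e x y\<bar> \<le> B + B'"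
    unfolding influence_def by (auto intro: order_trans[OF abs_triangle_ineq4 add_mono])
  then show ?thesis by blast
qed

lemma integrable_V_unit: "integrable (K x) (\<lambda>y. V_unit q (x, y) e)"
  using V_unit_bounded[of q e] integrable_measure_pmf_bounded[of "K x" "\<lambda>y. V_unit q (x, y) e"] by auto

lemma integrable_V_unit_mult: "integrable (K x) (\<lambda>y. V_unit q (x, y) e * V_unit q (x, y) e')"
proof -
  obtain B B' where "\<forall>z. \<bar>V_unit q z e\<bar> \<le> B" "\<forall>z. \<bar>V_unit q z e'\<bar> \<le> B'"
    using V_unit_bounded by metis
  then have "\<bar>V_unit q z e * V_unit q z e'\<bar> \<le> B * B'" for z
    by (intro abs_mult_bound) blast+
  then show ?thesis by (intro integrable_measure_pmf_bounded[where B="B * B'"]) simp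
qed

lemma influence_centered: "measure_pmf.expectation (K x) (influence e x) = 0"
  by (simp add: influence_def[abs_def] integrable_V_unit V_unit_expectation)

lemma influence_covariance:
  "measure_pmf.expectation (K x) (\<lambda>y. influence e x y * influence e' x y) =
    measure_pmf.expectation (K x) (\<lambda>y. V_unit q (x, y) e * V_unit q (x, y) e') - V_row q x e * V_row q x e'"
proof -
  have "influence e x y * influence e' x y = V_unit q (x, y) e * V_unit q (x, y) e' -
      V_row q x e * V_unit q (x, y) e' - V_row q x e' * V_unit q (x, y) e + V_row q x e * V_row q x e'" for y
    by (simp add: influence_def algebra_simps)
  then show ?thesis
    by (simp add: integrable_V_unit integrable_V_unit_mult V_unit_expectation)
qed

lemma V_P_summable_and_eq:
  fixes \<mu> :: "'e \<Rightarrow> real"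
  shows "(\<lambda>e'. q_bar q \<mu> e' * mtensor (V_unit q e') (V_unit q e') (a, b)) summable_on UNIV"
    and "V_P q \<mu> (a, b) = (\<Sum>x\<in>UNIV. \<mu> x * measure_pmf.expectation (K x) (\<lambda>y. influence a x y * influence b x y))"
proof -
  define f where "f e' = \<mu> (fst e') * (V_unit q e' a * V_unit q e' b)" for e'
  have eq: "(\<lambda>e'. q_bar q \<mu> e' * mtensor (V_unit q e') (V_unit q e') (a, b)) = (\<lambda>e'. q e' * f e')"
    by (auto simp: fun_eq_iff q_bar_def mtensor_def f_def)
  obtain B B' where B: "\<forall>z. \<bar>V_unit q z a\<bar> \<le> B" "\<forall>z. \<bar>V_unit q z b\<bar> \<le> B'"
    using V_unit_bounded by metis
  have "\<bar>f z\<bar> \<le> (\<Sum>x\<in>UNIV. \<bar>\<mu> x\<bar>) * (B * B')" for z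
  proof -
    have "\<bar>\<mu> (fst z)\<bar> \<le> (\<Sum>x\<in>UNIV. \<bar>\<mu> x\<bar>)" by (rule member_le_sum) auto
    moreover have "\<bar>V_unit q z a * V_unit q z b\<bar> \<le> B * B'"
      using B by (intro abs_mult_bound) blast+
    ultimately show ?thesis unfolding f_def by (rule abs_mult_bound)
  qed
  from has_sum_total_expectation[of f, OF this]
  have hs: "((\<lambda>e'. q e' * f e') has_sum (\<Sum>x\<in>UNIV. \<mu> x * measure_pmf.expectation (K x) (\<lambda>y. V_unit q (x, y) a * V_unit q (x, y) b))) UNIV"
    by (simp add: f_def)
  then show "(\<lambda>e'. q_bar q \<mu> e' * mtensor (V_unit q e') (V_unit q e') (a, b)) summable_on UNIV"
    unfolding eq by (rule has_sum_imp_summable)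
  have "(\<Sum>\<^sub>\<infinity>e'\<in>UNIV. q_bar q \<mu> e' * mtensor (V_unit q e') (V_unit q e') (a, b)) =
      (\<Sum>x\<in>UNIV. \<mu> x * measure_pmf.expectation (K x) (\<lambda>y. V_unit q (x, y) a * V_unit q (x, y) b))"
    unfolding eq by (rule infsumI[OF hs])
  then show "V_P q \<mu> (a, b) = (\<Sum>x\<in>UNIV. \<mu> x * measure_pmf.expectation (K x) (\<lambda>y. influence a x y * influence b x y))"
    by (simp add: V_P_def influence_covariance mtensor_def sum_subtractf right_diff_distrib)
qed

lemma influence_quad_form:
  assumes "finite F"
  shows "quad_form (\<lambda>a b. V_P q \<mu> (a, b)) F c =
    (\<Sum>x\<in>UNIV. \<mu> x * measure_pmf.expectation (K x) (\<lambda>y. (\<Sum>a\<in>F. c a * influence a x y)\<^sup>2))"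
proof -
  have int: "integrable (K x) (\<lambda>y. influence a x y * influence b x y)" for x a b
  proof -
    obtain B B' where "\<forall>x y. \<bar>influence a x y\<bar> \<le> B" "\<forall>x y. \<bar>influence b x y\<bar> \<le> B'"
      using influence_bounded by metis
    then have "\<bar>influence a x y * influence b x y\<bar> \<le> B * B'" for y
      by (intro abs_mult_bound) blast+
    then show ?thesis by (intro integrable_measure_pmf_bounded[where B="B * B'"]) simp
  qed
  have "measure_pmf.expectation (K x) (\<lambda>y. (\<Sum>a\<in>F. c a * influence a x y)\<^sup>2) =
      (\<Sum>a\<in>F. \<Sum>b\<in>F. c a * c b * measure_pmf.expectation (K x) (\<lambda>y. influence a x y * influence b x y))" for x
  proof -
    have "(\<Sum>a\<in>F. c a * influence a x y)\<^sup>2 = (\<Sum>a\<in>F. \<Sum>b\<in>F. c a * c b * (influence a x y * influence b x y))" for y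
      by (simp add: power2_eq_square sum_product ac_simps)
    then show ?thesis by (simp add: int)
  qed
  then have "(\<Sum>x\<in>UNIV. \<mu> x * measure_pmf.expectation (K x) (\<lambda>y. (\<Sum>a\<in>F. c a * influence a x y)\<^sup>2)) =
      (\<Sum>x\<in>UNIV. \<Sum>a\<in>F. \<Sum>b\<in>F. c a * c b * (\<mu> x * measure_pmf.expectation (K x) (\<lambda>y. influence a x y * influence b x y)))"
    by (simp add: sum_distrib_left ac_simps)
  also have "\<dots> = (\<Sum>a\<in>F. \<Sum>b\<in>F. \<Sum>x\<in>UNIV. c a * c b * (\<mu> x * measure_pmf.expectation (K x) (\<lambda>y. influence a x y * influence b x y)))"
    by (subst sum.swap) (intro sum.cong refl sum.swap)
  also have "\<dots> = quad_form (\<lambda>a b. V_P q \<mu> (a, b)) F c"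
    unfolding quad_form_def V_P_summable_and_eq(2) by (simp add: sum_distrib_left)
  finally show ?thesis ..
qed

lemma psd_V_P:
  assumes "\<And>x. 0 \<le> \<mu> x"
  shows "psd (\<lambda>a b. V_P q \<mu> (a, b))"
  unfolding psd_def
  by (auto simp: influence_quad_form intro!: sum_nonneg mult_nonneg_nonneg assms Bochner_Integration.integral_nonneg)
    (simp add: V_P_summable_and_eq(2) mult.commute)

end

lemma csum_vanishes:
  assumes "\<And>x y. 0 < snd y \<Longrightarrow> d x y = 0" "\<And>x y. y \<in> set_pmf (K x) \<Longrightarrow> 0 < snd y"
    "h \<in> set_pmf (history K i n)"
  shows "csum m d h = 0"
  using assms(3)
proof (induction n arbitrary: h)
  case (Suc n)
  then obtain y h' where "h = y # h'" "h' \<in> set_pmf (history K i n)" "y \<in> set_pmf (K (cur h'))" by auto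
  with Suc.IH[of h'] show ?case using assms(1,2) by (simp add: csum_def)
qed simp

locale semi_markov_lln = semi_markov q for q :: "'e::finite mseq" +
  fixes \<mu> :: "'e \<Rightarrow> real" and i\<^sub>0 :: 'e
  assumes \<mu>_pos: "0 < \<mu> x"
    and lln: "(\<lambda>m. measure_pmf.expectation (history (jump_pmf q) i\<^sub>0 (Suc m)) (\<lambda>h. (\<mu> x * wsum m (visit x) h / real m - 1)\<^sup>2)) \<longlonglongrightarrow> 0"
begin

abbreviation p :: "nat \<Rightarrow> 'e hist pmf" where "p m \<equiv> history K i\<^sub>0 (Suc m)"

abbreviation unvisited :: "nat \<Rightarrow> 'e hist set"
  where "unvisited m \<equiv> {h. \<exists>x. csum m (visit x) h \<le> 0}"

lemma one_over_sqrt_tendsto: "(\<lambda>m. c / sqrt (real m)) \<longlonglongrightarrow> 0"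
  by (intro tendsto_divide_0[OF tendsto_const] filterlim_at_top_imp_at_infinity
    filterlim_compose[OF sqrt_at_top filterlim_real_sequentially])

lemma visit_ratio: "neg_in_prob p (\<lambda>m h. \<mu> x * csum m (visit x) h / real m - 1)"
proof -
  have 1: "neg_in_prob p (\<lambda>m h. \<mu> x * wsum m (visit x) h / real m - 1)"
    by (rule neg_in_prob_second_moment[OF visit_average_integrable lln])
  have 2: "neg_in_prob p (\<lambda>m h. \<mu> x * (csum m (visit x) h - wsum m (visit x) h) / real m)"
  proof (rule neg_in_prob_tendsto[where b="\<lambda>m. \<mu> x / real m"])
    fix m h
    have "\<bar>wsum m (visit x) h - csum m (visit x) h\<bar> \<le> 1" by (rule wsum_csum_diff) (rule abs_visit_le)
    then have "\<mu> x * \<bar>csum m (visit x) h - wsum m (visit x) h\<bar> / real m \<le> \<mu> x * 1 / real m"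
      using \<mu>_pos[of x] by (intro divide_right_mono mult_left_mono) auto
    then show "\<bar>\<mu> x * (csum m (visit x) h - wsum m (visit x) h) / real m\<bar> \<le> \<mu> x / real m"
      using \<mu>_pos[of x] by (simp add: abs_mult)
  qed (rule lim_const_over_n)
  have eq: "\<mu> x * csum m (visit x) h / real m - 1 =
      (\<mu> x * wsum m (visit x) h / real m - 1) + \<mu> x * (csum m (visit x) h - wsum m (visit x) h) / real m" for m h
    by (simp add: algebra_simps add_divide_distrib[symmetric] diff_divide_distrib[symmetric])
  show ?thesis unfolding eq by (rule neg_in_prob_add[OF 1 2])
qed

lemma unvisited_negligible: "(\<lambda>m. measure (p m) (unvisited m)) \<longlonglongrightarrow> 0"
proof -
  have lim: "(\<lambda>m. \<Sum>x\<in>UNIV. measure (p m) {h. 1 / 2 < \<bar>\<mu> x * csum m (visit x) h / real m - 1\<bar>}) \<longlonglongrightarrow> (\<Sum>x::'e\<in>UNIV. 0)"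
    by (intro tendsto_sum visit_ratio[unfolded neg_in_prob_def, rule_format]) simp
  show ?thesis
  proof (rule Lim_null_comparison[OF always_eventually])
    show "\<forall>m. norm (measure (p m) (unvisited m)) \<le> (\<Sum>x\<in>UNIV. measure (p m) {h. 1 / 2 < \<bar>\<mu> x * csum m (visit x) h / real m - 1\<bar>})"
    proof
      fix m
      have sub: "{h. csum m (visit x) h \<le> 0} \<subseteq> {h. 1 / 2 < \<bar>\<mu> x * csum m (visit x) h / real m - 1\<bar>}" for x
      proof
        fix h assume "h \<in> {h. csum m (visit x) h \<le> 0}"
        then have "\<mu> x * csum m (visit x) h / real m \<le> 0"
          using \<mu>_pos[of x] by (auto intro!: divide_nonpos_nonneg mult_nonneg_nonpos)
        then show "h \<in> {h. 1 / 2 < \<bar>\<mu> x * csum m (visit x) h / real m - 1\<bar>}"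
          unfolding mem_Collect_eq by linarith
      qed
      have "unvisited m \<subseteq> (\<Union>x\<in>UNIV. {h. 1 / 2 < \<bar>\<mu> x * csum m (visit x) h / real m - 1\<bar>})"
        using sub by fast
      then have "measure (p m) (unvisited m) \<le> measure (p m) (\<Union>x\<in>UNIV. {h. 1 / 2 < \<bar>\<mu> x * csum m (visit x) h / real m - 1\<bar>})"
        by (rule measure_pmf_mono)
      also have "\<dots> \<le> (\<Sum>x\<in>UNIV. measure (p m) {h. 1 / 2 < \<bar>\<mu> x * csum m (visit x) h / real m - 1\<bar>})"
        by (rule measure_pmf.finite_measure_subadditive_finite) auto
      finally show "norm (measure (p m) (unvisited m)) \<le> (\<Sum>x\<in>UNIV. measure (p m) {h. 1 / 2 < \<bar>\<mu> x * csum m (visit x) h / real m - 1\<bar>})" by simp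
    qed
  qed (use lim in simp)
qed

lemma inverse_visit_ratio: "neg_in_prob p (\<lambda>m h. real m / csum m (visit x) h - \<mu> x)"
proof (rule neg_in_prob_dominated[where G="\<lambda>_. {}", OF visit_ratio[of x]])
  fix \<epsilon> :: real assume "0 < \<epsilon>"
  define \<eta> where "\<eta> = min (1 / 2) (\<epsilon> / (2 * \<mu> x))"
  have \<eta>: "0 < \<eta>" "\<eta> \<le> 1 / 2" "2 * \<mu> x * \<eta> \<le> \<epsilon>"
  proof -
    have "\<eta> \<le> \<epsilon> / (2 * \<mu> x)" by (simp add: \<eta>_def)
    then show "2 * \<mu> x * \<eta> \<le> \<epsilon>" using \<mu>_pos[of x] by (simp add: field_simps)
  qed (use \<open>0 < \<epsilon>\<close> \<mu>_pos[of x] in \<open>auto simp: \<eta>_def\<close>)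
  have "\<bar>real m / csum m (visit x) h - \<mu> x\<bar> \<le> \<epsilon>" if m: "m > 0" and r: "\<bar>\<mu> x * csum m (visit x) h / real m - 1\<bar> \<le> \<eta>" for m h
  proof -
    define u where "u = \<mu> x * csum m (visit x) h / real m"
    have u: "1 / 2 \<le> u" "\<bar>u - 1\<bar> \<le> \<eta>" using r \<eta>(2) unfolding u_def[symmetric] by linarith+
    then have "csum m (visit x) h \<noteq> 0" unfolding u_def by (intro notI) simp
    then have "real m / csum m (visit x) h - \<mu> x = \<mu> x * (1 - u) / u"
      using \<mu>_pos[of x] m by (simp add: u_def field_simps)
    also have "\<bar>\<dots>\<bar> = \<mu> x * \<bar>u - 1\<bar> / u"
      using u(1) \<mu>_pos[of x] by (simp add: abs_mult abs_minus_commute)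
    also have "\<dots> \<le> \<mu> x * \<eta> / (1 / 2)"
      using u \<mu>_pos[of x] \<eta> by (intro frac_le mult_left_mono) auto
    finally show ?thesis using \<eta>(3) by simp
  qed
  then have "\<forall>h\<in>set_pmf (p m). \<epsilon> < \<bar>real m / csum m (visit x) h - \<mu> x\<bar> \<longrightarrow>
      \<eta> < \<bar>\<mu> x * csum m (visit x) h / real m - 1\<bar> \<or> h \<in> {}" if "m > 0" for m
    using that by (meson not_le)
  then have "\<forall>\<^sub>F m in sequentially. \<forall>h\<in>set_pmf (p m). \<epsilon> < \<bar>real m / csum m (visit x) h - \<mu> x\<bar> \<longrightarrow>
      \<eta> < \<bar>\<mu> x * csum m (visit x) h / real m - 1\<bar> \<or> h \<in> {}"
    using eventually_gt_at_top[of 0] by (rule eventually_mono[rotated])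
  with \<eta>(1) show "\<exists>\<delta>>0. \<forall>\<^sub>F m in sequentially. \<forall>h\<in>set_pmf (p m). \<epsilon> < \<bar>real m / csum m (visit x) h - \<mu> x\<bar> \<longrightarrow>
      \<delta> < \<bar>\<mu> x * csum m (visit x) h / real m - 1\<bar> \<or> h \<in> {}" by blast
qed simp

lemma csum_tight:
  fixes d :: "'e \<Rightarrow> 'e \<times> nat \<Rightarrow> real"
  assumes B: "\<And>x y. \<bar>d x y\<bar> \<le> B" and centered: "\<And>x. measure_pmf.expectation (K x) (d x) = 0"
  shows "tight_in_prob p (\<lambda>m h. csum m d h / sqrt (real m))"
proof -
  have sq: "(d x y)\<^sup>2 \<le> B\<^sup>2" for x y using abs_mult_bound[OF B[of x y] B[of x y]] by (simp add: power2_eq_square)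
  have v: "measure_pmf.expectation (K x) (\<lambda>y. (d x y)\<^sup>2) \<le> B\<^sup>2" for x
    using expectation_bounded_pmf[of "K x" "\<lambda>y. (d x y)\<^sup>2" "B\<^sup>2"] sq by simp
  have 1: "tight_in_prob p (\<lambda>m h. wsum m d h / sqrt (real m))"
  proof (rule tight_in_prob_second_moment[where c="2 * B\<^sup>2"])
    fix m
    show "integrable (p m) (\<lambda>h. (wsum m d h / sqrt (real m))\<^sup>2)"
    proof (rule integrable_measure_pmf_bounded[where B="(real (Suc m) * B)\<^sup>2 / real m"])
      fix h assume h: "h \<in> set_pmf (p m)"
      have "\<bar>wsum m d h\<bar> \<le> \<bar>real (Suc m) * B\<bar>" using wsum_bound[of d B m h] B length_history[OF h] by simp
      then have "(wsum m d h)\<^sup>2 \<le> (real (Suc m) * B)\<^sup>2" by (simp only: abs_le_square_iff)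
      then show "norm ((wsum m d h / sqrt (real m))\<^sup>2) \<le> (real (Suc m) * B)\<^sup>2 / real m"
        by (simp add: power_divide divide_right_mono)
    qed
  next
    show "\<forall>\<^sub>F m in sequentially. measure_pmf.expectation (p m) (\<lambda>h. (wsum m d h / sqrt (real m))\<^sup>2) \<le> 2 * B\<^sup>2"
      using eventually_gt_at_top[of 0]
    proof eventually_elim
      case (elim m)
      have "measure_pmf.expectation (p m) (\<lambda>h. (wsum m d h / sqrt (real m))\<^sup>2) =
          measure_pmf.expectation (p m) (\<lambda>h. (wsum m d h)\<^sup>2) / real m"
        by (simp add: power_divide del: history.simps)
      also have "\<dots> \<le> real (Suc m) * B\<^sup>2 / real m"
        by (intro divide_right_mono wsum_second_moment[OF B centered v]) simp
      also have "\<dots> \<le> (2 * real m) * B\<^sup>2 / real m" using elim by (intro divide_right_mono mult_right_mono) auto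
      finally show ?case using elim by simp
    qed
  qed
  have 2: "neg_in_prob p (\<lambda>m h. (csum m d h - wsum m d h) / sqrt (real m))"
  proof (rule neg_in_prob_tendsto[where b="\<lambda>m. B / sqrt (real m)"])
    fix m h
    show "\<bar>(csum m d h - wsum m d h) / sqrt (real m)\<bar> \<le> B / sqrt (real m)"
      using wsum_csum_diff[of d B m h] B by (simp add: abs_minus_commute divide_right_mono)
  qed (rule one_over_sqrt_tendsto)
  from tight_in_prob_add[OF 1 neg_imp_tight[OF 2]] show ?thesis
    by (simp add: add_divide_distrib[symmetric])
qed

lemma state_csum_tight:
  fixes d :: "'e \<Rightarrow> 'e \<times> nat \<Rightarrow> real"
  assumes B: "\<And>x y. \<bar>d x y\<bar> \<le> B" and centered: "\<And>x. measure_pmf.expectation (K x) (d x) = 0"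
  shows "tight_in_prob p (\<lambda>m h. csum m (\<lambda>x y. visit i x y * d x y) h / sqrt (real m))"
proof -
  have "\<bar>visit i x y * d x y\<bar> \<le> 1 * B" for x y
    by (rule abs_mult_bound[OF abs_visit_le B])
  moreover have "measure_pmf.expectation (K x) (\<lambda>y. visit i x y * d x y) = 0" for x
    using centered[of x] by (cases "x = i") (simp_all add: visit_def)
  ultimately show ?thesis by (rule csum_tight)
qed

lemma empirical_mean_expansion:
  fixes d :: "'e \<Rightarrow> 'e \<times> nat \<Rightarrow> real"
  assumes B: "\<And>x y. \<bar>d x y\<bar> \<le> B" and centered: "\<And>x. measure_pmf.expectation (K x) (d x) = 0"
  shows "neg_in_prob p (\<lambda>m h. sqrt (real m) * csum m (\<lambda>x y. 1 / csum m (visit x) h * d x y) h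
    - wsum m (\<lambda>x y. \<mu> x * d x y) h / sqrt (real m))"
    and "tight_in_prob p (\<lambda>m h. sqrt (real m) * csum m (\<lambda>x y. 1 / csum m (visit x) h * d x y) h)"
proof -
  let ?S = "\<lambda>(m::nat) x h. csum m (\<lambda>x' y. visit x x' y * d x' y) h / sqrt (real m)"
  have sq: "sqrt (real m) * a = real m * (a / sqrt (real m))" for m :: nat and a
  proof -
    have "real m * (a / sqrt (real m)) = (real m / sqrt (real m)) * a" by simp
    then show ?thesis by (simp only: real_div_sqrt of_nat_0_le_iff)
  qed
  have e1: "sqrt (real m) * csum m (\<lambda>x y. 1 / csum m (visit x) h * d x y) h = (\<Sum>x\<in>UNIV. real m / csum m (visit x) h * ?S m x h)" for m h
    unfolding csum_split[of m "\<lambda>x. 1 / csum m (visit x) h"] sum_distrib_left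
    by (intro sum.cong refl, subst sq) simp
  have e2: "csum m (\<lambda>x y. \<mu> x * d x y) h / sqrt (real m) = (\<Sum>x\<in>UNIV. \<mu> x * ?S m x h)" for m h
    by (simp add: csum_split[of m \<mu>] sum_divide_distrib)
  have "neg_in_prob p (\<lambda>m h. \<Sum>x\<in>UNIV. (real m / csum m (visit x) h - \<mu> x) * ?S m x h)"
    by (rule neg_in_prob_sum, rule neg_in_prob_mult) (rule inverse_visit_ratio, rule state_csum_tight[of d B, OF B centered])
  then have 1: "neg_in_prob p (\<lambda>m h. sqrt (real m) * csum m (\<lambda>x y. 1 / csum m (visit x) h * d x y) h
      - csum m (\<lambda>x y. \<mu> x * d x y) h / sqrt (real m))"
    unfolding e1 e2 by (simp only: left_diff_distrib sum_subtractf)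
  define M where "M = (\<Sum>x\<in>UNIV. \<mu> x)"
  have M: "\<bar>\<mu> x\<bar> \<le> M" for x unfolding M_def using \<mu>_pos by (simp add: member_le_sum less_imp_le)
  have 2: "neg_in_prob p (\<lambda>m h. (csum m (\<lambda>x y. \<mu> x * d x y) h - wsum m (\<lambda>x y. \<mu> x * d x y) h) / sqrt (real m))"
  proof (rule neg_in_prob_tendsto[where b="\<lambda>m. M * B / sqrt (real m)"])
    fix m h
    have "\<bar>wsum m (\<lambda>x y. \<mu> x * d x y) h - csum m (\<lambda>x y. \<mu> x * d x y) h\<bar> \<le> M * B"
      by (rule wsum_csum_diff) (rule abs_mult_bound[OF M B])
    then show "\<bar>(csum m (\<lambda>x y. \<mu> x * d x y) h - wsum m (\<lambda>x y. \<mu> x * d x y) h) / sqrt (real m)\<bar> \<le> M * B / sqrt (real m)"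
      by (simp add: abs_minus_commute divide_right_mono)
  qed (rule one_over_sqrt_tendsto)
  from neg_in_prob_add[OF 1 2]
  show "neg_in_prob p (\<lambda>m h. sqrt (real m) * csum m (\<lambda>x y. 1 / csum m (visit x) h * d x y) h
    - wsum m (\<lambda>x y. \<mu> x * d x y) h / sqrt (real m))"
    by (simp add: diff_divide_distrib)
  have "tight_in_prob p (\<lambda>m h. real m / csum m (visit x) h)" for x
    using tight_in_prob_add[OF neg_imp_tight[OF inverse_visit_ratio[of x]] tight_in_prob_const[of p "\<mu> x"]] by simp
  then show "tight_in_prob p (\<lambda>m h. sqrt (real m) * csum m (\<lambda>x y. 1 / csum m (visit x) h * d x y) h)"
    unfolding e1 by (intro tight_in_prob_sum tight_in_prob_mult state_csum_tight[of d B, OF B centered])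
qed

lemma empirical_mean_diff:
  fixes f :: "'e \<Rightarrow> 'e \<times> nat \<Rightarrow> real" and r :: "'e \<Rightarrow> real"
  assumes "h \<notin> unvisited m"
  shows "csum m (\<lambda>x y. 1 / csum m (visit x) h * f x y) h - (\<Sum>x\<in>UNIV. r x) =
    csum m (\<lambda>x y. 1 / csum m (visit x) h * (f x y - r x)) h"
proof -
  have "csum m (visit x) h \<noteq> 0" for x using assms by (metis (mono_tags, lifting) mem_Collect_eq order_refl)
  then have "csum m (\<lambda>x y. 1 / csum m (visit x) h * r x) h = (\<Sum>x\<in>UNIV. r x)"
    unfolding csum_state by simp
  then show ?thesis by (simp add: right_diff_distrib csum_diff del: times_divide_eq_left)
qed

lemma empirical_kernel_apply: "empirical_kernel m h e = csum m (\<lambda>x y. 1 / csum m (visit x) h * unit_mseq (x, y) e) h"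
  by (simp add: empirical_kernel_def transition_sum_def)

lemma empirical_kernel_vanishes:
  assumes "h \<in> set_pmf (history K i n)"
  shows "vanishes_at_0 (empirical_kernel m h)"
  unfolding vanishes_at_0_def empirical_kernel_apply
  by (intro allI csum_vanishes[OF _ sojourn_positive assms]) (auto simp: unit_mseq_def)

lemma tail_convergent_empirical: "tail_convergent (empirical_kernel m h)"
  unfolding empirical_kernel_def by (rule tail_convergent_transition_sum)

lemma empirical_kernel_tight: "tight_in_prob p (\<lambda>m h. sqrt (real m) * (empirical_kernel m h e - q e))"
proof -
  have sum: "(\<Sum>x\<in>UNIV. restrict_row q x e) = q e"
    by (cases e) (simp add: restrict_row_def)
  have rb: "\<bar>restrict_row q x e\<bar> \<le> 1" for x
    using expectation_bounded_pmf[of "K x" "\<lambda>y. unit_mseq (x, y) e" 1]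
    by (simp add: restrict_row_integral unit_bounded)
  have ui: "integrable (K x) (\<lambda>y. unit_mseq (x, y) e)" for x
    by (rule integrable_measure_pmf_bounded[where B=1]) (simp add: unit_bounded)
  have "tight_in_prob p (\<lambda>m h. sqrt (real m) * csum m (\<lambda>x y. 1 / csum m (visit x) h * (unit_mseq (x, y) e - restrict_row q x e)) h)"
  proof (rule empirical_mean_expansion(2)[where B=2])
    show "\<bar>unit_mseq (x, y) e - restrict_row q x e\<bar> \<le> 2" for x y
      using rb[of x] unit_bounded[of "(x, y)" e] by linarith
    show "measure_pmf.expectation (K x) (\<lambda>y. unit_mseq (x, y) e - restrict_row q x e) = 0" for x
      using ui[of x] by (simp add: restrict_row_integral)
  qed
  then show ?thesis
  proof (rule tight_in_prob_cong[OF _ unvisited_negligible])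
    show "\<forall>\<^sub>F m in sequentially. \<forall>h\<in>set_pmf (p m). h \<notin> unvisited m \<longrightarrow>
      sqrt (real m) * (empirical_kernel m h e - q e) =
      sqrt (real m) * csum m (\<lambda>x y. 1 / csum m (visit x) h * (unit_mseq (x, y) e - restrict_row q x e)) h"
    proof (intro always_eventually allI ballI impI)
      fix m h assume "h \<notin> unvisited m"
      from empirical_mean_diff[OF this, of "\<lambda>x y. unit_mseq (x, y) e" "\<lambda>x. restrict_row q x e"]
      show "sqrt (real m) * (empirical_kernel m h e - q e) =
        sqrt (real m) * csum m (\<lambda>x y. 1 / csum m (visit x) h * (unit_mseq (x, y) e - restrict_row q x e)) h"
        by (simp only: empirical_kernel_apply sum)
    qed
  qed
qed

lemma sqrt_tight_imp_neg:
  fixes X :: "nat \<Rightarrow> 'e hist \<Rightarrow> real"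
  assumes "tight_in_prob p (\<lambda>m h. sqrt (real m) * X m h)"
  shows "neg_in_prob p X"
proof -
  have "neg_in_prob p (\<lambda>m h. 1 / sqrt (real m))"
    by (rule neg_in_prob_tendsto[OF one_over_sqrt_tendsto[of 1]]) simp
  from neg_in_prob_mult[OF this assms] show ?thesis
  proof (rule neg_in_prob_cong[where G="\<lambda>_. {}"])
    show "\<forall>\<^sub>F m in sequentially. \<forall>h\<in>set_pmf (p m). h \<notin> {} \<longrightarrow> X m h = 1 / sqrt (real m) * (sqrt (real m) * X m h)"
      using eventually_gt_at_top[of 0] by eventually_elim simp
  qed simp
qed

lemma empirical_kernel_op1: "tight_in_prob p (\<lambda>m h. empirical_kernel m h e)"
  using tight_in_prob_add[OF neg_imp_tight[OF sqrt_tight_imp_neg[OF empirical_kernel_tight[of e]]] tight_in_prob_const[of p "q e"]]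
  by simp

lemma empirical_power_tight: "tight_in_prob p (\<lambda>m h. mconv_power (empirical_kernel m h) n e)"
proof (induction n arbitrary: e)
  case (Suc n)
  show ?case unfolding mconv_power.simps by (intro tight_in_prob_mconv empirical_kernel_op1 Suc)
qed (simp add: tight_in_prob_const)

lemma empirical_inv_tight: "tight_in_prob p (\<lambda>m h. mconv_inv (empirical_kernel m h) e)"
proof (cases e)
  case (fields i j k)
  have "tight_in_prob p (\<lambda>m h. \<Sum>n\<le>k. mconv_power (empirical_kernel m h) n e)"
    by (intro tight_in_prob_sum empirical_power_tight)
  then show ?thesis
  proof (rule tight_in_prob_cong[where G="\<lambda>_. {}"])
    show "\<forall>\<^sub>F m in sequentially. \<forall>h\<in>set_pmf (p m). h \<notin> {} \<longrightarrow>
        mconv_inv (empirical_kernel m h) e = (\<Sum>n\<le>k. mconv_power (empirical_kernel m h) n e)"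
      unfolding fields
      by (intro always_eventually allI ballI impI mconv_inv_finite empirical_kernel_vanishes order_refl)
  qed simp
qed

lemma empirical_survival_bounded: "\<bar>survival (empirical_kernel m h) e\<bar> \<le> 1"
proof (cases e)
  case (fields i j k)
  let ?C = "\<lambda>x. csum m (visit x) h"
  have C: "0 \<le> ?C x" for x by (rule csum_nonneg) (rule visit_nonneg)
  have eq: "survival (empirical_kernel m h) e = csum m (\<lambda>x y. 1 / ?C x * survival (unit_mseq (x, y)) e) h"
    by (simp add: empirical_kernel_def survival_transition_sum)
  have s: "0 \<le> survival (unit_mseq (x, y)) e" "survival (unit_mseq (x, y)) e \<le> visit i x y" for x y
    by (cases y; simp add: fields survival_unit visit_def)+
  have "0 \<le> survival (empirical_kernel m h) e"
    unfolding eq by (intro csum_nonneg mult_nonneg_nonneg s) (simp add: C)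
  moreover have "survival (empirical_kernel m h) e \<le> csum m (\<lambda>x y. 1 / ?C x * visit i x y) h"
    unfolding eq by (intro csum_mono mult_left_mono s) (simp add: C)
  moreover have "csum m (\<lambda>x y. 1 / ?C x * visit i x y) h = csum m (\<lambda>x y. 1 / ?C i * visit i x y) h"
    by (rule arg_cong[where f="\<lambda>d. csum m d h"]) (auto simp: fun_eq_iff visit_def)
  moreover have "csum m (\<lambda>x y. 1 / ?C i * visit i x y) h \<le> 1"
    unfolding csum_scale by (cases "csum m (visit i) h = 0") simp_all
  ultimately show ?thesis by linarith
qed

abbreviation "P_emp m h \<equiv> semi_markov_law (empirical_kernel m h)"
abbreviation "P_true \<equiv> semi_markov_law q"
abbreviation "\<Delta> m h \<equiv> (\<lambda>e. empirical_kernel m h e - q e)"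

lemma P_emp_tight: "tight_in_prob p (\<lambda>m h. P_emp m h e)"
  unfolding semi_markov_law_def
  by (intro tight_in_prob_mconv empirical_inv_tight tight_in_prob_bounded[where B=1] always_eventually allI ballI
    empirical_survival_bounded)

lemma linear_part_expansion:
  shows "neg_in_prob p (\<lambda>m h. sqrt (real m) * semi_markov_law_deriv q (\<Delta> m h) e - wsum m (\<lambda>x y. \<mu> x * influence e x y) h / sqrt (real m))"
    and "tight_in_prob p (\<lambda>m h. sqrt (real m) * semi_markov_law_deriv q (\<Delta> m h) e)"
proof -
  obtain B where B: "\<And>x y. \<bar>influence e x y\<bar> \<le> B" using influence_bounded by blast
  have eq: "semi_markov_law_deriv q (\<Delta> m h) e = csum m (\<lambda>x y. 1 / csum m (visit x) h * influence e x y) h"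
    if "h \<notin> unvisited m" for m h
  proof -
    have "semi_markov_law_deriv q (\<Delta> m h) e = semi_markov_law_deriv q (empirical_kernel m h) e - semi_markov_law_deriv q q e"
      by (simp add: semi_markov_law_deriv_diff tail_convergent_empirical survival_q)
    also have "semi_markov_law_deriv q (empirical_kernel m h) e = csum m (\<lambda>x y. 1 / csum m (visit x) h * V_unit q (x, y) e) h"
      by (simp only: empirical_kernel_def deriv_transition_sum V_unit_deriv)
    also have "\<dots> - semi_markov_law_deriv q q e = csum m (\<lambda>x y. 1 / csum m (visit x) h * influence e x y) h"
      unfolding influence_def sum_V_row[symmetric] by (rule empirical_mean_diff[OF that])
    finally show ?thesis .
  qed
  show "neg_in_prob p (\<lambda>m h. sqrt (real m) * semi_markov_law_deriv q (\<Delta> m h) e - wsum m (\<lambda>x y. \<mu> x * influence e x y) h / sqrt (real m))"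
    by (rule neg_in_prob_cong[OF empirical_mean_expansion(1)[of "influence e" B, OF B influence_centered] unvisited_negligible])
      (intro always_eventually allI ballI impI, drule eq, simp only:)
  show "tight_in_prob p (\<lambda>m h. sqrt (real m) * semi_markov_law_deriv q (\<Delta> m h) e)"
    by (rule tight_in_prob_cong[OF empirical_mean_expansion(2)[of "influence e" B, OF B influence_centered] unvisited_negligible])
      (intro always_eventually allI ballI impI, drule eq, simp only:)
qed

lemma estimator_linearization:
  assumes "h \<in> set_pmf (p m)"
  shows "sqrt (real m) * (P_emp m h e - P_true e) = sqrt (real m) * semi_markov_law_deriv q (\<Delta> m h) e
    + (mconv_inv q \<circledast> (\<lambda>e. sqrt (real m) * \<Delta> m h e) \<circledast> (\<lambda>e. P_emp m h e - P_true e)) e"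
proof -
  have "P_emp m h e - P_true e = semi_markov_law_deriv q (\<Delta> m h) e
    + (mconv_inv q \<circledast> \<Delta> m h \<circledast> (\<lambda>e. P_emp m h e - P_true e)) e"
    by (rule semi_markov_law_linearization[OF q_vanishes empirical_kernel_vanishes[OF assms] survival_q(1) tail_convergent_empirical])
  then have "sqrt (real m) * (P_emp m h e - P_true e) = sqrt (real m) * (semi_markov_law_deriv q (\<Delta> m h) e
    + (mconv_inv q \<circledast> \<Delta> m h \<circledast> (\<lambda>e. P_emp m h e - P_true e)) e)"
    by (rule arg_cong)
  then show ?thesis by (simp only: mconv_scale_left mconv_scale_right distrib_left)
qed

lemma scaled_error_tight: "tight_in_prob p (\<lambda>m h. sqrt (real m) * (P_emp m h e - P_true e))"
proof -
  have error: "tight_in_prob p (\<lambda>m h. P_emp m h e - P_true e)" for e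
    using tight_in_prob_add[OF P_emp_tight tight_in_prob_const[of p "- P_true e"]] by simp
  have "tight_in_prob p (\<lambda>m h. sqrt (real m) * semi_markov_law_deriv q (\<Delta> m h) e
    + (mconv_inv q \<circledast> (\<lambda>e. sqrt (real m) * \<Delta> m h e) \<circledast> (\<lambda>e. P_emp m h e - P_true e)) e)"
  proof -
    have "tight_in_prob p (\<lambda>m h. (mconv_inv q \<circledast> (\<lambda>e. sqrt (real m) * \<Delta> m h e)) e)" for e
      by (rule tight_in_prob_mconv) (rule tight_in_prob_const, rule empirical_kernel_tight)
    then have "tight_in_prob p (\<lambda>m h. (mconv_inv q \<circledast> (\<lambda>e. sqrt (real m) * \<Delta> m h e) \<circledast> (\<lambda>e. P_emp m h e - P_true e)) e)"
      by (rule tight_in_prob_mconv) (rule error)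
    with linear_part_expansion(2) show ?thesis by (rule tight_in_prob_add)
  qed
  then show ?thesis
    by (rule tight_in_prob_cong[where G="\<lambda>_. {}"])
      (simp, intro always_eventually allI ballI impI estimator_linearization)
qed

lemma estimator_expansion:
  "neg_in_prob p (\<lambda>m h. sqrt (real m) * (P_emp m h e - P_true e) - wsum m (\<lambda>x y. \<mu> x * influence e x y) h / sqrt (real m))"
proof -
  have "neg_in_prob p (\<lambda>m h. (sqrt (real m) * semi_markov_law_deriv q (\<Delta> m h) e - wsum m (\<lambda>x y. \<mu> x * influence e x y) h / sqrt (real m))
    + (mconv_inv q \<circledast> (\<lambda>e. sqrt (real m) * \<Delta> m h e) \<circledast> (\<lambda>e. P_emp m h e - P_true e)) e)"
  proof -
    have "tight_in_prob p (\<lambda>m h. (mconv_inv q \<circledast> (\<lambda>e. sqrt (real m) * \<Delta> m h e)) e)" for e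
      by (rule tight_in_prob_mconv) (rule tight_in_prob_const, rule empirical_kernel_tight)
    then have "neg_in_prob p (\<lambda>m h. (mconv_inv q \<circledast> (\<lambda>e. sqrt (real m) * \<Delta> m h e) \<circledast> (\<lambda>e. P_emp m h e - P_true e)) e)"
      by (rule neg_in_prob_mconv) (rule sqrt_tight_imp_neg, rule scaled_error_tight)
    with linear_part_expansion(1) show ?thesis by (rule neg_in_prob_add)
  qed
  then show ?thesis
    by (rule neg_in_prob_cong[where G="\<lambda>_. {}"])
      (simp, intro always_eventually allI ballI impI, simp only: estimator_linearization add_diff_eq diff_add_eq)
qed

theorem estimator_iexp_limit:
  assumes "finite F"
  shows "(\<lambda>m. measure_pmf.expectation (p m) (\<lambda>h. iexp (\<Sum>e\<in>F. c e * (sqrt (real m) * (P_emp m h e - P_true e))))) \<longlonglongrightarrow>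
    of_real (exp (- quad_form (\<lambda>a b. V_P q \<mu> (a, b)) F c / 2))"
proof -
  define d where "d x y = (\<Sum>e\<in>F. c e * (\<mu> x * influence e x y))" for x y
  have "\<exists>B. \<forall>z. \<bar>c e * (\<mu> (fst z) * influence e (fst z) (snd z))\<bar> \<le> B" for e
  proof (rule scaled_uniformly_bounded)
    obtain B where B: "\<And>x y. \<bar>influence e x y\<bar> \<le> B" using influence_bounded by blast
    have "\<bar>\<mu> x\<bar> \<le> (\<Sum>x\<in>UNIV. \<bar>\<mu> x\<bar>)" for x by (rule member_le_sum) auto
    from abs_mult_bound[OF this B]
    show "\<exists>B. \<forall>z. \<bar>\<mu> (fst z) * influence e (fst z) (snd z)\<bar> \<le> B" by blast
  qed
  from sum_uniformly_bounded[of F "\<lambda>e z. c e * (\<mu> (fst z) * influence e (fst z) (snd z))", OF this]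
  obtain B where "\<forall>z. \<bar>d (fst z) (snd z)\<bar> \<le> B" unfolding d_def by blast
  then have B: "\<bar>d x y\<bar> \<le> B" for x y by (metis fst_conv snd_conv)
  have int: "integrable (K x) (influence e x)" for e x
    using influence_bounded[of e] integrable_measure_pmf_bounded[of "K x" "influence e x"] by auto
  have centered: "measure_pmf.expectation (K x) (d x) = 0" for x
    by (simp add: d_def[abs_def] int influence_centered)
  have "(\<Sum>x\<in>UNIV. measure_pmf.expectation (K x) (\<lambda>y. (d x y)\<^sup>2) / \<mu> x) = quad_form (\<lambda>a b. V_P q \<mu> (a, b)) F c"
    unfolding influence_quad_form[OF assms]
  proof (intro sum.cong refl)
    fix x
    have "(d x y)\<^sup>2 = (\<mu> x)\<^sup>2 * (\<Sum>a\<in>F. c a * influence a x y)\<^sup>2" for y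
      by (simp add: d_def sum_distrib_left power_mult_distrib[symmetric] ac_simps)
    then show "measure_pmf.expectation (K x) (\<lambda>y. (d x y)\<^sup>2) / \<mu> x =
        \<mu> x * measure_pmf.expectation (K x) (\<lambda>y. (\<Sum>a\<in>F. c a * influence a x y)\<^sup>2)"
      using \<mu>_pos[of x] by (simp add: power2_eq_square)
  qed
  with wsum_central_limit[of d B \<mu> i\<^sub>0, OF B centered \<mu>_pos lln]
  have lim: "(\<lambda>m. measure_pmf.expectation (p m) (\<lambda>h. iexp (wsum m d h / sqrt (real m)))) \<longlonglongrightarrow>
      of_real (exp (- quad_form (\<lambda>a b. V_P q \<mu> (a, b)) F c / 2))" by (simp del: history.simps)
  have "neg_in_prob p (\<lambda>m h. \<Sum>e\<in>F. c e * (sqrt (real m) * (P_emp m h e - P_true e) - wsum m (\<lambda>x y. \<mu> x * influence e x y) h / sqrt (real m)))"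
    by (intro neg_in_prob_sum neg_in_prob_scale estimator_expansion)
  moreover have "wsum m d h / sqrt (real m) = (\<Sum>e\<in>F. c e * (wsum m (\<lambda>x y. \<mu> x * influence e x y) h / sqrt (real m)))" for m h
    unfolding d_def[abs_def] by (simp only: wsum_sum wsum_scale sum_divide_distrib times_divide_eq_right)
  ultimately have "neg_in_prob p (\<lambda>m h. (\<Sum>e\<in>F. c e * (sqrt (real m) * (P_emp m h e - P_true e))) - wsum m d h / sqrt (real m))"
    by (simp only: sum_subtractf right_diff_distrib)
  from slutsky_iexp[OF lim this] show ?thesis .
qed

end

section \<open>Markov renewal chains\<close>

primrec observed :: "(nat \<Rightarrow> 'w \<Rightarrow> 'e) \<Rightarrow> (nat \<Rightarrow> 'w \<Rightarrow> nat) \<Rightarrow> nat \<Rightarrow> 'w \<Rightarrow> 'e hist"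
  where
    "observed J S 0 \<omega> = [(J 0 \<omega>, sojourn S 0 \<omega>)]"
  | "observed J S (Suc n) \<omega> = (J (Suc n) \<omega>, sojourn S (Suc n) \<omega>) # observed J S n \<omega>"

lemma observed_nonempty[simp]: "observed J S n \<omega> \<noteq> []"
  by (cases n) auto

lemma length_observed[simp]: "length (observed J S n \<omega>) = Suc n"
  by (induction n) auto

lemma cur_observed[simp]: "cur (observed J S n \<omega>) = J n \<omega>"
  by (cases n) auto

lemma observed_eq_iff:
  assumes "length h = Suc n"
  shows "observed J S n \<omega> = h \<longleftrightarrow>
    (\<forall>m\<le>n. J m \<omega> = fst (h ! (n - m)) \<and> sojourn S m \<omega> = snd (h ! (n - m)))"
  using assms
proof (induction n arbitrary: h)
  case 0
  then obtain y where "h = [y]" by (metis length_0_conv length_Suc_conv)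
  then show ?case by (cases y) auto
next
  case (Suc n)
  then obtain y h' where h: "h = y # h'" "length h' = Suc n" by (metis length_Suc_conv)
  have "(\<forall>m\<le>Suc n. J m \<omega> = fst (h ! (Suc n - m)) \<and> sojourn S m \<omega> = snd (h ! (Suc n - m))) \<longleftrightarrow>
      (J (Suc n) \<omega> = fst y \<and> sojourn S (Suc n) \<omega> = snd y) \<and>
      (\<forall>m\<le>n. J m \<omega> = fst (h' ! (n - m)) \<and> sojourn S m \<omega> = snd (h' ! (n - m)))"
    by (auto simp: h le_Suc_eq Suc_diff_le all_conj_distrib)
  then show ?case using Suc.IH[OF h(2)] by (cases y) (auto simp: h)
qed

lemma pmf_history_Cons: "pmf (history K i (Suc n)) (y # h) = pmf (history K i n) h * pmf (K (cur h)) y"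
proof -
  have "pmf (map_pmf (\<lambda>y. y # h') (K (cur h'))) (y # h) = indicator {h} h' * pmf (K (cur h)) y" for h'
  proof (cases "h' = h")
    case True
    then show ?thesis using pmf_map_inj'[of "\<lambda>y. y # h" "K (cur h)" y] by (simp add: inj_def)
  next
    case False
    then show ?thesis by (auto simp: pmf_eq_0_set_pmf)
  qed
  then show ?thesis by (simp add: pmf_bind measure_pmf_single)
qed

locale markov_renewal =
  fixes q :: "'e::finite mseq" and Pr :: "'e \<Rightarrow> 'w measure" and J :: "nat \<Rightarrow> 'w \<Rightarrow> 'e" and S :: "nat \<Rightarrow> 'w \<Rightarrow> nat"
  assumes chain: "markov_renewal_chain q Pr J S"

sublocale markov_renewal \<subseteq> semi_markov q
  by standard (use chain in \<open>simp add: markov_renewal_chain_def\<close>)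

context markov_renewal
begin

lemma prob_space_Pr: "prob_space (Pr i)"
  using chain by (simp add: markov_renewal_chain_def)

lemma J_measurable[measurable]: "J n \<in> measurable (Pr i) (count_space UNIV)"
  using chain by (simp add: markov_renewal_chain_def)

lemma S_measurable[measurable]: "S n \<in> measurable (Pr i) (count_space UNIV)"
  using chain by (simp add: markov_renewal_chain_def)

lemma sojourn_measurable[measurable]: "sojourn S n \<in> measurable (Pr i) (count_space UNIV)"
  unfolding sojourn_def[abs_def] by measurable

lemma observed_event: "{\<omega> \<in> space (Pr i). observed J S n \<omega> = h} \<in> sets (Pr i)"
proof (cases "length h = Suc n")
  case True
  have "{\<omega> \<in> space (Pr i). observed J S n \<omega> = h} =
      {\<omega> \<in> space (Pr i). \<forall>m\<in>{..n}. J m \<omega> = fst (h ! (n - m)) \<and> sojourn S m \<omega> = snd (h ! (n - m))}"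
    by (auto simp: observed_eq_iff[OF True])
  also have "\<dots> \<in> sets (Pr i)" by measurable
  finally show ?thesis .
next
  case False
  then have "{\<omega> \<in> space (Pr i). observed J S n \<omega> = h} = {}" by auto
  then show ?thesis by (simp only: sets.empty_sets)
qed

lemma observed_measurable[measurable]: "observed J S n \<in> measurable (Pr i) (count_space UNIV)"
proof (subst measurable_count_space_eq_countable)
  show "observed J S n \<in> space (Pr i) \<rightarrow> UNIV \<and> (\<forall>h\<in>UNIV. observed J S n -` {h} \<inter> space (Pr i) \<in> sets (Pr i))"
    using observed_event[of i n] by (simp add: vimage_def Int_def conj_commute)
qed auto

lemma start: "AE \<omega> in Pr i. J 0 \<omega> = i \<and> S 0 \<omega> = 0"
  using chain by (simp add: markov_renewal_chain_def)

lemma observed_Suc_prob: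
  assumes "length h = Suc n"
  shows "measure (Pr i) {\<omega> \<in> space (Pr i). observed J S (Suc n) \<omega> = y # h} =
    measure (Pr i) {\<omega> \<in> space (Pr i). observed J S n \<omega> = h} * q (cur h, y)"
proof -
  interpret prob_space "Pr i" by (rule prob_space_Pr)
  define js xs where "js m = fst (h ! (n - m))" and "xs m = snd (h ! (n - m))" for m
  let ?Q = "\<lambda>\<omega>. \<forall>m\<le>n. J m \<omega> = js m \<and> sojourn S m \<omega> = xs m"
  let ?R = "\<lambda>\<omega>. J (Suc n) \<omega> = fst y \<and> sojourn S (Suc n) \<omega> = snd y"
  have Q: "observed J S n \<omega> = h \<longleftrightarrow> ?Q \<omega>" for \<omega>
    using observed_eq_iff[OF assms] by (simp add: js_def xs_def)
  have QR: "observed J S (Suc n) \<omega> = y # h \<longleftrightarrow> ?R \<omega> \<and> ?Q \<omega>" for \<omega>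
    using Q by (cases y) auto
  have js: "js n = cur h" using assms by (cases h) (auto simp: js_def cur_def)
  show ?thesis
  proof (cases "measure (Pr i) {\<omega> \<in> space (Pr i). ?Q \<omega>} > 0")
    case True
    then have "cond_prob (Pr i) ?R ?Q = q (js n, fst y, snd y)"
      using chain unfolding markov_renewal_chain_def by blast
    then have "measure (Pr i) {\<omega> \<in> space (Pr i). ?R \<omega> \<and> ?Q \<omega>} = measure (Pr i) {\<omega> \<in> space (Pr i). ?Q \<omega>} * q (cur h, y)"
      using True by (simp add: cond_prob_def js field_simps)
    then show ?thesis unfolding Q QR .
  next
    case False
    then have 0: "measure (Pr i) {\<omega> \<in> space (Pr i). ?Q \<omega>} = 0" using measure_nonneg by (simp add: not_less order_antisym)
    have "{\<omega> \<in> space (Pr i). ?Q \<omega>} \<in> sets (Pr i)" using observed_event[of i n h] unfolding Q .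
    then have "measure (Pr i) {\<omega> \<in> space (Pr i). ?R \<omega> \<and> ?Q \<omega>} \<le> measure (Pr i) {\<omega> \<in> space (Pr i). ?Q \<omega>}"
      by (intro finite_measure_mono) auto
    with 0 have "measure (Pr i) {\<omega> \<in> space (Pr i). ?R \<omega> \<and> ?Q \<omega>} = 0" using measure_nonneg by (simp add: order_antisym)
    with 0 show ?thesis unfolding Q QR by simp
  qed
qed

lemma observed_prob: "measure (Pr i) {\<omega> \<in> space (Pr i). observed J S n \<omega> = h} = pmf (history K i n) h"
proof (induction n arbitrary: h)
  case 0
  interpret prob_space "Pr i" by (rule prob_space_Pr)
  show ?case
  proof (cases "h = [(i, 0)]")
    case True
    have "AE \<omega> in Pr i. observed J S 0 \<omega> = h" using start by eventually_elim (simp add: True sojourn_def)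
    then have "prob {\<omega> \<in> space (Pr i). observed J S 0 \<omega> = h} = 1"
      using observed_event[of i 0 h] by (subst prob_Collect_eq_1)
    then show ?thesis using True by simp
  next
    case False
    have "AE \<omega> in Pr i. observed J S 0 \<omega> \<noteq> h" using start by eventually_elim (use False in \<open>auto simp: sojourn_def\<close>)
    then have "prob {\<omega> \<in> space (Pr i). observed J S 0 \<omega> = h} = 0"
      using observed_event[of i 0 h] by (subst prob_Collect_eq_0)
    then show ?thesis using False by simp
  qed
next
  case (Suc n)
  show ?case
  proof (cases "length h = Suc (Suc n)")
    case True
    then obtain y h' where h: "h = y # h'" "length h' = Suc n" by (metis length_Suc_conv)
    show ?thesis unfolding h(1) observed_Suc_prob[OF h(2)] Suc pmf_history_Cons pmf_K ..
  next
    case False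
    then have "{\<omega> \<in> space (Pr i). observed J S (Suc n) \<omega> = h} = {}" using length_observed[of J S "Suc n"] by auto
    moreover have "pmf (history K i (Suc n)) h = 0" using False length_history[of h K i "Suc n"] by (auto simp: pmf_eq_0_set_pmf simp del: history.simps)
    ultimately show ?thesis by (simp only: measure_empty)
  qed
qed

lemma distr_observed: "distr (Pr i) (count_space UNIV) (observed J S n) = measure_pmf (history K i n)"
proof (rule measure_eqI_countable[of _ UNIV])
  fix h :: "'e hist"
  interpret prob_space "Pr i" by (rule prob_space_Pr)
  have "emeasure (distr (Pr i) (count_space UNIV) (observed J S n)) {h} = emeasure (Pr i) {\<omega> \<in> space (Pr i). observed J S n \<omega> = h}"
    by (subst emeasure_distr) (auto simp: vimage_def Int_def conj_commute)
  also have "\<dots> = emeasure (measure_pmf (history K i n)) {h}"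
    by (simp add: emeasure_eq_measure observed_prob emeasure_pmf_single)
  finally show "emeasure (distr (Pr i) (count_space UNIV) (observed J S n)) {h} = emeasure (measure_pmf (history K i n)) {h}" .
qed auto

lemma integral_observed:
  fixes f :: "'e hist \<Rightarrow> 'b::{banach, second_countable_topology}"
  shows "(\<integral>\<omega>. f (observed J S n \<omega>) \<partial>Pr i) = measure_pmf.expectation (history K i n) f"
  unfolding distr_observed[symmetric] by (rule integral_distr[symmetric]) auto

lemma nn_integral_observed: "(\<integral>\<^sup>+\<omega>. f (observed J S n \<omega>) \<partial>Pr i) = (\<integral>\<^sup>+h. f h \<partial>history K i n)"
  unfolding distr_observed[symmetric] by (rule nn_integral_distr[symmetric]) auto

lemma AE_observed: "AE \<omega> in Pr i. \<forall>n. observed J S n \<omega> \<in> set_pmf (history K i n)"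
proof (subst AE_all_countable, rule allI)
  fix n
  have "AE h in distr (Pr i) (count_space UNIV) (observed J S n). h \<in> set_pmf (history K i n)"
    unfolding distr_observed by (simp add: AE_measure_pmf)
  then show "AE \<omega> in Pr i. observed J S n \<omega> \<in> set_pmf (history K i n)"
    by (subst (asm) AE_distr_iff) auto
qed

definition regular :: "'e \<Rightarrow> 'w \<Rightarrow> bool"
  where "regular i \<omega> \<longleftrightarrow> J 0 \<omega> = i \<and> S 0 \<omega> = 0 \<and> (\<forall>n. S n \<omega> < S (Suc n) \<omega>)"

lemma AE_regular: "AE \<omega> in Pr i. regular i \<omega>"
  using start AE_observed
proof eventually_elim
  case (elim \<omega>)
  have "S n \<omega> < S (Suc n) \<omega>" for n
  proof -
    have "observed J S (Suc n) \<omega> \<in> set_pmf (history K i (Suc n))" using elim by blast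
    then have "0 < sojourn S (Suc n) \<omega>" using sojourn_positive by fastforce
    then show ?thesis by (simp add: sojourn_def)
  qed
  with elim show ?case by (simp add: regular_def)
qed

lemma regular_S:
  assumes "regular i \<omega>"
  shows "total (observed J S n \<omega>) = S n \<omega>" "n \<le> S n \<omega>" "strict_mono (\<lambda>n. S n \<omega>)"
    "sojourn S (Suc n) \<omega> = S (Suc n) \<omega> - S n \<omega>"
proof -
  have lt: "S n \<omega> < S (Suc n) \<omega>" for n using assms by (simp add: regular_def)
  show "sojourn S (Suc n) \<omega> = S (Suc n) \<omega> - S n \<omega>" by (simp add: sojourn_def)
  show "strict_mono (\<lambda>n. S n \<omega>)" using lt by (rule strict_mono_Suc_iff[THEN iffD2, OF allI])
  then show "n \<le> S n \<omega>" using strict_mono_imp_increasing by blast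
  show "total (observed J S n \<omega>) = S n \<omega>"
  proof (induction n)
    case 0
    then show ?case using assms by (simp add: regular_def sojourn_def total_def)
  next
    case (Suc n)
    then show ?case using lt[of n] by (simp add: sojourn_def)
  qed
qed

lemma regular_renewal_count:
  assumes "regular i \<omega>"
  shows "S n \<omega> \<le> m \<longleftrightarrow> n \<le> renewal_count S m \<omega>" "renewal_count S m \<omega> \<le> m"
proof -
  note mono = regular_S(3)[OF assms]
  have sub: "{n. S n \<omega> \<le> m} \<subseteq> {..m}" using regular_S(2)[OF assms] order_trans by blast
  then have fin: "finite {n. S n \<omega> \<le> m}" by (rule finite_subset) simp
  have "0 \<in> {n. S n \<omega> \<le> m}" using assms by (simp add: regular_def)
  then have "Max {n. S n \<omega> \<le> m} \<in> {n. S n \<omega> \<le> m}" by (intro Max_in fin) auto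
  then have N: "S (renewal_count S m \<omega>) \<omega> \<le> m" "renewal_count S m \<omega> \<in> {n. S n \<omega> \<le> m}" by (simp_all add: renewal_count_def)
  then show "renewal_count S m \<omega> \<le> m" using sub by blast
  show "S n \<omega> \<le> m \<longleftrightarrow> n \<le> renewal_count S m \<omega>"
  proof
    assume "S n \<omega> \<le> m"
    then show "n \<le> renewal_count S m \<omega>" unfolding renewal_count_def by (intro Max_ge fin) simp
  next
    assume "n \<le> renewal_count S m \<omega>"
    then have "S n \<omega> \<le> S (renewal_count S m \<omega>) \<omega>"
      using strict_mono_less_eq[OF mono, of n "renewal_count S m \<omega>"] by simp
    with N(1) show "S n \<omega> \<le> m" by simp
  qed
qed

lemma csum_observed:
  assumes "regular i \<omega>"
  shows "csum m d (observed J S L \<omega>) =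
    (\<Sum>n = 1..min L (renewal_count S m \<omega>). d (J (n - 1) \<omega>) (J n \<omega>, sojourn S n \<omega>))"
proof (induction L)
  case (Suc L)
  have t: "total (observed J S (Suc L) \<omega>) \<le> m \<longleftrightarrow> Suc L \<le> renewal_count S m \<omega>"
    by (simp only: regular_S(1)[OF assms] regular_renewal_count(1)[OF assms])
  have "csum m d (observed J S (Suc L) \<omega>) = csum m d (observed J S L \<omega>) +
      (if Suc L \<le> renewal_count S m \<omega> then d (J L \<omega>) (J (Suc L) \<omega>, sojourn S (Suc L) \<omega>) else 0)"
    using t by simp
  with Suc show ?case
    by (cases "Suc L \<le> renewal_count S m \<omega>") (simp_all add: min_absorb1 min_absorb2)
qed simp

lemma visit_count_observed:
  assumes "regular i \<omega>" "m \<le> L"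
  shows "visit_count J S x m \<omega> = csum m (visit x) (observed J S L \<omega>)"
proof -
  have "min L (renewal_count S m \<omega>) = renewal_count S m \<omega>"
    using regular_renewal_count(2)[OF assms(1), of m] assms(2) by simp
  then show ?thesis unfolding csum_observed[OF assms(1)] visit_count_def by (simp add: visit_def)
qed

lemma q_hat_observed:
  assumes "regular i \<omega>" "m \<le> L"
  shows "q_hat J S m \<omega> = empirical_kernel m (observed J S L \<omega>)"
proof (rule ext, clarify)
  fix a b k
  have N: "min L (renewal_count S m \<omega>) = renewal_count S m \<omega>"
    using regular_renewal_count(2)[OF assms(1), of m] assms(2) by simp
  define w where "w x = 1 / csum m (visit x) (observed J S L \<omega>)" for x
  have "empirical_kernel m (observed J S L \<omega>) (a, b, k) =
      csum m (\<lambda>x y. w x * unit_mseq (x, y) (a, b, k)) (observed J S L \<omega>)"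
    by (simp only: empirical_kernel_def transition_sum_def w_def)
  also have "\<dots> = (\<Sum>n = 1..renewal_count S m \<omega>. w (J (n - 1) \<omega>) * unit_mseq (J (n - 1) \<omega>, J n \<omega>, sojourn S n \<omega>) (a, b, k))"
    by (simp only: csum_observed[OF assms(1)] N)
  also have "\<dots> = (\<Sum>n = 1..renewal_count S m \<omega>. 1 / visit_count J S (J (n - 1) \<omega>) m \<omega> *
        unit_mseq (J (n - 1) \<omega>, J n \<omega>, sojourn S n \<omega>) (a, b, k))"
    by (simp only: w_def visit_count_observed[OF assms])
  also have "\<dots> = q_hat J S m \<omega> (a, b, k)"
    unfolding q_hat_def prod.case sum_distrib_left
    by (intro sum.cong refl) (auto simp: unit_mseq_def)
  finally show "q_hat J S m \<omega> (a, b, k) = empirical_kernel m (observed J S L \<omega>) (a, b, k)" ..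
qed

end

context semi_markov
begin

lemma expectation_state:
  fixes F :: "'e \<Rightarrow> nat \<Rightarrow> real"
  shows "measure_pmf.expectation p (\<lambda>h. if total h \<le> k then F (cur h) (total h) else 0) =
    (\<Sum>l\<le>k. \<Sum>u\<in>UNIV. measure (measure_pmf p) {h. cur h = u \<and> total h = l} * F u l)"
proof -
  have eq: "(if total h \<le> k then F (cur h) (total h) else 0) =
      (\<Sum>l\<le>k. \<Sum>u\<in>UNIV. indicator {h. cur h = u \<and> total h = l} h * F u l)" for h
  proof -
    have "(\<Sum>u\<in>UNIV. indicator {h. cur h = u \<and> total h = l} h * F u l) = (if l = total h then F (cur h) l else 0)" for l
    proof -
      have "(\<Sum>u\<in>UNIV. indicator {h. cur h = u \<and> total h = l} h * F u l) =
          (\<Sum>u\<in>UNIV. if u = cur h then (if l = total h then F u l else 0) else 0)"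
        by (intro sum.cong refl) (auto simp: indicator_def)
      then show ?thesis by simp
    qed
    then show ?thesis by simp
  qed
  have int: "integrable (measure_pmf p) (\<lambda>h. indicator {h. cur h = u \<and> total h = l} h * F u l)" for u l
    by (rule integrable_measure_pmf_bounded[where B="\<bar>F u l\<bar>"]) (auto split: split_indicator)
  have "measure_pmf.expectation p (\<lambda>h. if total h \<le> k then F (cur h) (total h) else 0) =
      (\<Sum>l\<le>k. measure_pmf.expectation p (\<lambda>h. \<Sum>u\<in>UNIV. indicator {h. cur h = u \<and> total h = l} h * F u l))"
    unfolding eq by (rule Bochner_Integration.integral_sum) (intro Bochner_Integration.integrable_sum int)
  also have "\<dots> = (\<Sum>l\<le>k. \<Sum>u\<in>UNIV. measure_pmf.expectation p (\<lambda>h. indicator {h. cur h = u \<and> total h = l} h * F u l))"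
    by (intro sum.cong refl Bochner_Integration.integral_sum int)
  finally show ?thesis by simp
qed

lemma history_state_prob:
  "measure (history K i n) {h. cur h = j \<and> total h = l} = mconv_power q n (i, j, l)"
proof (induction n arbitrary: j l)
  case 0
  show ?case by (auto simp: mconv_id_def indicator_def total_def)
next
  case (Suc n)
  have "measure (history K i (Suc n)) {h. cur h = j \<and> total h = l} =
      measure_pmf.expectation (history K i (Suc n)) (indicator {h. cur h = j \<and> total h = l})"
    by (simp del: history.simps)
  also have "\<dots> = measure_pmf.expectation (history K i n)
      (\<lambda>h. measure_pmf.expectation (K (cur h)) (\<lambda>y. indicator {h. cur h = j \<and> total h = l} (y # h)))"
    by (rule expectation_history_Suc[where B=1]) (simp add: indicator_def)
  also have "\<dots> = measure_pmf.expectation (history K i n) (\<lambda>h. if total h \<le> l then q (cur h, j, l - total h) else 0)"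
  proof (intro arg_cong[where f="measure_pmf.expectation (history K i n)"] ext)
    fix h
    have "(\<lambda>y. indicator {h. cur h = j \<and> total h = l} (y # h)) =
        (if total h \<le> l then indicator {(j, l - total h)} else (\<lambda>_. 0 :: real))"
      by (auto simp: fun_eq_iff indicator_def)
    then show "measure_pmf.expectation (K (cur h)) (\<lambda>y. indicator {h. cur h = j \<and> total h = l} (y # h)) =
        (if total h \<le> l then q (cur h, j, l - total h) else 0)"
      by (simp add: measure_pmf_single pmf_K)
  qed
  also have "\<dots> = (mconv_power q n \<circledast> q) (i, j, l)"
    unfolding expectation_state[of _ l "\<lambda>u t. q (u, j, l - t)"] Suc mconv_apply ..
  finally show ?case by (simp add: mconv_power_commute)
qed

end

context markov_renewal
begin

lemma Max_degenerate: "\<not> (finite A \<and> A \<noteq> {}) \<Longrightarrow> Max A = the None" for A :: "nat set"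
  by (cases "A = {}") (simp_all add: Max.eq_fold')

lemma renewal_count_eq_iff:
  "renewal_count S m \<omega> = v \<longleftrightarrow> (S v \<omega> \<le> m \<and> (\<forall>n>v. m < S n \<omega>)) \<or>
    ((\<forall>n. S n \<omega> \<le> m \<longrightarrow> (\<exists>n'>n. S n' \<omega> \<le> m)) \<and> v = the None)"
proof (cases "finite {n. S n \<omega> \<le> m} \<and> {n. S n \<omega> \<le> m} \<noteq> {}")
  case True
  define M where "M = renewal_count S m \<omega>"
  have "M \<in> {n. S n \<omega> \<le> m}" unfolding M_def renewal_count_def using True by (intro Max_in) auto
  moreover have "n \<le> M" if "S n \<omega> \<le> m" for n
    unfolding M_def renewal_count_def using True that by (intro Max_ge) auto
  ultimately have M: "S M \<omega> \<le> m" "\<And>n. S n \<omega> \<le> m \<Longrightarrow> n \<le> M" by auto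
  then have "\<not> (\<forall>n. S n \<omega> \<le> m \<longrightarrow> (\<exists>n'>n. S n' \<omega> \<le> m))" by (meson not_le)
  moreover have "M = v \<longleftrightarrow> S v \<omega> \<le> m \<and> (\<forall>n>v. m < S n \<omega>)"
    using M by (meson le_neq_implies_less not_le)
  ultimately show ?thesis unfolding M_def by blast
next
  case False
  then have "renewal_count S m \<omega> = the None"
    unfolding renewal_count_def by (rule Max_degenerate)
  moreover have "\<forall>n. S n \<omega> \<le> m \<longrightarrow> (\<exists>n'>n. S n' \<omega> \<le> m)"
  proof (cases "finite {n. S n \<omega> \<le> m}")
    case True
    then show ?thesis using False by auto
  next
    case False
    then show ?thesis unfolding infinite_nat_iff_unbounded by simp
  qed
  ultimately show ?thesis by (auto simp: not_le[symmetric])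
qed

lemma renewal_count_measurable[measurable]: "renewal_count S m \<in> measurable (Pr i) (count_space UNIV)"
proof (subst measurable_count_space_eq_countable)
  have "{\<omega> \<in> space (Pr i). renewal_count S m \<omega> = v} \<in> sets (Pr i)" for v
    unfolding renewal_count_eq_iff by measurable
  then show "renewal_count S m \<in> space (Pr i) \<rightarrow> UNIV \<and> (\<forall>v\<in>UNIV. renewal_count S m -` {v} \<inter> space (Pr i) \<in> sets (Pr i))"
    by (simp add: vimage_def Int_def conj_commute)
qed auto

lemma semi_markov_chain_measurable[measurable]: "semi_markov_chain J S k \<in> measurable (Pr i) (count_space UNIV)"
  unfolding semi_markov_chain_def[abs_def]
  by (rule measurable_compose_countable[OF J_measurable renewal_count_measurable])

lemma P_mseq_eq: "P_mseq Pr J S = semi_markov_law q"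
proof (rule ext, clarify)
  fix i j :: 'e and k
  interpret prob_space "Pr i" by (rule prob_space_Pr)
  define A where "A = {h. cur (tl h) = j \<and> total (tl h) \<le> k \<and> k < total h}"
  have ev: "{\<omega> \<in> space (Pr i). semi_markov_chain J S k \<omega> = j} \<in> sets (Pr i)" by measurable
  have "P_mseq Pr J S (i, j, k) = (\<integral>\<omega>. indicator {\<omega> \<in> space (Pr i). semi_markov_chain J S k \<omega> = j} \<omega> \<partial>Pr i)"
    using ev by (simp add: P_mseq_def)
  also have "\<dots> = (\<integral>\<omega>. (\<Sum>n\<le>k. indicator A (observed J S (Suc n) \<omega>)) \<partial>Pr i)"
  proof (rule integral_cong_AE)
    show "(\<lambda>\<omega>. (\<Sum>n\<le>k. indicator A (observed J S (Suc n) \<omega>)) :: real) \<in> borel_measurable (Pr i)"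
      by (intro borel_measurable_sum measurable_compose[OF observed_measurable]) simp
    show "AE \<omega> in Pr i. indicator {\<omega> \<in> space (Pr i). semi_markov_chain J S k \<omega> = j} \<omega> =
        ((\<Sum>n\<le>k. indicator A (observed J S (Suc n) \<omega>)) :: real)"
      using AE_regular[of i] AE_space
    proof eventually_elim
      case (elim \<omega>)
      define N where "N = renewal_count S k \<omega>"
      have in_A: "observed J S (Suc n) \<omega> \<in> A \<longleftrightarrow> J n \<omega> = j \<and> n = N" for n
      proof -
        have "observed J S (Suc n) \<omega> \<in> A \<longleftrightarrow> J n \<omega> = j \<and> S n \<omega> \<le> k \<and> \<not> S (Suc n) \<omega> \<le> k"
          using regular_S(1)[OF elim(1), of n] regular_S(1)[OF elim(1), of "Suc n"] by (simp add: A_def not_le)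
        also have "\<dots> \<longleftrightarrow> J n \<omega> = j \<and> n = N"
          unfolding regular_renewal_count(1)[OF elim(1)] N_def by auto
        finally show ?thesis .
      qed
      have "N \<le> k" unfolding N_def by (rule regular_renewal_count(2)[OF elim(1)])
      have "(\<Sum>n\<le>k. indicator A (observed J S (Suc n) \<omega>)) = (\<Sum>n\<le>k. if n = N then (if J N \<omega> = j then 1 else 0 :: real) else 0)"
        by (intro sum.cong refl) (auto simp: indicator_def in_A simp del: observed.simps)
      also have "\<dots> = indicator {\<omega> \<in> space (Pr i). semi_markov_chain J S k \<omega> = j} \<omega>"
        using \<open>N \<le> k\<close> elim(2) by (simp add: semi_markov_chain_def N_def indicator_def)
      finally show ?case ..
    qed
  qed (use ev in simp)
  also have "\<dots> = (\<Sum>n\<le>k. \<integral>\<omega>. indicator A (observed J S (Suc n) \<omega>) \<partial>Pr i)"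
  proof (rule Bochner_Integration.integral_sum)
    fix n
    have "(\<lambda>\<omega>. indicator A (observed J S (Suc n) \<omega>) :: real) \<in> borel_measurable (Pr i)"
      by (rule measurable_compose[OF observed_measurable]) simp
    then show "integrable (Pr i) (\<lambda>\<omega>. indicator A (observed J S (Suc n) \<omega>) :: real)"
      by (intro integrable_const_bound[where B=1]) (auto simp: indicator_def)
  qed
  also have "\<dots> = (\<Sum>n\<le>k. (mconv_power q n \<circledast> survival q) (i, j, k))"
  proof (intro sum.cong refl)
    fix n
    have "(\<integral>\<omega>. indicator A (observed J S (Suc n) \<omega>) \<partial>Pr i) = measure_pmf.expectation (history K i (Suc n)) (indicator A :: _ \<Rightarrow> real)"
      by (rule integral_observed)
    also have "\<dots> = measure_pmf.expectation (history K i n) (\<lambda>h. measure_pmf.expectation (K (cur h)) (\<lambda>y. indicator A (y # h)))"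
      by (rule expectation_history_Suc[where B=1]) (simp add: indicator_def)
    also have "\<dots> = measure_pmf.expectation (history K i n) (\<lambda>h. if total h \<le> k then survival q (cur h, j, k - total h) else 0)"
    proof (intro arg_cong[where f="measure_pmf.expectation (history K i n)"] ext)
      fix h
      have "(\<lambda>y. indicator A (y # h)) = (if total h \<le> k \<and> cur h = j then indicator {y. k - total h < snd y} else (\<lambda>_. 0 :: real))"
        by (auto simp: fun_eq_iff indicator_def A_def)
      then show "measure_pmf.expectation (K (cur h)) (\<lambda>y. indicator A (y # h)) =
          (if total h \<le> k then survival q (cur h, j, k - total h) else 0)"
        by (simp add: survival_q)
    qed
    also have "\<dots> = (mconv_power q n \<circledast> survival q) (i, j, k)"
      unfolding expectation_state[of _ k "\<lambda>u t. survival q (u, j, k - t)"] history_state_prob mconv_apply ..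
    finally show "(\<integral>\<omega>. indicator A (observed J S (Suc n) \<omega>) \<partial>Pr i) = (mconv_power q n \<circledast> survival q) (i, j, k)" .
  qed
  also have "\<dots> = ((\<lambda>e. \<Sum>n\<le>k. mconv_power q n e) \<circledast> survival q) (i, j, k)"
    by (simp add: mconv_sum_left)
  also have "\<dots> = semi_markov_law q (i, j, k)"
    unfolding semi_markov_law_def mconv_apply
    by (intro sum.cong refl arg_cong2[of _ _ _ _ "(*)"] mconv_inv_finite[symmetric] q_vanishes) auto
  finally show "P_mseq Pr J S (i, j, k) = semi_markov_law q (i, j, k)" .
qed

end

definition taboo :: "('e \<Rightarrow> ('e \<times> nat) pmf) \<Rightarrow> 'e \<Rightarrow> ('e \<Rightarrow> ennreal) \<Rightarrow> 'e \<Rightarrow> ennreal"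
  where "taboo K i f x = (\<integral>\<^sup>+y. (if fst y = i then 0 else f (fst y)) \<partial>measure_pmf (K x))"

lemma nn_integral_taboo:
  "(\<integral>\<^sup>+h. (if i \<in> fst ` set (butlast h) then 0 else f (cur h)) \<partial>measure_pmf (history K x n)) = (taboo K i ^^ n) f x"
proof (induction n arbitrary: f)
  case (Suc n)
  have "(\<integral>\<^sup>+h. (if i \<in> fst ` set (butlast h) then 0 else f (cur h)) \<partial>measure_pmf (history K x (Suc n))) =
      (\<integral>\<^sup>+h. \<integral>\<^sup>+y. (if i \<in> fst ` set (butlast (y # h)) then 0 else f (fst y)) \<partial>measure_pmf (K (cur h)) \<partial>measure_pmf (history K x n))"
    by (simp cong: if_cong)
  also have "\<dots> = (\<integral>\<^sup>+h. (if i \<in> fst ` set (butlast h) then 0 else taboo K i f (cur h)) \<partial>measure_pmf (history K x n))"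
  proof (rule nn_integral_cong_AE, rule AE_pmfI)
    fix h assume "h \<in> set_pmf (history K x n)"
    then have "h \<noteq> []" by (rule history_nonempty)
    then have "butlast (y # h) = y # butlast h" for y by simp
    then show "(\<integral>\<^sup>+y. (if i \<in> fst ` set (butlast (y # h)) then 0 else f (fst y)) \<partial>measure_pmf (K (cur h))) =
        (if i \<in> fst ` set (butlast h) then 0 else taboo K i f (cur h))"
      by (auto simp: taboo_def intro!: nn_integral_cong)
  qed
  also have "\<dots> = (taboo K i ^^ n) (taboo K i f) x" by (rule Suc)
  finally show ?case by (simp add: funpow_swap1)
qed simp

context semi_markov
begin

definition mean_sojourn :: "'e \<Rightarrow> ennreal"
  where "mean_sojourn x = (\<integral>\<^sup>+y. ennreal (real (snd y)) \<partial>measure_pmf (K x))"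

definition hitting_mean :: "'e \<Rightarrow> 'e \<Rightarrow> ennreal"
  where "hitting_mean i x = (\<Sum>n. (taboo K i ^^ n) mean_sojourn x)"

lemma hitting_mean_unfold: "hitting_mean i x = mean_sojourn x + taboo K i (hitting_mean i) x"
proof -
  have "hitting_mean i x = mean_sojourn x + (\<Sum>n. (taboo K i ^^ Suc n) mean_sojourn x)"
    unfolding hitting_mean_def using suminf_offset[of "\<lambda>n. (taboo K i ^^ n) mean_sojourn x" 1] by simp
  also have "(\<Sum>n. (taboo K i ^^ Suc n) mean_sojourn x) = taboo K i (hitting_mean i) x"
  proof -
    have "taboo K i (hitting_mean i) x =
        (\<integral>\<^sup>+y. (\<Sum>n. if fst y = i then 0 else (taboo K i ^^ n) mean_sojourn (fst y)) \<partial>measure_pmf (K x))"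
      unfolding taboo_def[of K i "hitting_mean i"] hitting_mean_def by (intro nn_integral_cong) simp
    also have "\<dots> = (\<Sum>n. \<integral>\<^sup>+y. (if fst y = i then 0 else (taboo K i ^^ n) mean_sojourn (fst y)) \<partial>measure_pmf (K x))"
      by (rule nn_integral_suminf) simp
    finally show ?thesis by (simp add: taboo_def[symmetric])
  qed
  finally show ?thesis .
qed

lemma hitting_mean_finite_step:
  assumes "hitting_mean i i < \<infinity>" "hitting_mean i x < \<infinity>" "y \<in> set_pmf (K x)"
  shows "hitting_mean i (fst y) < \<infinity>"
proof (cases "fst y = i")
  case False
  have "taboo K i (hitting_mean i) x \<noteq> \<infinity>"
    using assms(2) hitting_mean_unfold[of i x] by auto
  then have "AE y in K x. (if fst y = i then 0 else hitting_mean i (fst y)) \<noteq> \<infinity>"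
    unfolding taboo_def by (rule nn_integral_noteq_infinite[rotated]) simp
  then have "(if fst y = i then 0 else hitting_mean i (fst y)) \<noteq> \<infinity>"
    using assms(3) by (auto simp: AE_measure_pmf_iff simp del: infinity_ennreal_def)
  then show ?thesis using False by (simp add: less_top)
qed (use assms(1) in simp)

lemma hitting_mean_finite:
  assumes "hitting_mean i i < \<infinity>" "h \<in> set_pmf (history K i n)"
  shows "hitting_mean i (cur h) < \<infinity>"
  using assms(2)
proof (induction n arbitrary: h)
  case (Suc n)
  then obtain y h' where h: "h = y # h'" "h' \<in> set_pmf (history K i n)" "y \<in> set_pmf (K (cur h'))" by auto
  then show ?case using hitting_mean_finite_step[OF assms(1) Suc.IH[OF h(2)] h(3)] by simp
qed (simp add: assms(1) cur_def del: infinity_ennreal_def)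

lemma mean_sojourn_ge_1: "1 \<le> mean_sojourn x"
proof -
  have "(\<integral>\<^sup>+y. 1 \<partial>measure_pmf (K x)) \<le> mean_sojourn x"
    unfolding mean_sojourn_def
    by (intro nn_integral_mono_AE) (auto simp: AE_measure_pmf_iff dest!: sojourn_positive simp flip: ennreal_1 intro!: ennreal_leI)
  then show ?thesis by simp
qed

lemma poisson_equation:
  assumes fin: "\<And>x. hitting_mean i x < \<infinity>"
  defines "g \<equiv> \<lambda>x. if x = i then 0 else enn2real (hitting_mean i x)"
  shows "integrable (K x) (\<lambda>y. real (snd y))"
    and "measure_pmf.expectation (K x) (\<lambda>y. real (snd y)) + measure_pmf.expectation (K x) (\<lambda>y. g (fst y))
      = g x + (if x = i then enn2real (hitting_mean i i) else 0)"
proof -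
  have m: "mean_sojourn x < \<infinity>" using fin[of x] hitting_mean_unfold[of i x] by (auto simp: less_top)
  then show int: "integrable (K x) (\<lambda>y. real (snd y))"
    unfolding mean_sojourn_def by (intro integrableI_bounded) auto
  have g: "ennreal (g x) = (if x = i then 0 else hitting_mean i x)" "0 \<le> g x" for x
    using fin[of x] by (auto simp: g_def ennreal_enn2real_if)
  have ig: "integrable (K x) (\<lambda>y. g (fst y))"
  proof (rule integrable_measure_pmf_bounded[where B="\<Sum>x\<in>UNIV. g x"])
    fix y show "norm (g (fst y)) \<le> (\<Sum>x\<in>UNIV. g x)" using g(2) by (auto intro: member_le_sum)
  qed
  have "ennreal (measure_pmf.expectation (K x) (\<lambda>y. real (snd y)) + measure_pmf.expectation (K x) (\<lambda>y. g (fst y))) =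
      (\<integral>\<^sup>+y. ennreal (real (snd y)) \<partial>measure_pmf (K x)) + (\<integral>\<^sup>+y. ennreal (g (fst y)) \<partial>measure_pmf (K x))"
    using int ig g(2) by (simp add: nn_integral_eq_integral Bochner_Integration.integral_nonneg)
  also have "\<dots> = mean_sojourn x + taboo K i (hitting_mean i) x"
    by (simp add: mean_sojourn_def taboo_def g(1))
  also have "\<dots> = hitting_mean i x" by (rule hitting_mean_unfold[symmetric])
  finally have "measure_pmf.expectation (K x) (\<lambda>y. real (snd y)) + measure_pmf.expectation (K x) (\<lambda>y. g (fst y)) = enn2real (hitting_mean i x)"
    using g(2) by (metis Bochner_Integration.integral_nonneg add_nonneg_nonneg enn2real_ennreal of_nat_0_le_iff)
  then show "measure_pmf.expectation (K x) (\<lambda>y. real (snd y)) + measure_pmf.expectation (K x) (\<lambda>y. g (fst y))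
      = g x + (if x = i then enn2real (hitting_mean i i) else 0)"
    by (simp add: g_def)
qed

end

context markov_renewal
begin

lemma butlast_observed: "fst ` set (butlast (observed J S n \<omega>)) = {J k \<omega> | k. 1 \<le> k \<and> k \<le> n}"
proof (induction n)
  case (Suc n)
  have "fst ` set (butlast (observed J S (Suc n) \<omega>)) = insert (J (Suc n) \<omega>) {J k \<omega> | k. 1 \<le> k \<and> k \<le> n}"
    using Suc by (simp)
  also have "\<dots> = {J k \<omega> | k. 1 \<le> k \<and> k \<le> Suc n}" by (auto simp: le_Suc_eq)
  finally show ?case .
qed auto

lemma S_at_hit_series:
  assumes "regular x \<omega>"
  shows "ennreal_of_enat (S_at_hit J S i \<omega>) =
    (\<Sum>n. if i \<in> fst ` set (butlast (observed J S n \<omega>)) then 0 else ennreal (real (sojourn S (Suc n) \<omega>)))"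
    (is "_ = (\<Sum>n. ?f n)")
proof (cases "\<exists>k\<ge>1. J k \<omega> = i")
  case True
  define \<tau> where "\<tau> = (LEAST k. 1 \<le> k \<and> J k \<omega> = i)"
  have \<tau>: "1 \<le> \<tau>" "J \<tau> \<omega> = i" using LeastI_ex[of "\<lambda>k. 1 \<le> k \<and> J k \<omega> = i"] True by (auto simp: \<tau>_def)
  have least: "\<tau> \<le> k" if "1 \<le> k" "J k \<omega> = i" for k using that by (auto simp: \<tau>_def intro: Least_le)
  have "hit_time J i \<omega> = enat \<tau>"
    unfolding hit_time_def
    by (rule Inf_eqI) (use \<tau> least in auto)
  then have "S_at_hit J S i \<omega> = enat (S \<tau> \<omega>)" by (simp add: S_at_hit_def)
  have f: "?f n = (if n < \<tau> then ennreal (real (S (Suc n) \<omega>) - real (S n \<omega>)) else 0)" for n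
  proof -
    have "i \<in> fst ` set (butlast (observed J S n \<omega>)) \<longleftrightarrow> \<tau> \<le> n"
      unfolding butlast_observed using \<tau> least order_trans by blast
    moreover have "S n \<omega> < S (Suc n) \<omega>" using assms by (simp add: regular_def)
    ultimately show ?thesis using regular_S(4)[OF assms, of n] by (auto simp: of_nat_diff)
  qed
  have "(\<Sum>n. ?f n) = (\<Sum>n<\<tau>. ennreal (real (S (Suc n) \<omega>) - real (S n \<omega>)))"
    unfolding f by (subst suminf_finite[of "{..<\<tau>}"]) auto
  also have "\<dots> = ennreal (\<Sum>n<\<tau>. real (S (Suc n) \<omega>) - real (S n \<omega>))"
    by (rule sum_ennreal) (use assms in \<open>auto simp: regular_def less_imp_le\<close>)
  also have "\<dots> = ennreal (real (S \<tau> \<omega>))"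
    using assms sum_lessThan_telescope[of "\<lambda>n. real (S n \<omega>)" \<tau>] by (simp add: regular_def)
  finally show ?thesis using \<open>S_at_hit J S i \<omega> = enat (S \<tau> \<omega>)\<close> by (simp add: ennreal_of_nat_eq_real_of_nat)
next
  case False
  then have empty: "{enat n |n. 1 \<le> n \<and> J n \<omega> = i} = {}" by auto
  have "hit_time J i \<omega> = \<infinity>" unfolding hit_time_def empty by (simp add: top_enat_def)
  then have S: "S_at_hit J S i \<omega> = \<infinity>" by (simp add: S_at_hit_def)
  have ge: "1 \<le> ?f n" for n
  proof -
    have "i \<notin> fst ` set (butlast (observed J S n \<omega>))" unfolding butlast_observed using False by auto
    moreover have "1 \<le> sojourn S (Suc n) \<omega>" using assms regular_S(4)[OF assms, of n]
      by (auto simp: regular_def Suc_le_eq)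
    ultimately show ?thesis by (simp flip: ennreal_1 add: ennreal_leI)
  qed
  have "of_nat N \<le> (\<Sum>n. ?f n)" for N
  proof -
    have "of_nat N = (\<Sum>n<N. 1::ennreal)" by simp
    also have "\<dots> \<le> (\<Sum>n<N. ?f n)" by (rule sum_mono) (rule ge)
    also have "\<dots> \<le> (\<Sum>n. ?f n)" by (rule sum_le_suminf) auto
    finally show ?thesis .
  qed
  then have "\<not> (\<Sum>n. ?f n) < top"
    using ennreal_Ex_less_of_nat[of "\<Sum>n. ?f n"] by (auto simp: not_less[symmetric])
  then have "(\<Sum>n. ?f n) = \<infinity>" by (simp add: not_less top_unique)
  then show ?thesis using S by simp
qed

lemma mean_recurrence_eq: "mean_recurrence Pr J S i = hitting_mean i i"
proof -
  have "mean_recurrence Pr J S i = (\<integral>\<^sup>+\<omega>. (\<Sum>n. if i \<in> fst ` set (butlast (observed J S n \<omega>)) then 0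
      else ennreal (real (sojourn S (Suc n) \<omega>))) \<partial>Pr i)"
    unfolding mean_recurrence_def
    by (rule nn_integral_cong_AE) (use AE_regular[of i] in eventually_elim, rule S_at_hit_series)
  also have "\<dots> = (\<Sum>n. \<integral>\<^sup>+\<omega>. (if i \<in> fst ` set (butlast (observed J S n \<omega>)) then 0
      else ennreal (real (sojourn S (Suc n) \<omega>))) \<partial>Pr i)"
  proof (rule nn_integral_suminf)
    fix n
    have "(\<lambda>\<omega>. (\<lambda>h. if i \<in> fst ` set (butlast (tl h)) then 0 else ennreal (real (snd (hd h)))) (observed J S (Suc n) \<omega>))
        \<in> borel_measurable (Pr i)"
      by (rule measurable_compose[OF observed_measurable]) simp
    then show "(\<lambda>\<omega>. if i \<in> fst ` set (butlast (observed J S n \<omega>)) then 0 else ennreal (real (sojourn S (Suc n) \<omega>)))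
        \<in> borel_measurable (Pr i)" by (simp cong: if_cong)
  qed
  also have "\<dots> = (\<Sum>n. (taboo K i ^^ n) mean_sojourn i)"
  proof (rule suminf_cong)
    fix n
    let ?F = "\<lambda>h. if i \<in> fst ` set (butlast (tl h)) then 0 else ennreal (real (snd (hd h)))"
    have "(\<integral>\<^sup>+\<omega>. (if i \<in> fst ` set (butlast (observed J S n \<omega>)) then 0
        else ennreal (real (sojourn S (Suc n) \<omega>))) \<partial>Pr i) = (\<integral>\<^sup>+\<omega>. ?F (observed J S (Suc n) \<omega>) \<partial>Pr i)"
      by (simp cong: if_cong)
    also have "\<dots> = (\<integral>\<^sup>+h. ?F h \<partial>measure_pmf (history K i (Suc n)))" by (rule nn_integral_observed)
    also have "\<dots> = (\<integral>\<^sup>+h. (if i \<in> fst ` set (butlast h) then 0 else mean_sojourn (cur h)) \<partial>measure_pmf (history K i n))"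
      by (auto simp: mean_sojourn_def intro!: nn_integral_cong)
    also have "\<dots> = (taboo K i ^^ n) mean_sojourn i" by (rule nn_integral_taboo)
    finally show "(\<integral>\<^sup>+\<omega>. (if i \<in> fst ` set (butlast (observed J S n \<omega>)) then 0
        else ennreal (real (sojourn S (Suc n) \<omega>))) \<partial>Pr i) = (taboo K i ^^ n) mean_sojourn i" .
  qed
  finally show ?thesis by (simp add: hitting_mean_def)
qed

lemma irreducible_reach:
  assumes "chain_irreducible Pr J"
  shows "\<exists>n. \<exists>h\<in>set_pmf (history K i n). cur h = j"
proof (rule ccontr)
  assume no: "\<not> ?thesis"
  interpret prob_space "Pr i" by (rule prob_space_Pr)
  have "AE \<omega> in Pr i. \<not> hit_time J j \<omega> < \<infinity>"
    using AE_observed[of i]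
  proof eventually_elim
    case (elim \<omega>)
    then have "J n \<omega> \<noteq> j" for n using no cur_observed by metis
    then have empty: "{enat n |n. 1 \<le> n \<and> J n \<omega> = j} = {}" by auto
    show ?case unfolding hit_time_def empty by (simp add: top_enat_def)
  qed
  then obtain N where N: "{\<omega> \<in> space (Pr i). hit_time J j \<omega> < \<infinity>} \<subseteq> N" "N \<in> sets (Pr i)" "emeasure (Pr i) N = 0"
    by (auto elim!: AE_E)
  then have "measure (Pr i) {\<omega> \<in> space (Pr i). hit_time J j \<omega> < \<infinity>} \<le> measure (Pr i) N"
    by (intro finite_measure_mono)
  also have "\<dots> = 0" using N(3) by (simp add: measure_def)
  finally show False using assms unfolding chain_irreducible_def by (metis not_less)
qed

end

section \<open>Asymptotic normality\<close>

lemma L2_tendsto_diff_integrable: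
  assumes "L2_tendsto M X Y"
  shows "integrable M (\<lambda>\<omega>. (X n \<omega> - Y \<omega>)\<^sup>2)"
proof -
  have [measurable]: "X n \<in> borel_measurable M" "Y \<in> borel_measurable M"
    and int: "integrable M (\<lambda>\<omega>. (X n \<omega>)\<^sup>2)" "integrable M (\<lambda>\<omega>. (Y \<omega>)\<^sup>2)"
    using assms by (auto simp: L2_tendsto_def)
  show ?thesis
  proof (rule Bochner_Integration.integrable_bound)
    show "integrable M (\<lambda>\<omega>. 2 * (X n \<omega>)\<^sup>2 + 2 * (Y \<omega>)\<^sup>2)" using int by simp
    have "(a - b)\<^sup>2 \<le> 2 * a\<^sup>2 + 2 * b\<^sup>2" for a b :: real
      using zero_le_power2[of "a + b"] by (simp add: power2_diff power2_sum)
    then show "AE \<omega> in M. norm ((X n \<omega> - Y \<omega>)\<^sup>2) \<le> norm (2 * (X n \<omega>)\<^sup>2 + 2 * (Y \<omega>)\<^sup>2)"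
      by (intro AE_I2) simp
  qed measurable
qed

lemma L2_tendsto_unique:
  assumes Y: "L2_tendsto M X Y" and Z: "L2_tendsto M X Z"
  shows "AE \<omega> in M. Y \<omega> = Z \<omega>"
proof -
  have [measurable]: "Y \<in> borel_measurable M" "Z \<in> borel_measurable M"
    using Y Z by (auto simp: L2_tendsto_def)
  note iY = L2_tendsto_diff_integrable[OF Y] and iZ = L2_tendsto_diff_integrable[OF Z]
  have le: "(a - b)\<^sup>2 \<le> 2 * (x - a)\<^sup>2 + 2 * (x - b)\<^sup>2" for a b x :: real
    using zero_le_power2[of "(x - a) + (x - b)"] by (simp add: power2_eq_square algebra_simps)
  have int: "integrable M (\<lambda>\<omega>. (Y \<omega> - Z \<omega>)\<^sup>2)"
  proof (rule Bochner_Integration.integrable_bound)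
    show "integrable M (\<lambda>\<omega>. 2 * (X 0 \<omega> - Y \<omega>)\<^sup>2 + 2 * (X 0 \<omega> - Z \<omega>)\<^sup>2)" using iY iZ by simp
    show "AE \<omega> in M. norm ((Y \<omega> - Z \<omega>)\<^sup>2) \<le> norm (2 * (X 0 \<omega> - Y \<omega>)\<^sup>2 + 2 * (X 0 \<omega> - Z \<omega>)\<^sup>2)"
      using le by (intro AE_I2) simp
  qed measurable
  have bound: "(\<integral>\<omega>. (Y \<omega> - Z \<omega>)\<^sup>2 \<partial>M) \<le> 2 * (\<integral>\<omega>. (X n \<omega> - Y \<omega>)\<^sup>2 \<partial>M) + 2 * (\<integral>\<omega>. (X n \<omega> - Z \<omega>)\<^sup>2 \<partial>M)" for n
  proof -
    have "(\<integral>\<omega>. (Y \<omega> - Z \<omega>)\<^sup>2 \<partial>M) \<le> (\<integral>\<omega>. 2 * (X n \<omega> - Y \<omega>)\<^sup>2 + 2 * (X n \<omega> - Z \<omega>)\<^sup>2 \<partial>M)"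
      by (rule integral_mono[OF int]) (use iY iZ le in auto)
    then show ?thesis using iY[of n] iZ[of n] by simp
  qed
  have lim: "(\<lambda>n. 2 * (\<integral>\<omega>. (X n \<omega> - Y \<omega>)\<^sup>2 \<partial>M) + 2 * (\<integral>\<omega>. (X n \<omega> - Z \<omega>)\<^sup>2 \<partial>M)) \<longlonglongrightarrow> 2 * 0 + 2 * 0"
    by (intro tendsto_intros) (use Y Z in \<open>auto simp: L2_tendsto_def\<close>)
  have "(\<integral>\<omega>. (Y \<omega> - Z \<omega>)\<^sup>2 \<partial>M) \<le> 2 * 0 + 2 * 0"
    by (rule LIMSEQ_le_const[OF lim]) (use bound in auto)
  then have "(\<integral>\<omega>. (Y \<omega> - Z \<omega>)\<^sup>2 \<partial>M) = 0"
    by (intro order_antisym Bochner_Integration.integral_nonneg) auto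
  then have "AE \<omega> in M. (Y \<omega> - Z \<omega>)\<^sup>2 = 0"
    using integral_nonneg_eq_0_iff_AE[OF int] by simp
  then show ?thesis by eventually_elim simp
qed

lemma transition_sum_nonneg:
  assumes "\<And>x. 0 \<le> w x"
  shows "0 \<le> transition_sum m w h e"
  unfolding transition_sum_def by (intro csum_nonneg mult_nonneg_nonneg assms) (simp add: unit_mseq_def)

lemma empirical_kernel_nonneg: "0 \<le> empirical_kernel m h e"
  unfolding empirical_kernel_def
  by (intro transition_sum_nonneg) (simp add: csum_nonneg visit_nonneg)

lemma tail_partial_sum_empirical:
  "0 \<le> tail_partial_sum (empirical_kernel m h) i k n"
  "tail_partial_sum (empirical_kernel m h) i k n \<le> survival (empirical_kernel m h) (i, i, k)"
proof -
  show "0 \<le> tail_partial_sum (empirical_kernel m h) i k n"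
    unfolding tail_partial_sum_def by (intro sum_nonneg empirical_kernel_nonneg)
  have "incseq (tail_partial_sum (empirical_kernel m h) i k)"
    unfolding incseq_def tail_partial_sum_def
    by (auto intro!: sum_mono sum_mono2 simp: empirical_kernel_nonneg)
  moreover have "tail_convergent (empirical_kernel m h)"
    unfolding empirical_kernel_def by (rule tail_convergent_transition_sum)
  ultimately show "tail_partial_sum (empirical_kernel m h) i k n \<le> survival (empirical_kernel m h) (i, i, k)"
    by (intro incseq_le survival_tendsto)
qed

context markov_renewal
begin

lemma q_hat_measurable[measurable]: "(\<lambda>\<omega>. q_hat J S m \<omega> e) \<in> borel_measurable (Pr i)"
proof (cases e)
  case (fields a b k)
  have visit_meas[measurable]: "visit_count J S a m \<in> borel_measurable (Pr i)"
    unfolding visit_count_def[abs_def]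
  proof (rule measurable_compose_countable[OF _ renewal_count_measurable])
    fix N
    show "(\<lambda>\<omega>. \<Sum>n = 1..N. if J (n - 1) \<omega> = a then 1 else 0 :: real) \<in> borel_measurable (Pr i)" by measurable
  qed
  have [measurable]: "(\<lambda>\<omega>. \<Sum>n = 1..renewal_count S m \<omega>.
      if J (n - 1) \<omega> = a \<and> J n \<omega> = b \<and> sojourn S n \<omega> = k then 1 else 0 :: real) \<in> borel_measurable (Pr i)"
  proof (rule measurable_compose_countable[OF _ renewal_count_measurable])
    fix N
    show "(\<lambda>\<omega>. \<Sum>n = 1..N. if J (n - 1) \<omega> = a \<and> J n \<omega> = b \<and> sojourn S n \<omega> = k then 1 else 0 :: real)
        \<in> borel_measurable (Pr i)" by measurable
  qed
  show ?thesis unfolding fields q_hat_def prod.case by measurable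
qed

lemma mconv_measurable:
  assumes "\<And>e. (\<lambda>\<omega>. A \<omega> e) \<in> borel_measurable M" "\<And>e. (\<lambda>\<omega>. B \<omega> e) \<in> borel_measurable M"
  shows "(\<lambda>\<omega>. (A \<omega> \<circledast> B \<omega>) e) \<in> borel_measurable M"
  by (cases e) (simp only: mconv_apply, intro borel_measurable_sum borel_measurable_times assms)

lemma q_hat_inv_measurable: "(\<lambda>\<omega>. mconv_inv (q_hat J S m \<omega>) e) \<in> borel_measurable (Pr i)"
proof -
  have "(\<lambda>\<omega>. mconv_power (q_hat J S m \<omega>) n e) \<in> borel_measurable (Pr i)" for n e
  proof (induction n arbitrary: e)
    case (Suc n)
    show ?case unfolding mconv_power.simps by (intro mconv_measurable q_hat_measurable Suc)
  qed simp
  then show ?thesis unfolding mconv_inv_def by (rule borel_measurable_suminf)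
qed

lemma tail_q_hat_measurable: "(\<lambda>\<omega>. tail_partial_sum (q_hat J S m \<omega>) a k n) \<in> borel_measurable (Pr i)"
  unfolding tail_partial_sum_def by (intro borel_measurable_sum q_hat_measurable)

lemma survival_q_hat_measurable: "(\<lambda>\<omega>. survival (q_hat J S m \<omega>) (a, a, k)) \<in> borel_measurable (Pr i)"
  unfolding survival_def prod.case by (simp, intro borel_measurable_lim_metric tail_q_hat_measurable)

lemma AE_q_hat: "AE \<omega> in Pr i. q_hat J S m \<omega> = empirical_kernel m (observed J S (Suc m) \<omega>)"
  using AE_regular[of i] by eventually_elim (rule q_hat_observed, auto)

lemma survival_q_hat_L2:
  assumes bounded: "\<And>h. \<bar>survival (empirical_kernel m h) (a, a, k)\<bar> \<le> 1"
  shows "L2_tendsto (Pr i) (\<lambda>n \<omega>. tail_partial_sum (q_hat J S m \<omega>) a k n) (\<lambda>\<omega>. survival (q_hat J S m \<omega>) (a, a, k))"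
proof -
  interpret prob_space "Pr i" by (rule prob_space_Pr)
  let ?X = "\<lambda>n \<omega>. tail_partial_sum (q_hat J S m \<omega>) a k n" and ?Y = "\<lambda>\<omega>. survival (q_hat J S m \<omega>) (a, a, k)"
  have [measurable]: "?X n \<in> borel_measurable (Pr i)" "?Y \<in> borel_measurable (Pr i)" for n
    by (rule tail_q_hat_measurable survival_q_hat_measurable)+
  have AE: "AE \<omega> in Pr i. (\<forall>n. 0 \<le> ?X n \<omega> \<and> ?X n \<omega> \<le> ?Y \<omega>) \<and> ?Y \<omega> \<le> 1 \<and> (\<lambda>n. ?X n \<omega>) \<longlonglongrightarrow> ?Y \<omega>"
    using AE_q_hat[of m i]
  proof eventually_elim
    case (elim \<omega>)
    have "tail_convergent (empirical_kernel m (observed J S (Suc m) \<omega>))"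
      unfolding empirical_kernel_def by (rule tail_convergent_transition_sum)
    then show ?case unfolding elim
      using tail_partial_sum_empirical[of m "observed J S (Suc m) \<omega>" a k] survival_tendsto[of _ a k]
        bounded[of "observed J S (Suc m) \<omega>"] abs_le_D1 by blast
  qed
  have sq: "x\<^sup>2 \<le> 1" if "0 \<le> x" "x \<le> 1" for x :: real using that by (simp add: power_le_one)
  show ?thesis
    unfolding L2_tendsto_def
  proof (intro conjI allI)
    show "integrable (Pr i) (\<lambda>\<omega>. (?X n \<omega>)\<^sup>2)" for n
    proof (rule integrable_const_bound[where B=1])
      show "AE \<omega> in Pr i. norm ((?X n \<omega>)\<^sup>2) \<le> 1"
        using AE by eventually_elim (auto intro!: sq intro: order_trans)
    qed measurable
    show "integrable (Pr i) (\<lambda>\<omega>. (?Y \<omega>)\<^sup>2)"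
    proof (rule integrable_const_bound[where B=1])
      show "AE \<omega> in Pr i. norm ((?Y \<omega>)\<^sup>2) \<le> 1"
        using AE by eventually_elim (auto intro!: sq intro: order_trans)
    qed measurable
    have "(\<lambda>n. \<integral>\<omega>. (?X n \<omega> - ?Y \<omega>)\<^sup>2 \<partial>Pr i) \<longlonglongrightarrow> (\<integral>\<omega>. 0 \<partial>Pr i)"
    proof (rule integral_dominated_convergence[where w="\<lambda>_. 1"])
      show "AE \<omega> in Pr i. (\<lambda>n. (?X n \<omega> - ?Y \<omega>)\<^sup>2) \<longlonglongrightarrow> 0"
        using AE
      proof eventually_elim
        case (elim \<omega>)
        then have "(\<lambda>n. (?X n \<omega> - ?Y \<omega>)\<^sup>2) \<longlonglongrightarrow> (?Y \<omega> - ?Y \<omega>)\<^sup>2" by (intro tendsto_intros) auto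
        then show ?case by simp
      qed
      show "AE \<omega> in Pr i. norm ((?X n \<omega> - ?Y \<omega>)\<^sup>2) \<le> 1" for n
        using AE
      proof eventually_elim
        case (elim \<omega>)
        then have x: "0 \<le> ?X n \<omega>" "?X n \<omega> \<le> ?Y \<omega>" "?Y \<omega> \<le> 1" by auto
        then have "(?Y \<omega> - ?X n \<omega>)\<^sup>2 \<le> 1" by (intro sq) linarith+
        then show ?case by (simp add: power2_commute)
      qed
    qed auto
    then show "(\<lambda>n. \<integral>\<omega>. (?X n \<omega> - ?Y \<omega>)\<^sup>2 \<partial>Pr i) \<longlonglongrightarrow> 0" by simp
  qed measurable
qed

lemma random_survival_q_hat:
  assumes bounded: "\<And>(h :: 'e hist) e. \<bar>survival (empirical_kernel m h) e\<bar> \<le> 1"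
  shows "(\<lambda>\<omega>. random_survival (Pr i) (q_hat J S m) \<omega> e) \<in> borel_measurable (Pr i)"
    and "AE \<omega> in Pr i. random_survival (Pr i) (q_hat J S m) \<omega> = survival (q_hat J S m \<omega>)"
proof -
  define X where "X a k n \<omega> = tail_partial_sum (q_hat J S m \<omega>) a k n" for a k n \<omega>
  have L2: "L2_tendsto (Pr i) (X a k) (\<lambda>\<omega>. survival (q_hat J S m \<omega>) (a, a, k))" for a k
    unfolding X_def[abs_def] by (rule survival_q_hat_L2) (rule bounded)
  then have lim: "L2_tendsto (Pr i) (X a k) (L2_lim (Pr i) (X a k))" for a k
    unfolding L2_lim_def by (rule someI[of "L2_tendsto (Pr i) (X a k)"])
  have rs: "random_survival (Pr i) (q_hat J S m) \<omega> (a, b, k) = (if a = b then L2_lim (Pr i) (X a k) \<omega> else 0)" for \<omega> a b k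
    by (simp add: random_survival_def X_def[abs_def])
  show "(\<lambda>\<omega>. random_survival (Pr i) (q_hat J S m) \<omega> e) \<in> borel_measurable (Pr i)"
  proof (cases e)
    case (fields a b k)
    have "L2_lim (Pr i) (X a k) \<in> borel_measurable (Pr i)" using lim[of a k] by (simp add: L2_tendsto_def)
    then show ?thesis by (cases "a = b") (simp_all add: fields rs)
  qed
  have "AE \<omega> in Pr i. \<forall>z. L2_lim (Pr i) (X (fst z) (snd z)) \<omega> = survival (q_hat J S m \<omega>) (fst z, fst z, snd z)"
    by (subst AE_all_countable) (intro allI L2_tendsto_unique[OF lim L2])
  then show "AE \<omega> in Pr i. random_survival (Pr i) (q_hat J S m) \<omega> = survival (q_hat J S m \<omega>)"
  proof eventually_elim
    case (elim \<omega>)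
    show ?case
    proof (rule ext, clarify)
      fix a b k
      show "random_survival (Pr i) (q_hat J S m) \<omega> (a, b, k) = survival (q_hat J S m \<omega>) (a, b, k)"
        using elim[rule_format, of "(a, k)"] by (cases "a = b") (auto simp: rs survival_off_diagonal)
    qed
  qed
qed

end

theorem theorem4p3:
  fixes q :: "'e::finite \<times> 'e \<times> nat \<Rightarrow> real"
    and Pr :: "'e \<Rightarrow> 'w measure"
    and J :: "nat \<Rightarrow> 'w \<Rightarrow> 'e"
    and S :: "nat \<Rightarrow> 'w \<Rightarrow> nat"
    and \<mu> :: "'e \<Rightarrow> real"
  assumes "markov_renewal_chain q Pr J S"
    and A1: "chain_irreducible Pr J"
    and A2: "chain_aperiodic Pr J S"
    and A3: "chain_positive_recurrent Pr J S"
  defines "\<mu> \<equiv> \<lambda>i. enn2real (mean_recurrence Pr J S i)"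
  shows "(\<forall>ee. (\<lambda>e'. q_bar q \<mu> e' * mtensor (V_unit q e') (V_unit q e') ee) summable_on UNIV) \<and>
    (\<exists>\<gamma> :: ('e \<times> 'e \<times> nat \<Rightarrow> real) measure.
      centered_gaussian_law (V_P q \<mu>) \<gamma> \<and>
      (\<forall>i\<^sub>0. converges_in_distribution (Pr i\<^sub>0)
        (\<lambda>m \<omega> e. sqrt (real m) * (P_hat (Pr i\<^sub>0) J S m \<omega> e - P_mseq Pr J S e)) \<gamma>))"
proof -
  interpret markov_renewal q Pr J S by standard fact
  have hm: "hitting_mean i i < \<infinity>" for i
    using A3 mean_recurrence_eq by (simp add: chain_positive_recurrent_def)
  have fin: "hitting_mean i x < \<infinity>" for i x
    using irreducible_reach[OF A1, of i x] hitting_mean_finite[OF hm] by blast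
  have \<mu>: "\<mu> i = enn2real (hitting_mean i i)" for i by (simp add: \<mu>_def mean_recurrence_eq)
  have \<mu>_pos: "0 < \<mu> i" for i
  proof -
    have "1 \<le> hitting_mean i i"
      using mean_sojourn_ge_1[of i] hitting_mean_unfold[of i i] by (simp add: add_increasing2)
    then have "0 < hitting_mean i i" using less_le_trans[OF zero_less_one] by blast
    with hm[of i] show ?thesis unfolding \<mu> by (simp add: enn2real_positive_iff)
  qed
  have lln: "(\<lambda>m. measure_pmf.expectation (history K i\<^sub>0 (Suc m)) (\<lambda>h. (\<mu> x * wsum m (visit x) h / m - 1)\<^sup>2)) \<longlonglongrightarrow> 0" for i\<^sub>0 x
    unfolding \<mu> by (rule visits_law_of_large_numbers[OF poisson_equation[OF fin]])
  have "psd (\<lambda>a b. V_P q \<mu> (a, b))" by (rule psd_V_P) (rule less_imp_le[OF \<mu>_pos])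
  from centered_gaussian_law_exists[of "V_P q \<mu>", OF this]
  obtain \<gamma> where \<gamma>: "centered_gaussian_law (V_P q \<mu>) \<gamma>"
    and \<gamma>_char: "\<And>F c. finite F \<Longrightarrow> (\<integral>y. iexp (\<Sum>e\<in>F. c e * y e) \<partial>\<gamma>) =
      of_real (exp (- quad_form (\<lambda>a b. V_P q \<mu> (a, b)) F c / 2))"
    by blast
  have conv: "converges_in_distribution (Pr i\<^sub>0)
      (\<lambda>m \<omega> e. sqrt (real m) * (P_hat (Pr i\<^sub>0) J S m \<omega> e - P_mseq Pr J S e)) \<gamma>" (is "converges_in_distribution _ ?Y _") for i\<^sub>0
  proof -
    interpret L: semi_markov_lln q \<mu> i\<^sub>0 by standard (rule \<mu>_pos lln)+
    interpret prob_space "Pr i\<^sub>0" by (rule prob_space_Pr)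
    note surv = random_survival_q_hat[OF L.empirical_survival_bounded]
    have Ym: "?Y m \<in> borel_measurable (Pr i\<^sub>0)" for m
    proof (rule measurable_coordinatewise_then_product)
      fix e
      have "(\<lambda>\<omega>. P_hat (Pr i\<^sub>0) J S m \<omega> e) \<in> borel_measurable (Pr i\<^sub>0)"
        unfolding P_hat_def by (intro mconv_measurable q_hat_inv_measurable surv)
      then show "(\<lambda>\<omega>. ?Y m \<omega> e) \<in> borel_measurable (Pr i\<^sub>0)" by measurable
    qed
    have Y_AE: "AE \<omega> in Pr i\<^sub>0. ?Y m \<omega> = (\<lambda>e. sqrt (real m) * (L.P_emp m (observed J S (Suc m) \<omega>) e - L.P_true e))" for m
      using surv(2)[of i\<^sub>0 m] AE_q_hat[of m i\<^sub>0]
      by eventually_elim (simp only: P_hat_def semi_markov_law_def P_mseq_eq)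
    have "(\<lambda>m. \<integral>\<omega>. f (?Y m \<omega>) \<partial>Pr i\<^sub>0) \<longlonglongrightarrow> (\<integral>y. f y \<partial>\<gamma>)"
      if f: "continuous_on UNIV f" "bounded (range f)" for f :: "('e \<times> 'e \<times> nat \<Rightarrow> real) \<Rightarrow> real"
    proof -
      have "(\<lambda>m. \<integral>y. f y \<partial>distr (Pr i\<^sub>0) borel (?Y m)) \<longlonglongrightarrow> (\<integral>y. f y \<partial>\<gamma>)"
      proof (rule product_weak_convI[OF _ _ _ _ _ f])
        show "prob_space (distr (Pr i\<^sub>0) borel (?Y m))" for m by (rule prob_space_distr[OF Ym])
        show "prob_space \<gamma>" "sets \<gamma> = sets borel" using \<gamma> by (simp_all add: centered_gaussian_law_def)
        fix F :: "('e \<times> 'e \<times> nat) set" and c assume F: "finite F"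
        have lm: "(\<lambda>y. \<Sum>e\<in>F. c e * y e) \<in> borel_measurable borel" for c :: "'e \<times> 'e \<times> nat \<Rightarrow> real"
          by (rule linear_forms_measurable) (use F in \<open>auto simp: linear_forms_def\<close>)
        have "(\<integral>y. iexp (\<Sum>e\<in>F. c e * y e) \<partial>distr (Pr i\<^sub>0) borel (?Y m)) =
            measure_pmf.expectation (history K i\<^sub>0 (Suc m))
              (\<lambda>h. iexp (\<Sum>e\<in>F. c e * (sqrt (real m) * (L.P_emp m h e - L.P_true e))))" for m
        proof -
          have [measurable]: "(\<lambda>y. \<Sum>e\<in>F. c e * y e) \<in> borel_measurable borel" by (rule lm)
          have im: "(\<lambda>y. iexp (\<Sum>e\<in>F. c e * y e)) \<in> borel_measurable borel"
            by measurable
          have "(\<integral>y. iexp (\<Sum>e\<in>F. c e * y e) \<partial>distr (Pr i\<^sub>0) borel (?Y m)) = (\<integral>\<omega>. iexp (\<Sum>e\<in>F. c e * ?Y m \<omega> e) \<partial>Pr i\<^sub>0)"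
            by (rule integral_distr[OF Ym im])
          also have "\<dots> = (\<integral>\<omega>. (\<lambda>h. iexp (\<Sum>e\<in>F. c e * (sqrt (real m) * (L.P_emp m h e - L.P_true e)))) (observed J S (Suc m) \<omega>) \<partial>Pr i\<^sub>0)"
          proof (rule integral_cong_AE)
            show "(\<lambda>\<omega>. iexp (\<Sum>e\<in>F. c e * ?Y m \<omega> e)) \<in> borel_measurable (Pr i\<^sub>0)"
              by (rule measurable_compose[OF Ym im])
            show "(\<lambda>\<omega>. (\<lambda>h. iexp (\<Sum>e\<in>F. c e * (sqrt (real m) * (L.P_emp m h e - L.P_true e)))) (observed J S (Suc m) \<omega>))
                \<in> borel_measurable (Pr i\<^sub>0)"
              by (rule measurable_compose[OF observed_measurable]) simp
            show "AE \<omega> in Pr i\<^sub>0. iexp (\<Sum>e\<in>F. c e * ?Y m \<omega> e) =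
                (\<lambda>h. iexp (\<Sum>e\<in>F. c e * (sqrt (real m) * (L.P_emp m h e - L.P_true e)))) (observed J S (Suc m) \<omega>)"
              using Y_AE[of m] by eventually_elim (simp only: fun_eq_iff)
          qed
          also have "\<dots> = measure_pmf.expectation (history K i\<^sub>0 (Suc m))
              (\<lambda>h. iexp (\<Sum>e\<in>F. c e * (sqrt (real m) * (L.P_emp m h e - L.P_true e))))"
            by (rule integral_observed)
          finally show ?thesis .
        qed
        then show "(\<lambda>m. \<integral>y. iexp (\<Sum>e\<in>F. c e * y e) \<partial>distr (Pr i\<^sub>0) borel (?Y m)) \<longlonglongrightarrow>
            (\<integral>y. iexp (\<Sum>e\<in>F. c e * y e) \<partial>\<gamma>)"
          using L.estimator_iexp_limit[OF F, of c] by (simp only: \<gamma>_char[OF F])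
      qed simp
      then show ?thesis
        using integral_distr[OF Ym borel_measurable_continuous_onI[OF f(1)]] by simp
    qed
    then show ?thesis using Ym unfolding converges_in_distribution_def by blast
  qed
  have "(\<lambda>e'. q_bar q \<mu> e' * mtensor (V_unit q e') (V_unit q e') ee) summable_on UNIV" for ee
    using V_P_summable_and_eq(1)[of \<mu> "fst ee" "snd ee"] by simp
  with \<gamma> conv show ?thesis by blast
qed

end
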